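(* Let $\mathfrak g$ be a tame reduced extended affine Lie algebra of rank $>1$ and of nullity at least one, admitting a Chevalley automorphism, whose coordinate ring 2-cocycle is elementary. Let $\mathbb K$ be a field extension of the prime field $\mathbb F_p$ for some prime $p$, and let $\mathrm{Ad}(G)_{\mathbb K}$ be the adjoint form over $\mathbb K$ of the group of extended affine Lie type associated to $\mathfrak g$. Then: (i) The group $\mathrm{Ad}(G)_{\mathbb K}$ is infinite. (ii) If $\mathbb K$ is finite with characteristic at least $5$, then $\mathrm{Ad}(G)_{\mathbb K}$ is finitely generated.
   Context: Extended affine Lie algebra (EALA) over $\mathbb C$: a triple $(\mathfrak g,(\cdot,\cdot),\mathfrak h)$ with $\mathfrak g$ a Lie algebra, $\mathfrak h$ a non-trivial subalgebra, $(\cdot,\cdot)$ a symmetric bilinear form on $\mathfrak g$ such that: (A1) the form is invariant and non-degenerate; (A2) $\mathfrak h$ is finite-dimensional and $\mathfrak g=\sum_{\alpha\in\mathfrak h^\star}\mathfrak g_\alpha$, $\mathfrak g_\alpha=\{x\mid [h,x]=\alpha(h)x\ \forall h\in\mathfrak h\}$, $\mathfrak g_0=\mathfrak h$; let $R=\{\alpha\mid\mathfrak g_\alpha\ne0\}$, transfer the form to $\mathfrak h^\star$ by $(\alpha,\beta)=(t_\alpha,t_\beta)$ where $\alpha(h)=(h,t_\alpha)$, let $V=\mathrm{span}_{\mathbb R}R$, $V^0$ the radical of the form on $V$, $R^0=\{\alpha\in R\mid(\alpha,\alpha)=0\}$, $R^\times=R\setminus R^0$; (A3) for $\alpha\in R^\times$,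 $x\in\mathfrak g_\alpha$, $\mathrm{ad}(x)$ is locally nilpotent; (A4) the $\mathbb Z$-span of $R$ is free abelian of rank $\dim V$; (A5) $R^\times$ is indecomposable, and $R^0=(R^\times-R^\times)\cap V^0$. The image $\bar R$ of $R$ in $V/V^0$ is an irreducible finite root system; the rank of $\mathfrak g$ is the rank of $\bar R$, the nullity is $\dim V^0$, and $\mathfrak g$ is reduced if $\bar R$ is. Fixing preimages in $R$ of a base of $\bar R$ with real span $\dot V$, $\dot R=\{\dot\alpha\in\dot V\mid\dot\alpha+\sigma\in R\text{ for some }\sigma\in V^0\}$ is a finite root system isomorphic to $\bar R$, and each $\alpha\in R^\times$ has the form $\dot\alpha+\delta$, $\dot\alpha\in\dot R$, $\delta\in\Lambda:=\langle R^0\rangle$. The core $\mathfrak g_c$ is the subalgebra generated by the $\mathfrak g_\alpha$, $\alpha\in R^\times$. $\mathfrak g$ is tame if $\{x\in\mathfrak g\mid(x,\mathfrak g_c)=0\}$ equals the center of $\mathfrak g_c$. Coordinate ring: $\mathfrak g$ is assumed to be coordinatized by a quantum torus $\mathbb C_\sigma=\bigoplus_{\delta\in\Lambda}\mathbb Cc_\delta$, $c_\delta c_{\delta'}=\sigma(\delta,\delta')c_{\delta+\delta'}$, for a 2-cocycle $\sigma:\Lambda\times\Lambda\to\mathbb C^\times$ with $\sigma(\lambda,\tau)=\sigma(\tau,\lambda)=\sigma(-\lambda,-\tau)$, $\sigma(0,0)=1$; the non-isotropic root space $\mathfrak g_{\dot\alpha+\delta}$ is spanned by an element written $c_\delta X_{\dot\alpha}$,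 with $X_{\dot\alpha}$ a root vector for $\dot\alpha$. The cocycle $\sigma$ is elementary if its image lies in $\{\pm1\}$. (It is also assumed that $\mathfrak g$ is such that a group can be associated to it by integration.) A Chevalley automorphism of $\mathfrak g$ is a finite order automorphism $\tau$ with $\tau(h)=-h$ for $h\in\mathfrak h$. A Chevalley system for $(\mathfrak g,\tau)$ is a set $\{x_\alpha\in\mathfrak g_\alpha\mid\alpha\in R^\times\}$ with $[x_\alpha,x_{-\alpha}]=h_\alpha:=2t_\alpha/(\alpha,\alpha)$ and $\tau(x_\alpha)=-x_{-\alpha}$. It yields the $\mathbb Z$-form $\mathfrak g_c^{\mathbb Z}=\mathrm{span}_{\mathbb Z}\{x_\alpha,[x_{\alpha+\delta},x_{-\alpha}],h_\alpha\mid\alpha\in R^\times,0\ne\delta\in R^0,\alpha+\delta\in R\}$ of $\mathfrak g_c$, which is independent of the system up to isomorphism and stable under the divided powers $(\mathrm{ad}\,x_\alpha)^k/k!$. Set $\mathfrak g_c^{\mathbb K}=\mathfrak g_c^{\mathbb Z}\otimes_{\mathbb Z}\mathbb K$. For $\alpha\in R^\times$, $c\in\mathbb K$, $\exp(\mathrm{ad}^{\mathbb K}(x_\alpha\otimes c))$ is the automorphism $v\otimes s\mapsto\sum_{k\ge0}\frac{(\mathrm{ad}\,x_\alpha)^k}{k!}(v)\otimes c^ks$ of $\mathfrak g_c^{\mathbb K}$, and $$\mathrm{Ad}(G)_{\mathbb K}:=\langle\exp(\mathrm{ad}^{\mathbb K}(x_\alpha\otimes c))\mid\alpha\in R^\times,\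 c\in\mathbb K\rangle\le\mathrm{Aut}(\mathfrak g_c^{\mathbb K}).$$ *)

theory Defs
  imports
    Complex_Main
    "HOL-Library.Function_Algebras"
    "HOL-Library.Poly_Mapping"
    "HOL-Algebra.Bij"
    "HOL-Algebra.Free_Abelian_Groups"
    "HOL-Computational_Algebra.Computational_Algebra"
begin

section \<open>Lie algebras over the complex numbers\<close>

locale lie_algebra = vector_space scale
  for scale :: "complex \<Rightarrow> 'g::ab_group_add \<Rightarrow> 'g" +
  fixes lie :: "'g \<Rightarrow> 'g \<Rightarrow> 'g"
  assumes lie_add_left: "lie (x + y) z = lie x z + lie y z"
    and lie_add_right: "lie x (y + z) = lie x y + lie x z"
    and lie_scale_left: "lie (scale c x) y = scale c (lie x y)"
    and lie_scale_right: "lie x (scale c y) = scale c (lie x y)"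
    and lie_self: "lie x x = 0"
    and jacobi: "lie x (lie y z) + lie y (lie z x) + lie z (lie x y) = 0"
begin

definition subalgebra :: "'g set \<Rightarrow> bool" where
  "subalgebra S \<longleftrightarrow> subspace S \<and> (\<forall>x\<in>S. \<forall>y\<in>S. lie x y \<in> S)"

definition finite_dim :: "'g set \<Rightarrow> bool" where
  "finite_dim S \<longleftrightarrow> (\<exists>B. finite B \<and> S \<subseteq> span B)"

definition center_of :: "'g set \<Rightarrow> 'g set" where
  "center_of S = {x\<in>S. \<forall>y\<in>S. lie x y = 0}"

definition lie_automorphism :: "('g \<Rightarrow> 'g) \<Rightarrow> bool" where
  "lie_automorphism \<tau> \<longleftrightarrow> bij \<tau> \<and>
     (\<forall>x y. \<tau> (x + y) = \<tau> x + \<tau> y) \<and> (\<forall>c x. \<tau> (scale c x) = scale c (\<tau> x)) \<and>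
     (\<forall>x y. \<tau> (lie x y) = lie (\<tau> x) (\<tau> y))"

text \<open>The bracket of \<open>L \<otimes> \<complex>\<^sub>\<sigma>\<close>, where \<open>c\<^sub>\<delta> c\<^sub>\<epsilon> = \<sigma>(\<delta>, \<epsilon>) c\<^bsub>\<delta>+\<epsilon>\<^esub>\<close> in \<open>\<complex>\<^sub>\<sigma>\<close>. The element \<open>X \<otimes> c\<^sub>\<delta>\<close> is
  \<open>Poly_Mapping.single \<delta> X\<close>, so that \<open>[X \<otimes> c\<^sub>\<delta>, Y \<otimes> c\<^sub>\<epsilon>] = [X, Y] \<otimes> c\<^sub>\<delta> c\<^sub>\<epsilon>\<close>.\<close>
definition qtorus_lie ::
    "('d::ab_group_add \<Rightarrow> 'd \<Rightarrow> complex) \<Rightarrow> ('d \<Rightarrow>\<^sub>0 'g) \<Rightarrow> ('d \<Rightarrow>\<^sub>0 'g) \<Rightarrow> ('d \<Rightarrow>\<^sub>0 'g)" where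
  "qtorus_lie \<sigma> u v = (\<Sum>\<delta>\<in>Poly_Mapping.keys u. \<Sum>\<epsilon>\<in>Poly_Mapping.keys v.
     Poly_Mapping.single (\<delta> + \<epsilon>)
       (scale (\<sigma> \<delta> \<epsilon>) (lie (Poly_Mapping.lookup u \<delta>) (Poly_Mapping.lookup v \<epsilon>))))"

definition zspan :: "'g set \<Rightarrow> 'g set" where
  "zspan S = module.span (\<lambda>(n::int) x. scale (of_int n) x) S"

end


section \<open>Real and integral spans of complex-valued functions\<close>

interpretation real_fun: vector_space
  "\<lambda>(r::real) (f::'a \<Rightarrow> complex). (\<lambda>x. complex_of_real r * f x)"
  by unfold_locales (auto simp: fun_eq_iff algebra_simps)

interpretation int_fun: Modules.module
  "\<lambda>(n::int) (f::'a \<Rightarrow> complex). (\<lambda>x. of_int n * f x)"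
  by unfold_locales (auto simp: fun_eq_iff algebra_simps)


section \<open>Extended affine Lie algebras\<close>

locale eala_data = lie_algebra scale lie
  for scale :: "complex \<Rightarrow> 'g::ab_group_add \<Rightarrow> 'g" and lie +
  fixes form :: "'g \<Rightarrow> 'g \<Rightarrow> complex" and H :: "'g set"
begin

text \<open>A functional on \<open>H\<close> is represented by its extension by zero to the whole type, so that
  equality, sums and multiples of functionals are those of functions.\<close>
definition dual :: "('g \<Rightarrow> complex) set" where
  "dual = {\<alpha>. (\<forall>x\<in>H. \<forall>y\<in>H. \<alpha> (x + y) = \<alpha> x + \<alpha> y) \<and>
              (\<forall>c. \<forall>x\<in>H. \<alpha> (scale c x) = c * \<alpha> x) \<and> (\<forall>x. x \<notin> H \<longrightarrow> \<alpha> x = 0)}"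

definition root_space :: "('g \<Rightarrow> complex) \<Rightarrow> 'g set" where
  "root_space \<alpha> = {x. \<forall>h\<in>H. lie h x = scale (\<alpha> h) x}"

definition R :: "('g \<Rightarrow> complex) set" where
  "R = {\<alpha>\<in>dual. root_space \<alpha> \<noteq> {0}}"

definition t :: "('g \<Rightarrow> complex) \<Rightarrow> 'g" where
  "t \<alpha> = (THE u. u \<in> H \<and> (\<forall>h\<in>H. \<alpha> h = form h u))"

definition dform :: "('g \<Rightarrow> complex) \<Rightarrow> ('g \<Rightarrow> complex) \<Rightarrow> complex" where
  "dform \<alpha> \<beta> = form (t \<alpha>) (t \<beta>)"

definition V :: "('g \<Rightarrow> complex) set" where
  "V = real_fun.span R"

definition V0 :: "('g \<Rightarrow> complex) set" where
  "V0 = {v\<in>V. \<forall>w\<in>V. dform v w = 0}"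

definition R0 :: "('g \<Rightarrow> complex) set" where
  "R0 = {\<alpha>\<in>R. dform \<alpha> \<alpha> = 0}"

definition Rx :: "('g \<Rightarrow> complex) set" where
  "Rx = R - R0"

definition \<Lambda> :: "('g \<Rightarrow> complex) set" where
  "\<Lambda> = int_fun.span R0"

definition core :: "'g set" where
  "core = subalgebra hull (\<Union>\<alpha>\<in>Rx. root_space \<alpha>)"

definition tame :: bool where
  "tame \<longleftrightarrow> {x. \<forall>y\<in>core. form x y = 0} = center_of core"

definition nullity :: nat where
  "nullity = real_fun.dim V0"

text \<open>The rank of the root system \<open>Rbar\<close> is the dimension of the space \<open>V / V0\<close> that it spans.\<close>
definition rank :: nat where
  "rank = real_fun.dim V - real_fun.dim V0"

definition cls :: "('g \<Rightarrow> complex) \<Rightarrow> ('g \<Rightarrow> complex) set" where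
  "cls v = {v + w | w. w \<in> V0}"

definition Rbar :: "('g \<Rightarrow> complex) set set" where
  "Rbar = cls ` R"

definition reduced :: bool where
  "reduced \<longleftrightarrow> (\<forall>\<alpha>\<in>R. \<forall>r::real. cls \<alpha> \<noteq> cls 0 \<and> cls (\<lambda>x. complex_of_real r * \<alpha> x) \<in> Rbar - {cls 0}
                   \<longrightarrow> r = 1 \<or> r = - 1)"

text \<open>\<open>B\<close> consists of preimages in \<open>R\<close>, one for each element, of a base of \<open>Rbar\<close>.\<close>
definition lifted_base :: "('g \<Rightarrow> complex) set \<Rightarrow> bool" where
  "lifted_base B \<longleftrightarrow> finite B \<and> B \<subseteq> R \<and>
     (\<forall>c::_ \<Rightarrow> real. (\<Sum>\<pi>\<in>B. (\<lambda>x. complex_of_real (c \<pi>) * \<pi> x)) \<in> V0 \<longrightarrow> (\<forall>\<pi>\<in>B. c \<pi> = 0)) \<and>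
     (\<forall>\<alpha>\<in>R. \<exists>n::_ \<Rightarrow> nat. cls \<alpha> = cls (\<Sum>\<pi>\<in>B. (\<lambda>x. of_nat (n \<pi>) * \<pi> x)) \<or>
                          cls \<alpha> = cls (- (\<Sum>\<pi>\<in>B. (\<lambda>x. of_nat (n \<pi>) * \<pi> x))))"

definition Rdot :: "('g \<Rightarrow> complex) set \<Rightarrow> ('g \<Rightarrow> complex) set" where
  "Rdot B = {\<alpha>\<in>real_fun.span B. \<exists>\<delta>\<in>V0. \<alpha> + \<delta> \<in> R}"

definition torus_cocycle :: "(('g \<Rightarrow> complex) \<Rightarrow> ('g \<Rightarrow> complex) \<Rightarrow> complex) \<Rightarrow> bool" where
  "torus_cocycle \<sigma> \<longleftrightarrow>
     (\<forall>\<delta>\<in>\<Lambda>. \<forall>\<epsilon>\<in>\<Lambda>. \<sigma> \<delta> \<epsilon> \<noteq> 0 \<and> \<sigma> \<delta> \<epsilon> = \<sigma> \<epsilon> \<delta> \<and> \<sigma> \<delta> \<epsilon> = \<sigma> (- \<delta>) (- \<epsilon>)) \<and>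
     (\<forall>\<delta>\<in>\<Lambda>. \<forall>\<epsilon>\<in>\<Lambda>. \<forall>\<zeta>\<in>\<Lambda>. \<sigma> \<delta> \<epsilon> * \<sigma> (\<delta> + \<epsilon>) \<zeta> = \<sigma> \<epsilon> \<zeta> * \<sigma> \<delta> (\<epsilon> + \<zeta>)) \<and>
     \<sigma> 0 0 = 1"

definition elementary :: "(('g \<Rightarrow> complex) \<Rightarrow> ('g \<Rightarrow> complex) \<Rightarrow> complex) \<Rightarrow> bool" where
  "elementary \<sigma> \<longleftrightarrow> (\<forall>\<delta>\<in>\<Lambda>. \<forall>\<epsilon>\<in>\<Lambda>. \<sigma> \<delta> \<epsilon> \<in> {1, - 1})"

text \<open>Coordinatization by the quantum torus \<open>\<complex>\<^sub>\<sigma>\<close>: a homomorphism \<open>\<Phi>\<close> from the core to \<open>L \<otimes> \<complex>\<^sub>\<sigma>\<close>,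
  for a finite-dimensional Lie algebra \<open>L\<close>, under which the spanning vector \<open>e\<close> of the root space
  of \<open>\<alpha> + \<delta>\<close> is \<open>c\<^sub>\<delta> X\<close> with \<open>X\<close> a root vector of \<open>L\<close> for \<open>\<alpha>\<close>; the centre of the core is not seen
  by \<open>\<Phi>\<close>. The root spaces of \<open>L\<close> may have dimension greater than one, as happens for the core of
  a twisted algebra inside \<open>L \<otimes> \<complex>\<^sub>\<sigma>\<close>, and then \<open>X\<close> may vary with \<open>\<delta>\<close>.\<close>
definition coordinatized ::
    "('g \<Rightarrow> complex) set \<Rightarrow> (('g \<Rightarrow> complex) \<Rightarrow> ('g \<Rightarrow> complex) \<Rightarrow> complex) \<Rightarrow>
     (complex \<Rightarrow> 'l::ab_group_add \<Rightarrow> 'l) \<Rightarrow> ('l \<Rightarrow> 'l \<Rightarrow> 'l) \<Rightarrow> bool" where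
  "coordinatized B \<sigma> scaleL lieL \<longleftrightarrow> torus_cocycle \<sigma> \<and>
     lie_algebra scaleL lieL \<and> lie_algebra.finite_dim scaleL UNIV \<and>
     (\<exists>\<Phi> :: 'g \<Rightarrow> ('g \<Rightarrow> complex) \<Rightarrow>\<^sub>0 'l.
        (\<forall>x\<in>core. Poly_Mapping.keys (\<Phi> x) \<subseteq> \<Lambda>) \<and>
        (\<forall>x\<in>core. \<forall>y\<in>core. \<Phi> (x + y) = \<Phi> x + \<Phi> y) \<and>
        (\<forall>c. \<forall>x\<in>core. \<forall>\<delta>. Poly_Mapping.lookup (\<Phi> (scale c x)) \<delta> =
                            scaleL c (Poly_Mapping.lookup (\<Phi> x) \<delta>)) \<and>
        (\<forall>x\<in>core. \<forall>y\<in>core. \<Phi> (lie x y) = lie_algebra.qtorus_lie scaleL lieL \<sigma> (\<Phi> x) (\<Phi> y)) \<and>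
        (\<forall>\<alpha>\<in>Rdot B - {0}. \<forall>\<delta>\<in>\<Lambda>. \<alpha> + \<delta> \<in> R \<longrightarrow>
           (\<exists>e X. root_space (\<alpha> + \<delta>) = span {e} \<and> \<Phi> e = Poly_Mapping.single \<delta> X \<and> X \<noteq> 0 \<and>
              (\<forall>h\<in>H \<inter> core. lieL (Poly_Mapping.lookup (\<Phi> h) 0) X = scaleL (\<alpha> h) X))))"

definition chevalley_automorphism :: "('g \<Rightarrow> 'g) \<Rightarrow> bool" where
  "chevalley_automorphism \<tau> \<longleftrightarrow> lie_automorphism \<tau> \<and> (\<exists>n>0. \<tau> ^^ n = id) \<and> (\<forall>h\<in>H. \<tau> h = - h)"

definition coroot :: "('g \<Rightarrow> complex) \<Rightarrow> 'g" where
  "coroot \<alpha> = scale (2 / dform \<alpha> \<alpha>) (t \<alpha>)"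

text \<open>Only the values of \<open>x\<close> on \<open>Rx\<close> matter.\<close>
definition chevalley_system :: "('g \<Rightarrow> 'g) \<Rightarrow> (('g \<Rightarrow> complex) \<Rightarrow> 'g) \<Rightarrow> bool" where
  "chevalley_system \<tau> x \<longleftrightarrow> (\<forall>\<alpha>\<in>Rx. x \<alpha> \<in> root_space \<alpha> \<and>
     lie (x \<alpha>) (x (- \<alpha>)) = coroot \<alpha> \<and> \<tau> (x \<alpha>) = - x (- \<alpha>))"

definition core_Z :: "(('g \<Rightarrow> complex) \<Rightarrow> 'g) \<Rightarrow> 'g set" where
  "core_Z x = zspan ({x \<alpha> | \<alpha>. \<alpha> \<in> Rx} \<union>
     {lie (x (\<alpha> + \<delta>)) (x (- \<alpha>)) | \<alpha> \<delta>. \<alpha> \<in> Rx \<and> \<delta> \<in> R0 \<and> \<delta> \<noteq> 0 \<and> \<alpha> + \<delta> \<in> R} \<union>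
     {coroot \<alpha> | \<alpha>. \<alpha> \<in> Rx})"

definition ad_divpow :: "'g \<Rightarrow> nat \<Rightarrow> 'g \<Rightarrow> 'g" where
  "ad_divpow y k v = scale (1 / fact k) ((lie y ^^ k) v)"

end

locale eala = eala_data scale lie form H
  for scale :: "complex \<Rightarrow> 'g::ab_group_add \<Rightarrow> 'g" and lie form H +
  assumes subalgebra_H: "subalgebra H" and H_nontrivial: "H \<noteq> {0}"
    and form_sym: "form x y = form y x"
    and form_add: "form (x + y) z = form x z + form y z"
    and form_scale: "form (scale c x) y = c * form x y"
    and A1_invariant: "form (lie x y) z = form x (lie y z)"
    and A1_nondegenerate: "(\<And>y. form x y = 0) \<Longrightarrow> x = 0"
    and A2_finite_dim: "finite_dim H"
    and A2_sum: "span (\<Union>\<alpha>\<in>dual. root_space \<alpha>) = UNIV"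
    and A2_zero: "root_space 0 = H"
    and A3: "\<alpha> \<in> Rx \<Longrightarrow> x \<in> root_space \<alpha> \<Longrightarrow> \<exists>n. (lie x ^^ n) y = 0"
    and A4: "\<exists>B. finite B \<and> int_fun.independent B \<and> int_fun.span B = int_fun.span R \<and>
               card B = real_fun.dim V"
    and A5_indecomposable: "\<not> (\<exists>A B. A \<noteq> {} \<and> B \<noteq> {} \<and> A \<inter> B = {} \<and> A \<union> B = Rx \<and>
               (\<forall>\<alpha>\<in>A. \<forall>\<beta>\<in>B. dform \<alpha> \<beta> = 0))"
    and A5_isotropic: "R0 = {\<alpha> - \<beta> | \<alpha> \<beta>. \<alpha> \<in> Rx \<and> \<beta> \<in> Rx} \<inter> V0"


section \<open>Extension of scalars from the integers\<close>

text \<open>The tensor product \<open>M \<otimes>\<^sub>\<int> K\<close> of an additive subgroup \<open>M\<close> with the additive group of \<open>K\<close>, as a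
  quotient of the free abelian group on \<open>M \<times> K\<close>. It is a group in the sense of HOL-Algebra, hence
  written multiplicatively. Balancedness over the integers follows from biadditivity.\<close>
definition tensor_rel :: "'a::ab_group_add set \<Rightarrow> ('a \<times> 'k::field \<Rightarrow>\<^sub>0 int) set" where
  "tensor_rel M = generate (free_Abelian_group (M \<times> UNIV))
     ({frag_of (x + y, c) - frag_of (x, c) - frag_of (y, c) | x y c. x \<in> M \<and> y \<in> M} \<union>
      {frag_of (x, c + d) - frag_of (x, c) - frag_of (x, d) | x c d. x \<in> M})"

definition tensor :: "'a::ab_group_add set \<Rightarrow> ('a \<times> 'k::field \<Rightarrow>\<^sub>0 int) set monoid" where
  "tensor M = free_Abelian_group (M \<times> UNIV) Mod tensor_rel M"

definition pure_tensor :: "'a::ab_group_add set \<Rightarrow> 'a \<Rightarrow> 'k::field \<Rightarrow> ('a \<times> 'k \<Rightarrow>\<^sub>0 int) set" where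
  "pure_tensor M x c = tensor_rel M #>\<^bsub>free_Abelian_group (M \<times> UNIV)\<^esub> frag_of (x, c)"

text \<open>The additive endomorphism determined by the values \<open>f x c\<close>, biadditive in \<open>x\<close> and \<open>c\<close>, on the
  pure tensors.\<close>
definition tensor_lift :: "'a::ab_group_add set \<Rightarrow> ('a \<Rightarrow> 'k::field \<Rightarrow> ('a \<times> 'k \<Rightarrow>\<^sub>0 int) set) \<Rightarrow>
    ('a \<times> 'k \<Rightarrow>\<^sub>0 int) set \<Rightarrow> ('a \<times> 'k \<Rightarrow>\<^sub>0 int) set" where
  "tensor_lift M f = (THE h. h \<in> hom (tensor M) (tensor M) \<and> h \<in> extensional (carrier (tensor M)) \<and>
     (\<forall>x\<in>M. \<forall>c. h (pure_tensor M x c) = f x c))"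

definition tensor_scale :: "'a::ab_group_add set \<Rightarrow> 'k::field \<Rightarrow>
    ('a \<times> 'k \<Rightarrow>\<^sub>0 int) set \<Rightarrow> ('a \<times> 'k \<Rightarrow>\<^sub>0 int) set" where
  "tensor_scale M s = tensor_lift M (\<lambda>x c. pure_tensor M x (s * c))"

text \<open>\<open>[x \<otimes> c, y \<otimes> d] = [x, y] \<otimes> c d\<close>\<close>
definition tensor_lie :: "('a \<Rightarrow> 'a \<Rightarrow> 'a) \<Rightarrow> 'a::ab_group_add set \<Rightarrow>
    ('a \<times> 'k::field \<Rightarrow>\<^sub>0 int) set \<Rightarrow> ('a \<times> 'k \<Rightarrow>\<^sub>0 int) set \<Rightarrow> ('a \<times> 'k \<Rightarrow>\<^sub>0 int) set" where
  "tensor_lie br M u v =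
     tensor_lift M (\<lambda>y d. tensor_lift M (\<lambda>x c. pure_tensor M (br x y) (c * d)) u) v"

definition tensor_Aut :: "('a \<Rightarrow> 'a \<Rightarrow> 'a) \<Rightarrow> 'a::ab_group_add set \<Rightarrow>
    (('a \<times> 'k::field \<Rightarrow>\<^sub>0 int) set \<Rightarrow> ('a \<times> 'k \<Rightarrow>\<^sub>0 int) set) monoid" where
  "tensor_Aut br M = (BijGroup (carrier (tensor M)))
     \<lparr>carrier := {f \<in> Bij (carrier (tensor M)). f \<in> hom (tensor M) (tensor M) \<and>
        (\<forall>s. \<forall>u\<in>carrier (tensor M). f (tensor_scale M s u) = tensor_scale M s (f u)) \<and>
        (\<forall>u\<in>carrier (tensor M). \<forall>v\<in>carrier (tensor M).
           f (tensor_lie br M u v) = tensor_lie br M (f u) (f v))}\<rparr>"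


section \<open>The adjoint form of the group of extended affine Lie type\<close>

context eala_data
begin

text \<open>The index set of the sum is finite because \<open>ad (x \<alpha>)\<close> is locally nilpotent.\<close>
definition exp_ad :: "(('g \<Rightarrow> complex) \<Rightarrow> 'g) \<Rightarrow> ('g \<Rightarrow> complex) \<Rightarrow> 'k::field \<Rightarrow>
    ('g \<times> 'k \<Rightarrow>\<^sub>0 int) set \<Rightarrow> ('g \<times> 'k \<Rightarrow>\<^sub>0 int) set" where
  "exp_ad x \<alpha> c = tensor_lift (core_Z x)
     (\<lambda>v s. finprod (tensor (core_Z x))
              (\<lambda>k. pure_tensor (core_Z x) (ad_divpow (x \<alpha>) k v) (c ^ k * s))
              {k. ad_divpow (x \<alpha>) k v \<noteq> 0})"

definition Ad_group :: "'k::field itself \<Rightarrow> (('g \<Rightarrow> complex) \<Rightarrow> 'g) \<Rightarrow>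
    (('g \<times> 'k \<Rightarrow>\<^sub>0 int) set \<Rightarrow> ('g \<times> 'k \<Rightarrow>\<^sub>0 int) set) monoid" where
  "Ad_group K x = (tensor_Aut lie (core_Z x))
     \<lparr>carrier := generate (tensor_Aut lie (core_Z x)) {exp_ad x \<alpha> (c::'k) | \<alpha> c. \<alpha> \<in> Rx}\<rparr>"

end

definition finitely_generated :: "('a, 'b) monoid_scheme \<Rightarrow> bool" where
  "finitely_generated G \<longleftrightarrow> (\<exists>S. finite S \<and> S \<subseteq> carrier G \<and> generate G S = carrier G)"

end

theory Submission
  imports Defs
begin

text \<open>The automorphisms \<open>exp (X \<gamma>) exp (- X (- \<gamma>)) exp (X \<gamma>)\<close> commute with the Chevalley automorphism, hence
  permute the root vectors up to sign. Together with the bound \<open>0 \<le> \<langle>\<alpha>, \<beta>\<^sup>\<or>\<rangle> \<langle>\<beta>, \<alpha>\<^sup>\<or>\<rangle> \<le> 4\<close>,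
  which follows from A3 and A5, this determines the structure constants in the rank two subsystems up to
  sign, as for finite root systems. An element \<open>[X (\<alpha> + \<delta>), X (- \<alpha>)]\<close> acts integrally on root vectors
  in directions other than \<open>\<alpha>\<close>, and since the rank is greater than one the remaining root vectors are,
  up to small denominators, brackets of such vectors. So the integral form is stable under brackets
  and divided powers, and the exponentials over \<open>K\<close> are automorphisms.

  The group is infinite because \<open>exp (X \<alpha>)\<close> moves \<open>X (- \<alpha>)\<close> by a vector whose \<open>X \<alpha>\<close>-coefficient is \<open>- 1\<close>,
  so that the \<open>exp (X \<alpha>)\<close> are distinct, and there are infinitely many nonisotropic roots. It is finitely
  generated because the set of roots whose root subgroups lie in a given subgroup is stable under the
  reflections in its members, and under reflections all the roots arise from finitely many: within
  one class modulo \<open>V0\<close> the reflections in \<open>\<beta>\<close> and \<open>\<beta> + \<delta>\<close> compose to the translation by \<open>2 \<delta>\<close>.\<close>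

section \<open>Lie algebras\<close>

text \<open>The form on \<open>V\<close> is complex valued and nothing says that it is semidefinite,
  so the Cauchy-Schwarz inequality cannot bound the Cartan integers; integrality, divisibility and
  root strings take its place. Isotropic root spaces are not known to be lines and carry no
  preferred basis. So the isotropic part of the integral form is handled only through brackets of
  two root vectors, and coefficients at \<open>X \<alpha>\<close> are read off with the form. Since
  \<open>K\<close> may have characteristic 2 or 3, the denominators 2 and 3 must cancel over the
  integers; hence the constant of a pair of roots is compared with those of all pairs congruent to
  it modulo \<open>V0\<close>. Integrality precedes every statement about the group:
  \<open>tensor_lift\<close> is a definite description, and nothing is known about
  \<open>exp_ad\<close> until its values on pure tensors are shown to be biadditive. For finite
  generation, the shifts \<delta> for which \<beta> + \<delta> is a root need not form a group; only
  translations by twice their span are available, and one root is added for each residue class that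
  occurs modulo these.\<close>

lemma sum_triangle:
  fixes f :: "nat \<Rightarrow> nat \<Rightarrow> 'a::comm_monoid_add"
  assumes "\<And>i j. i \<ge> n \<or> j \<ge> n \<Longrightarrow> f i j = 0"
  shows "(\<Sum>k<2*n. \<Sum>i\<le>k. f i (k - i)) = (\<Sum>i<n. \<Sum>j<n. f i j)"
proof -
  let ?g = "\<lambda>(i, j). f i j"
  have "(\<Sum>k<2*n. \<Sum>i\<le>k. f i (k - i)) = (\<Sum>(k, i)\<in>(SIGMA k:{..<2*n}. {..k}). f i (k - i))"
    by (simp add: sum.Sigma)
  also have "\<dots> = (\<Sum>(i, j)\<in>{(i, j). i + j < 2 * n}. f i j)"
    by (rule sum.reindex_bij_witness[of _ "\<lambda>(i, j). (i + j, i)" "\<lambda>(k, i). (i, k - i)"]) auto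
  \<comment> \<open>The triangle \<open>i + j < 2 * n\<close> contains the square
    \<open>i, j < n\<close>, and outside the square one index is at least \<open>n\<close>.\<close>
  also have "\<dots> = (\<Sum>(i, j)\<in>{..<n} \<times> {..<n}. f i j)"
  proof (rule sum.mono_neutral_right)
    have "{(i, j). i + j < 2 * n} \<subseteq> {..<2*n} \<times> {..<2*n}" by auto
    then show "finite {(i, j). i + j < 2 * n}" by (rule finite_subset) simp
    show "{..<n} \<times> {..<n} \<subseteq> {(i, j). i + j < 2 * n}" by auto
    show "\<forall>p\<in>{(i, j). i + j < 2 * n} - {..<n} \<times> {..<n}. (case p of (i, j) \<Rightarrow> f i j) = 0"
      using assms by clarsimp (metis not_less)
  qed
  also have "\<dots> = (\<Sum>i<n. \<Sum>j<n. f i j)"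
    by (simp add: sum.cartesian_product)
  finally show ?thesis .
qed

context lie_algebra
begin

lemma lie_zero_left [simp]: "lie 0 y = 0"
  using lie_add_left[of 0 0 y] by simp

lemma lie_zero_right [simp]: "lie x 0 = 0"
  using lie_add_right[of x 0 0] by simp

lemma lie_minus_left: "lie (- x) y = - lie x y"
  by (metis add_eq_0_iff lie_add_left lie_zero_left)

lemma lie_minus_right: "lie x (- y) = - lie x y"
  by (metis add_eq_0_iff lie_add_right lie_zero_right)

lemma lie_diff_left: "lie (x - y) z = lie x z - lie y z"
  by (metis diff_conv_add_uminus lie_add_left lie_minus_left)

lemma lie_diff_right: "lie x (y - z) = lie x y - lie x z"
  by (metis diff_conv_add_uminus lie_add_right lie_minus_right)

lemma lie_sum_left: "lie (\<Sum>i\<in>A. f i) z = (\<Sum>i\<in>A. lie (f i) z)"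
  by (induction A rule: infinite_finite_induct) (auto simp: lie_add_left)

lemma lie_sum_right: "lie z (\<Sum>i\<in>A. f i) = (\<Sum>i\<in>A. lie z (f i))"
  by (induction A rule: infinite_finite_induct) (auto simp: lie_add_right)

lemma lie_anti: "lie y x = - lie x y"
proof -
  have "lie (x + y) (x + y) = lie x y + lie y x"
    by (simp only: lie_add_left lie_add_right) (simp add: lie_self add.commute)
  then show ?thesis by (metis lie_self add.commute add_eq_0_iff)
qed

lemma lie_derivation: "lie x (lie y z) = lie (lie x y) z + lie y (lie x z)"
proof -
  have "lie x (lie y z) = - (lie y (lie z x) + lie z (lie x y))"
    using jacobi[of x y z] by (simp only: add.assoc eq_neg_iff_add_eq_0)
  moreover have "lie y (lie z x) = - lie y (lie x z)"
    by (metis lie_anti lie_minus_right)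
  moreover have "lie z (lie x y) = - lie (lie x y) z"
    by (rule lie_anti)
  ultimately show ?thesis by simp
qed

lemmas lie_linear = lie_add_left lie_add_right lie_diff_left lie_diff_right lie_minus_left
  lie_minus_right lie_scale_left lie_scale_right

definition locally_nilpotent :: "'g \<Rightarrow> bool" where
  "locally_nilpotent y \<longleftrightarrow> (\<forall>v. \<exists>n. (lie y ^^ n) v = 0)"

lemma lie_funpow_zero: "(lie y ^^ n) 0 = 0"
  by (induction n) auto

lemma lie_funpow_add: "(lie y ^^ n) (u + v) = (lie y ^^ n) u + (lie y ^^ n) v"
  by (induction n) (auto simp: lie_add_right)

lemma lie_funpow_scale: "(lie y ^^ n) (scale c u) = scale c ((lie y ^^ n) u)"
  by (induction n) (auto simp: lie_scale_right)

lemma lie_funpow_eq_zero_mono: "(lie y ^^ n) v = 0 \<Longrightarrow> n \<le> m \<Longrightarrow> (lie y ^^ m) v = 0"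
  by (metis funpow_add le_add_diff_inverse2 lie_funpow_zero o_apply)

lemma locally_nilpotent_scale:
  assumes "locally_nilpotent y" shows "locally_nilpotent (scale c y)"
proof -
  have "(lie (scale c y) ^^ n) v = scale (c ^ n) ((lie y ^^ n) v)" for n v
    by (induction n) (auto simp: lie_scale_left lie_scale_right mult.commute)
  then show ?thesis using assms unfolding locally_nilpotent_def by (metis scale_zero_right)
qed

lemma locally_nilpotent_minus: "locally_nilpotent y \<Longrightarrow> locally_nilpotent (- y)"
  using locally_nilpotent_scale[of y "- 1"] by simp

subsection \<open>Representations of sl2\<close>

definition sl2_triple :: "'g \<Rightarrow> 'g \<Rightarrow> 'g \<Rightarrow> bool" where
  "sl2_triple e f h \<longleftrightarrow> lie e f = h \<and> lie h e = scale 2 e \<and> lie h f = scale (- 2) f"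

lemma sl2_triple_swap: "sl2_triple e f h \<Longrightarrow> sl2_triple f e (- h)"
  unfolding sl2_triple_def by (auto simp: lie_minus_left lie_anti[of e f])

lemma sl2_weight_up:
  assumes "sl2_triple e f h" "lie h w = scale \<mu> w"
  shows "lie h ((lie e ^^ n) w) = scale (\<mu> + 2 * of_nat n) ((lie e ^^ n) w)"
proof (induction n)
  case (Suc n)
  have "lie h (lie e ((lie e ^^ n) w)) = lie (lie h e) ((lie e ^^ n) w) + lie e (lie h ((lie e ^^ n) w))"
    by (rule lie_derivation)
  then have "lie h (lie e ((lie e ^^ n) w)) = scale (2 + (\<mu> + 2 * of_nat n)) (lie e ((lie e ^^ n) w))"
    using assms(1) Suc.IH by (simp only: sl2_triple_def lie_scale_left lie_scale_right scale_left_distrib lie_add_right)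
  moreover have "2 + (\<mu> + 2 * of_nat n) = \<mu> + 2 * of_nat (Suc n)" by simp
  ultimately show ?case by simp
qed (use assms in auto)

lemma sl2_weight_down:
  assumes "sl2_triple e f h" "lie h w = scale \<mu> w"
  shows "lie h ((lie f ^^ n) w) = scale (\<mu> - 2 * of_nat n) ((lie f ^^ n) w)"
proof -
  let ?u = "(lie f ^^ n) w"
  have "lie (- h) ?u = scale (- \<mu> + 2 * of_nat n) ?u"
    by (rule sl2_weight_up[OF sl2_triple_swap[OF assms(1)]]) (simp add: lie_minus_left assms(2))
  moreover have "- \<mu> + 2 * of_nat n = - (\<mu> - 2 * of_nat n)" by simp
  ultimately show ?thesis by (simp only: scale_minus_left lie_minus_left neg_equal_iff_equal)
qed

text \<open>Moving \<open>f\<close> past one \<open>e\<close> costs one \<open>h\<close>; the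
  weights \<mu> + 2i for i = 0, ..., n add up to (n + 1)(\<mu> + n).\<close>

lemma sl2_lowest:
  assumes sl2: "sl2_triple e f h" and w: "lie h w = scale \<mu> w" and f: "lie f w = 0"
  shows "lie f ((lie e ^^ Suc n) w) = scale (- (of_nat (Suc n) * (\<mu> + of_nat n))) ((lie e ^^ n) w)"
proof (induction n)
  case 0
  have "lie e (lie f w) = lie (lie e f) w + lie f (lie e w)" by (rule lie_derivation)
  then have "lie f (lie e w) = - lie h w"
    using sl2 f by (simp add: sl2_triple_def add_eq_0_iff)
  then show ?case using w by simp
next
  case (Suc n)
  let ?v = "(lie e ^^ Suc n) w"
  have "lie e (lie f ?v) = lie (lie e f) ?v + lie f (lie e ?v)" by (rule lie_derivation)
  then have "lie f (lie e ?v) = lie e (lie f ?v) - lie h ?v"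
    using sl2 by (simp add: sl2_triple_def)
  also have "lie h ?v = scale (\<mu> + 2 * of_nat (Suc n)) ?v"
    by (rule sl2_weight_up[OF sl2 w])
  also have "lie e (lie f ?v) = scale (- (of_nat (Suc n) * (\<mu> + of_nat n))) ?v"
    by (simp only: Suc.IH lie_scale_right) simp
  finally have "lie f (lie e ?v) =
      scale (- (of_nat (Suc n) * (\<mu> + of_nat n)) - (\<mu> + 2 * of_nat (Suc n))) ?v"
    by (simp only: scale_left_diff_distrib)
  moreover have "- (of_nat (Suc n) * (\<mu> + of_nat n)) - (\<mu> + 2 * of_nat (Suc n)) =
      - (of_nat (Suc (Suc n)) * (\<mu> + of_nat (Suc n)))"
    by (simp add: algebra_simps)
  ultimately show ?case by simp
qed

lemma last_nonzero_iterate: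
  assumes "locally_nilpotent y" "v \<noteq> 0"
  obtains n where "(lie y ^^ n) v \<noteq> 0" "(lie y ^^ Suc n) v = 0"
proof -
  define k where "k = (LEAST k. (lie y ^^ k) v = 0)"
  have z: "(lie y ^^ k) v = 0"
    unfolding k_def by (rule LeastI_ex) (use assms(1) in \<open>simp add: locally_nilpotent_def\<close>)
  then obtain n where n: "k = Suc n" using assms(2) by (cases k) auto
  have "(lie y ^^ n) v \<noteq> 0"
    using not_less_Least[of n "\<lambda>k. (lie y ^^ k) v = 0"] n unfolding k_def by simp
  then show thesis using that z n by blast
qed

text \<open>Local nilpotency replaces finite dimension: if \<open>n\<close> is the last exponent
  with a nonzero power, then applying \<open>f\<close> to the next power forces (n + 1)(\<mu> + n) =
  0 in \<open>sl2_lowest\<close>.\<close>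

lemma sl2_lowest_weight:
  assumes sl2: "sl2_triple e f h" and w: "lie h w = scale \<mu> w" and f: "lie f w = 0" and "w \<noteq> 0"
    and nil: "locally_nilpotent e"
  obtains n where "\<mu> = - of_nat n" "\<And>k. k \<le> n \<Longrightarrow> (lie e ^^ k) w \<noteq> 0" "(lie e ^^ Suc n) w = 0"
proof -
  obtain n where nz: "(lie e ^^ n) w \<noteq> 0" and z: "(lie e ^^ Suc n) w = 0"
    by (rule last_nonzero_iterate[OF nil \<open>w \<noteq> 0\<close>])
  have "scale (- (of_nat (Suc n) * (\<mu> + of_nat n))) ((lie e ^^ n) w) = 0"
    using sl2_lowest[OF sl2 w f, of n] z by simp
  then have "of_nat (Suc n) * (\<mu> + of_nat n) = 0" using nz by (simp only: scale_eq_0_iff) simp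
  then have "\<mu> + of_nat n = 0" by (simp only: mult_eq_0_iff of_nat_eq_0_iff) simp
  then have "\<mu> = - of_nat n" by (simp add: add_eq_0_iff2)
  then show thesis using that z nz lie_funpow_eq_zero_mono by blast
qed

text \<open>Descending with \<open>f\<close> as far as possible ends in a lowest weight vector,
  whose weight \<mu> - 2k is an integer.\<close>

lemma sl2_weight_int:
  assumes sl2: "sl2_triple e f h" and v: "lie h v = scale \<mu> v" and "v \<noteq> 0"
    and nil: "locally_nilpotent e" "locally_nilpotent f"
  obtains z :: int where "\<mu> = of_int z"
proof -
  obtain k where nz: "(lie f ^^ k) v \<noteq> 0" and z: "(lie f ^^ Suc k) v = 0"
    by (rule last_nonzero_iterate[OF nil(2) \<open>v \<noteq> 0\<close>])
  obtain n where "\<mu> - 2 * of_nat k = - of_nat n"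
    using sl2_lowest_weight[OF sl2 sl2_weight_down[OF sl2 v] _ nz nil(1)] z by auto
  then have "\<mu> = of_int (2 * int k - int n)" by (simp add: algebra_simps)
  then show thesis by (rule that)
qed

end

subsection \<open>Divided powers and exponentials\<close>

context eala_data
begin

lemma ad_divpow_0 [simp]: "ad_divpow y 0 v = v"
  by (simp add: ad_divpow_def)

lemma ad_divpow_zero [simp]: "ad_divpow y k 0 = 0"
  by (simp add: ad_divpow_def lie_funpow_zero)

lemma ad_divpow_add: "ad_divpow y k (u + v) = ad_divpow y k u + ad_divpow y k v"
  by (simp add: ad_divpow_def lie_funpow_add scale_right_distrib)

lemma ad_divpow_scale: "ad_divpow y k (scale c v) = scale c (ad_divpow y k v)"
  by (simp add: ad_divpow_def lie_funpow_scale mult.commute)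

lemma ad_divpow_eq_zero_iff: "ad_divpow y k v = 0 \<longleftrightarrow> (lie y ^^ k) v = 0"
  by (simp add: ad_divpow_def)

lemma lie_ad_divpow: "lie y (ad_divpow y k v) = scale (of_nat (Suc k)) (ad_divpow y (Suc k) v)"
proof -
  have "of_nat (Suc k) * (1 / fact (Suc k)) = (1 / fact k :: complex)"
    by (simp add: field_simps del: of_nat_Suc)
  then show ?thesis by (simp add: ad_divpow_def lie_scale_right del: of_nat_Suc)
qed

lemma ad_divpow_Suc: "ad_divpow y (Suc k) v = scale (1 / of_nat (Suc k)) (lie y (ad_divpow y k v))"
  by (simp add: lie_ad_divpow del: of_nat_Suc)

lemma ad_divpow_1 [simp]: "ad_divpow y (Suc 0) v = lie y v"
  by (simp add: ad_divpow_def)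

lemma ad_divpow_2: "ad_divpow y 2 v = scale (1 / 2) (lie y (lie y v))"
  by (simp add: ad_divpow_def numeral_2_eq_2)

lemma ad_divpow_comp:
  "ad_divpow y i (ad_divpow y j v) = scale (of_nat ((i + j) choose i)) (ad_divpow y (i + j) v)"
proof -
  have "of_nat ((i + j) choose i) * (1 / fact (i + j)) = (1 / fact i * (1 / fact j) :: complex)"
    using binomial_fact[of i "i + j", where 'a = complex] by (simp add: field_simps)
  then show ?thesis by (simp add: ad_divpow_def lie_funpow_scale funpow_add)
qed

text \<open>The Leibniz rule; divided powers absorb the binomial coefficients. In the induction step
  both sides are multiplied by \<open>Suc n\<close>, which splits as i + (Suc n - i) between the two
  factors of the bracket.\<close>

lemma ad_divpow_lie:
  "ad_divpow y n (lie u v) = (\<Sum>i\<le>n. lie (ad_divpow y i u) (ad_divpow y (n - i) v))"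
proof (induction n)
  case (Suc n)
  let ?D = "ad_divpow y"
  let ?t = "\<lambda>i. lie (?D i u) (?D (Suc n - i) v)"
  have "scale (of_nat (Suc n)) (?D (Suc n) (lie u v)) = lie y (?D n (lie u v))"
    by (rule lie_ad_divpow[symmetric])
  also have "\<dots> = (\<Sum>i\<le>n. lie (lie y (?D i u)) (?D (n - i) v) + lie (?D i u) (lie y (?D (n - i) v)))"
    unfolding Suc.IH lie_sum_right by (rule sum.cong[OF refl], rule lie_derivation)
  also have "\<dots> = (\<Sum>i\<le>n. scale (of_nat (Suc i)) (?t (Suc i)) + scale (of_nat (Suc n - i)) (?t i))"
    by (rule sum.cong) (auto simp: lie_ad_divpow lie_scale_left lie_scale_right Suc_diff_le simp del: of_nat_Suc)
  also have "\<dots> = (\<Sum>i\<le>n. scale (of_nat (Suc i)) (?t (Suc i))) + (\<Sum>i\<le>n. scale (of_nat (Suc n - i)) (?t i))"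
    by (rule sum.distrib)
  also have "(\<Sum>i\<le>n. scale (of_nat (Suc i)) (?t (Suc i))) = (\<Sum>i\<le>Suc n. scale (of_nat i) (?t i))"
    by (subst sum.atMost_Suc_shift) simp
  also have "(\<Sum>i\<le>n. scale (of_nat (Suc n - i)) (?t i)) = (\<Sum>i\<le>Suc n. scale (of_nat (Suc n - i)) (?t i))"
    by simp
  also have "(\<Sum>i\<le>Suc n. scale (of_nat i) (?t i)) + (\<Sum>i\<le>Suc n. scale (of_nat (Suc n - i)) (?t i)) =
      (\<Sum>i\<le>Suc n. scale (of_nat (Suc n)) (?t i))"
    unfolding sum.distrib[symmetric]
    by (rule sum.cong) (auto simp: scale_left_distrib[symmetric] of_nat_add[symmetric] simp del: of_nat_add of_nat_Suc)
  also have "\<dots> = scale (of_nat (Suc n)) (\<Sum>i\<le>Suc n. ?t i)"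
    by (rule scale_sum_right[symmetric])
  finally show ?case by (simp only: scale_cancel_left of_nat_eq_0_iff) simp
qed simp

lemma ad_divpow_scale_left: "ad_divpow (scale c y) k v = scale (c ^ k) (ad_divpow y k v)"
proof -
  have "(lie (scale c y) ^^ k) v = scale (c ^ k) ((lie y ^^ k) v)"
    by (induction k) (auto simp: lie_scale_left lie_scale_right mult.commute)
  then show ?thesis by (simp add: ad_divpow_def mult.commute)
qed

lemma ad_divpow_lie_zero:
  assumes "\<And>k. k \<ge> n \<Longrightarrow> ad_divpow y k u = 0" "\<And>k. k \<ge> n \<Longrightarrow> ad_divpow y k v = 0" "k \<ge> 2 * n"
  shows "ad_divpow y k (lie u v) = 0"
  unfolding ad_divpow_lie
proof (rule sum.neutral, safe)
  fix i assume "i \<le> k"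
  show "lie (ad_divpow y i u) (ad_divpow y (k - i) v) = 0"
    using assms(1)[of i] assms(2)[of "k - i"] assms(3) by (cases "i \<ge> n") auto
qed

lemma ad_divpow_uminus: "ad_divpow (- y) k v = scale ((- 1) ^ k) (ad_divpow y k v)"
  using ad_divpow_scale_left[of "- 1" y k v] by simp

lemma ad_divpow_hom:
  assumes "\<And>u v. f (u + v) = f u + f v" "\<And>c u. f (scale c u) = scale c (f u)"
    "\<And>u v. f (lie u v) = lie (f u) (f v)"
  shows "f (ad_divpow y k v) = ad_divpow (f y) k (f v)"
proof -
  have "f ((lie y ^^ k) v) = (lie (f y) ^^ k) (f v)"
    by (induction k) (auto simp: assms(3))
  then show ?thesis by (simp add: ad_divpow_def assms(2))
qed

text \<open>Summing over the nonzero terms mirrors \<open>exp_ad\<close>. The index set is finite if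
  \<open>y\<close> is locally nilpotent; over an infinite set \<open>sum\<close> is 0.\<close>

definition Exp :: "'g \<Rightarrow> 'g \<Rightarrow> 'g" where
  "Exp y v = (\<Sum>k | ad_divpow y k v \<noteq> 0. ad_divpow y k v)"

lemma ad_divpow_bound:
  assumes "locally_nilpotent y"
  obtains n where "\<And>k. k \<ge> n \<Longrightarrow> ad_divpow y k v = 0"
  using assms lie_funpow_eq_zero_mono unfolding locally_nilpotent_def ad_divpow_eq_zero_iff by metis

lemma ad_divpow_bound2:
  assumes "locally_nilpotent y"
  obtains n where "\<And>k. k \<ge> n \<Longrightarrow> ad_divpow y k u = 0" "\<And>k. k \<ge> n \<Longrightarrow> ad_divpow y k v = 0"
proof -
  obtain n m where "\<And>k. k \<ge> n \<Longrightarrow> ad_divpow y k u = 0" "\<And>k. k \<ge> m \<Longrightarrow> ad_divpow y k v = 0"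
    using ad_divpow_bound[OF assms] by metis
  then show thesis by (intro that[of "max n m"]) auto
qed

lemma Exp_eq_sum:
  assumes "\<And>k. k \<ge> n \<Longrightarrow> ad_divpow y k v = 0"
  shows "Exp y v = (\<Sum>k<n. ad_divpow y k v)"
  unfolding Exp_def using assms by (intro sum.mono_neutral_left) (auto simp: not_less[symmetric])

lemma Exp_add:
  assumes "locally_nilpotent y" shows "Exp y (u + v) = Exp y u + Exp y v"
proof -
  obtain n where n: "\<And>k. k \<ge> n \<Longrightarrow> ad_divpow y k u = 0" "\<And>k. k \<ge> n \<Longrightarrow> ad_divpow y k v = 0"
    using ad_divpow_bound2[OF assms] by metis
  then show ?thesis
    by (subst (1 2 3) Exp_eq_sum[where n = n]) (auto simp: ad_divpow_add sum.distrib)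
qed

lemma Exp_scale:
  assumes "locally_nilpotent y" shows "Exp y (scale c u) = scale c (Exp y u)"
proof -
  obtain n where n: "\<And>k. k \<ge> n \<Longrightarrow> ad_divpow y k u = 0" using ad_divpow_bound[OF assms] by metis
  then show ?thesis
    by (subst (1 2) Exp_eq_sum[where n = n]) (auto simp: ad_divpow_scale scale_sum_right)
qed

lemma Exp_sum:
  assumes "locally_nilpotent y" shows "Exp y (\<Sum>i\<in>A. f i) = (\<Sum>i\<in>A. Exp y (f i))"
proof (induction A rule: infinite_finite_induct)
qed (use Exp_scale[OF assms, of 0] in \<open>auto simp: Exp_add[OF assms]\<close>)

text \<open>The exponential of a locally nilpotent derivation is an automorphism: the Leibniz rule
  makes the left side a Cauchy product.\<close>

lemma Exp_lie:
  assumes "locally_nilpotent y" shows "Exp y (lie u v) = lie (Exp y u) (Exp y v)"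
proof -
  let ?D = "ad_divpow y"
  obtain n where n: "\<And>k. k \<ge> n \<Longrightarrow> ?D k u = 0" "\<And>k. k \<ge> n \<Longrightarrow> ?D k v = 0"
    using ad_divpow_bound2[OF assms] by metis
  have big: "?D k (lie u v) = 0" if "k \<ge> 2 * n" for k
    using ad_divpow_lie_zero[of n y u v k] n that by blast
  have "Exp y (lie u v) = (\<Sum>k<2*n. \<Sum>i\<le>k. lie (?D i u) (?D (k - i) v))"
    by (subst Exp_eq_sum[OF big]) (auto simp: ad_divpow_lie)
  also have "\<dots> = (\<Sum>i<n. \<Sum>j<n. lie (?D i u) (?D j v))"
    by (rule sum_triangle) (use n in auto)
  also have "\<dots> = lie (Exp y u) (Exp y v)"
    by (subst (1 2) Exp_eq_sum[where n = n]) (use n in \<open>auto simp: lie_sum_left lie_sum_right intro: sum.swap\<close>)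
  finally show ?thesis .
qed

text \<open>Collected by total degree \<open>k\<close>, the coefficient of the divided power is the
  binomial expansion of (1 + (- 1))^k.\<close>

lemma Exp_minus_inverse:
  assumes "locally_nilpotent y" shows "Exp y (Exp (- y) v) = v"
proof -
  let ?D = "ad_divpow y"
  \<comment> \<open>Positivity of \<open>n\<close> puts the only surviving term,
    \<open>k = 0\<close>, into the range of the final sum.\<close>
  obtain n where n: "\<And>k. k \<ge> n \<Longrightarrow> ?D k v = 0" and "n > 0"
    using ad_divpow_bound[OF assms] by (metis le_Suc_eq less_Suc_eq_0_disj less_imp_le nat_le_linear not_less_eq_eq)
  let ?f = "\<lambda>i j. scale ((- 1) ^ j) (?D i (?D j v))"
  have z: "?D i (?D j v) = 0" if "i \<ge> n \<or> j \<ge> n" for i j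
    using n[of "i + j"] that by (auto simp: ad_divpow_comp)
  have "Exp y (Exp (- y) v) = (\<Sum>j<n. Exp y (scale ((- 1) ^ j) (?D j v)))"
    by (subst Exp_eq_sum[of n "- y"]) (use n in \<open>auto simp: ad_divpow_uminus Exp_sum[OF assms]\<close>)
  also have "\<dots> = (\<Sum>j<n. \<Sum>i<n. ?f i j)"
    by (intro sum.cong refl, subst Exp_eq_sum[of n]) (use z in \<open>auto simp: ad_divpow_scale\<close>)
  also have "\<dots> = (\<Sum>i<n. \<Sum>j<n. ?f i j)" by (rule sum.swap)
  also have "\<dots> = (\<Sum>k<2*n. \<Sum>i\<le>k. ?f i (k - i))"
    by (rule sum_triangle[symmetric]) (use z in auto)
  also have "\<dots> = (\<Sum>k<2*n. scale (\<Sum>i\<le>k. (- 1) ^ (k - i) * of_nat (k choose i)) (?D k v))"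
    by (intro sum.cong refl) (auto simp: ad_divpow_comp scale_sum_left)
  also have "\<dots> = (\<Sum>k<2*n. if k = 0 then v else 0)"
  proof (rule sum.cong)
    fix k
    have "(\<Sum>i\<le>k. (- 1) ^ (k - i) * of_nat (k choose i)) = ((1 + (- 1)) ^ k :: complex)"
      by (subst binomial_ring) (simp add: mult.commute)
    then show "scale (\<Sum>i\<le>k. (- 1) ^ (k - i) * of_nat (k choose i)) (?D k v) = (if k = 0 then v else 0)"
      by (auto simp: power_0_left)
  qed simp
  also have "\<dots> = v" using \<open>n > 0\<close> by simp
  finally show ?thesis .
qed

lemma Exp_hom:
  assumes "\<And>u v. f (u + v) = f u + f v" "\<And>c u. f (scale c u) = scale c (f u)"
    "\<And>u v. f (lie u v) = lie (f u) (f v)" and y: "locally_nilpotent y"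
  shows "f (Exp y v) = Exp (f y) (f v)"
proof -
  obtain n where n: "\<And>k. k \<ge> n \<Longrightarrow> ad_divpow y k v = 0" using ad_divpow_bound[OF y] by metis
  have f0: "f 0 = 0" using assms(1)[of 0 0] by simp
  have fsum: "f (\<Sum>i\<in>A. g i) = (\<Sum>i\<in>A. f (g i))" for A and g :: "nat \<Rightarrow> 'g"
    by (induction A rule: infinite_finite_induct) (auto simp: assms(1) f0)
  note h = ad_divpow_hom[of f y _ v, OF assms(1-3), symmetric]
  have "Exp (f y) (f v) = (\<Sum>k<n. ad_divpow (f y) k (f v))"
    by (rule Exp_eq_sum) (auto simp: h n f0)
  then show ?thesis by (simp add: Exp_eq_sum[OF n] fsum h)
qed

end

context eala
begin

section \<open>Extended affine Lie algebras\<close>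

subsection \<open>The form, the root spaces and the transfer to the dual\<close>

lemma form_add_right: "form z (x + y) = form z x + form z y"
  by (metis form_add form_sym)

lemma form_scale_right: "form x (scale c y) = c * form x y"
  by (metis form_scale form_sym)

lemma form_zero_left [simp]: "form 0 y = 0"
  using form_add[of 0 0 y] by simp

lemma form_zero_right [simp]: "form y 0 = 0"
  by (metis form_sym form_zero_left)

lemma form_minus_left: "form (- x) y = - form x y"
  by (metis add.right_inverse add_eq_0_iff form_add form_zero_left)

lemma form_minus_right: "form x (- y) = - form x y"
  by (metis form_minus_left form_sym)

lemma form_diff: "form (x - y) z = form x z - form y z"
  by (metis add_uminus_conv_diff form_add form_minus_left)

lemma form_diff_right: "form z (x - y) = form z x - form z y"
  by (metis form_diff form_sym)

lemmas form_linear = form_add form_add_right form_scale form_scale_right form_minus_left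
  form_minus_right form_diff form_diff_right

lemma H_closed:
  shows H_zero: "0 \<in> H" and H_add: "x \<in> H \<Longrightarrow> y \<in> H \<Longrightarrow> x + y \<in> H"
    and H_scale: "x \<in> H \<Longrightarrow> scale c x \<in> H" and H_diff: "x \<in> H \<Longrightarrow> y \<in> H \<Longrightarrow> x - y \<in> H"
  using subalgebra_H subspace_0 subspace_add subspace_scale subspace_diff
  unfolding subalgebra_def by auto

lemma H_minus: "x \<in> H \<Longrightarrow> - x \<in> H"
  using H_diff[OF H_zero] by fastforce

lemma dual_zero: "0 \<in> dual"
  by (auto simp: dual_def)

lemma dual_add: "\<alpha> \<in> dual \<Longrightarrow> \<beta> \<in> dual \<Longrightarrow> \<alpha> + \<beta> \<in> dual"
  by (auto simp: dual_def algebra_simps)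

lemma dual_rscale: "\<alpha> \<in> dual \<Longrightarrow> (\<lambda>x. complex_of_real r * \<alpha> x) \<in> dual"
  by (auto simp: dual_def algebra_simps)

lemma dual_minus: "\<alpha> \<in> dual \<Longrightarrow> - \<alpha> \<in> dual"
  by (auto simp: dual_def)

lemma dual_eval_add: "\<alpha> \<in> dual \<Longrightarrow> x \<in> H \<Longrightarrow> y \<in> H \<Longrightarrow> \<alpha> (x + y) = \<alpha> x + \<alpha> y"
  by (simp add: dual_def)

lemma dual_eval_scale: "\<alpha> \<in> dual \<Longrightarrow> x \<in> H \<Longrightarrow> \<alpha> (scale c x) = c * \<alpha> x"
  by (simp add: dual_def)

lemma dual_eval_minus: "\<alpha> \<in> dual \<Longrightarrow> x \<in> H \<Longrightarrow> \<alpha> (- x) = - \<alpha> x"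
  using dual_eval_scale[of \<alpha> x "- 1"] by simp

lemma dual_eval_diff: "\<alpha> \<in> dual \<Longrightarrow> x \<in> H \<Longrightarrow> y \<in> H \<Longrightarrow> \<alpha> (x - y) = \<alpha> x - \<alpha> y"
  using dual_eval_add[of \<alpha> x "- y"] dual_eval_minus[of \<alpha> y] H_minus[of y] by simp

lemma dual_eqI:
  assumes "\<alpha> \<in> dual" "\<beta> \<in> dual" "\<And>h. h \<in> H \<Longrightarrow> \<alpha> h = \<beta> h" shows "\<alpha> = \<beta>"
proof
  fix x show "\<alpha> x = \<beta> x" using assms by (cases "x \<in> H") (auto simp: dual_def)
qed

lemma root_space_zero: "0 \<in> root_space \<alpha>"
  by (auto simp: root_space_def)

lemma root_space_add: "x \<in> root_space \<alpha> \<Longrightarrow> y \<in> root_space \<alpha> \<Longrightarrow> x + y \<in> root_space \<alpha>"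
  by (auto simp: root_space_def lie_add_right scale_right_distrib)

lemma root_space_scale: "x \<in> root_space \<alpha> \<Longrightarrow> scale c x \<in> root_space \<alpha>"
  by (auto simp: root_space_def lie_scale_right mult.commute)

lemma root_space_minus: "x \<in> root_space \<alpha> \<Longrightarrow> - x \<in> root_space \<alpha>"
  using root_space_scale[of x \<alpha> "- 1"] by simp

lemma root_space_diff: "x \<in> root_space \<alpha> \<Longrightarrow> y \<in> root_space \<alpha> \<Longrightarrow> x - y \<in> root_space \<alpha>"
  using root_space_add[OF _ root_space_minus, of x \<alpha> y] by simp

lemma root_spaceD: "x \<in> root_space \<alpha> \<Longrightarrow> h \<in> H \<Longrightarrow> lie h x = scale (\<alpha> h) x"
  by (auto simp: root_space_def)

lemma root_space_lie:
  assumes "x \<in> root_space \<alpha>" "y \<in> root_space \<beta>" shows "lie x y \<in> root_space (\<alpha> + \<beta>)"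
  unfolding root_space_def
proof safe
  fix h assume h: "h \<in> H"
  have "lie h (lie x y) = lie (lie h x) y + lie x (lie h y)" by (rule lie_derivation)
  then show "lie h (lie x y) = scale ((\<alpha> + \<beta>) h) (lie x y)"
    using assms h by (simp add: root_spaceD lie_scale_left lie_scale_right scale_left_distrib)
qed

lemma root_space_form:
  assumes "x \<in> root_space \<alpha>" "y \<in> root_space \<beta>" "\<alpha> \<in> dual" "\<beta> \<in> dual" "\<alpha> + \<beta> \<noteq> 0"
  shows "form x y = 0"
proof -
  obtain h where h: "h \<in> H" "(\<alpha> + \<beta>) h \<noteq> 0"
    using dual_eqI[OF dual_add[OF assms(3,4)] dual_zero] assms(5) by auto
  have "form (lie h x) y = form (- lie x h) y" by (metis lie_anti)
  also have "\<dots> = - form x (lie h y)" by (simp add: form_minus_left A1_invariant)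
  finally have "(\<alpha> h + \<beta> h) * form x y = 0"
    using assms(1,2) h(1) by (simp add: root_spaceD form_scale form_scale_right algebra_simps)
  then show ?thesis using h by simp
qed

text \<open>Otherwise \<open>y\<close> would be orthogonal to all root spaces, the others being
  handled by \<open>root_space_form\<close>, and hence by \<open>A2_sum\<close> to
  everything.\<close>

lemma root_space_dual_nondeg:
  assumes "\<alpha> \<in> dual" "y \<in> root_space \<alpha>" "y \<noteq> 0"
  obtains z where "z \<in> root_space (- \<alpha>)" "form y z \<noteq> 0"
proof (rule ccontr)
  assume "\<not> thesis"
  then have z: "\<forall>u\<in>root_space (- \<alpha>). form y u = 0" using that by blast
  have all: "form y z = 0" if "z \<in> (\<Union>\<beta>\<in>dual. root_space \<beta>)" for z
  proof -
    from that obtain \<beta> where b: "\<beta> \<in> dual" "z \<in> root_space \<beta>" by auto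
    show ?thesis
    proof (cases "\<alpha> + \<beta> = 0")
      case True
      then have "\<beta> = - \<alpha>" by (metis add_eq_0_iff)
      then show ?thesis using z b by simp
    qed (use root_space_form[OF assms(2) b(2) assms(1) b(1)] in simp)
  qed
  have "form y z = 0" for z
  proof -
    have "subspace {z. form y z = 0}"
      by (rule subspaceI) (auto simp: form_add_right form_scale_right)
    then have "span (\<Union>\<beta>\<in>dual. root_space \<beta>) \<subseteq> {z. form y z = 0}"
      using all by (intro span_minimal) auto
    then show ?thesis using A2_sum by auto
  qed
  then show False using A1_nondegenerate assms(3) by blast
qed

lemma R_minus: assumes "\<alpha> \<in> R" shows "- \<alpha> \<in> R"
proof -
  have a: "\<alpha> \<in> dual" "root_space \<alpha> \<noteq> {0}" using assms by (auto simp: R_def)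
  then obtain y where "y \<in> root_space \<alpha>" "y \<noteq> 0" using root_space_zero by blast
  then obtain z where "z \<in> root_space (- \<alpha>)" "form y z \<noteq> 0"
    using root_space_dual_nondeg[OF a(1)] by metis
  then show ?thesis using dual_minus[OF a(1)] by (auto simp: R_def)
qed

lemma R_dual: "\<alpha> \<in> R \<Longrightarrow> \<alpha> \<in> dual"
  by (simp add: R_def)

lemma RI: "\<alpha> \<in> dual \<Longrightarrow> y \<in> root_space \<alpha> \<Longrightarrow> y \<noteq> 0 \<Longrightarrow> \<alpha> \<in> R"
  by (auto simp: R_def)

text \<open>The pairing of opposite root spaces at \<alpha> = 0, since \<open>H\<close> is the root
  space of 0.\<close>

lemma H_nondeg:
  assumes "d \<in> H" "\<And>h. h \<in> H \<Longrightarrow> form h d = 0" shows "d = 0"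
proof (rule ccontr)
  assume "d \<noteq> 0"
  then obtain z where "z \<in> root_space (- 0)" "form d z \<noteq> 0"
    using root_space_dual_nondeg[OF dual_zero, of d] assms(1) A2_zero by auto
  then show False using assms(2)[of z] A2_zero by (simp add: form_sym)
qed

lemma t_unique:
  assumes "u \<in> H" "\<And>h. h \<in> H \<Longrightarrow> \<alpha> h = form h u" shows "t \<alpha> = u"
  unfolding t_def
proof (rule the_equality)
  fix u' assume u': "u' \<in> H \<and> (\<forall>h\<in>H. \<alpha> h = form h u')"
  have "u' - u = 0"
    using u' assms by (intro H_nondeg) (auto simp: H_diff form_diff_right)
  then show "u' = u" by simp
qed (use assms in auto)

text \<open>The representing vector is built explicitly. For a root \<alpha> take \<open>y\<close>,
  \<open>z\<close> in opposite root spaces with \<open>form y z\<close> nonzero; by invariance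
  \<open>lie y z\<close> divided by \<open>form y z\<close> represents \<alpha>. The rest is
  linearity.\<close>

lemma V_t:
  assumes "\<alpha> \<in> V" shows "\<alpha> \<in> dual" "t \<alpha> \<in> H" "h \<in> H \<Longrightarrow> form h (t \<alpha>) = \<alpha> h"
proof -
  have "\<alpha> \<in> dual \<and> (\<exists>u\<in>H. \<forall>h\<in>H. \<alpha> h = form h u)"
    using assms unfolding V_def
  proof (induction rule: real_fun.span_induct)
    case base
    show ?case
      unfolding real_fun.subspace_def
    proof (intro conjI ballI allI; clarsimp simp: dual_zero dual_add dual_rscale)
      show "\<exists>u\<in>H. \<forall>h\<in>H. form h u = 0" using H_zero by (intro bexI[of _ 0]) auto
    next
      fix \<alpha> \<beta> u v
      assume "u \<in> H" "v \<in> H" "\<forall>h\<in>H. \<alpha> h = form h u" "\<forall>h\<in>H. \<beta> h = form h v"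
      then show "\<exists>w\<in>H. \<forall>h\<in>H. form h u + form h v = form h w"
        by (intro bexI[of _ "u + v"]) (auto simp: form_add_right H_add)
    next
      fix r \<alpha> u assume "u \<in> H" "\<forall>h\<in>H. \<alpha> h = form h u"
      then show "\<exists>w\<in>H. \<forall>h\<in>H. complex_of_real r * form h u = form h w"
        by (intro bexI[of _ "scale (complex_of_real r) u"]) (auto simp: form_scale_right H_scale)
    qed
  next
    case (step \<alpha>)
    then have a: "\<alpha> \<in> dual" "root_space \<alpha> \<noteq> {0}" by (auto simp: R_def)
    then obtain y where y: "y \<in> root_space \<alpha>" "y \<noteq> 0" using root_space_zero by blast
    then obtain z where z: "z \<in> root_space (- \<alpha>)" "form y z \<noteq> 0"
      using root_space_dual_nondeg[OF a(1)] by metis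
    let ?u = "scale (1 / form y z) (lie y z)"
    have "lie y z \<in> H" using root_space_lie[OF y(1) z(1)] A2_zero by simp
    moreover have "form h (lie y z) = \<alpha> h * form y z" if "h \<in> H" for h
      using y(1) that by (simp add: A1_invariant[symmetric] root_spaceD form_scale)
    ultimately show ?case using a(1) z(2) H_scale
      by (intro conjI bexI[of _ ?u]) (auto simp: form_scale_right)
  qed
  then obtain u where u: "\<alpha> \<in> dual" "u \<in> H" "\<forall>h\<in>H. \<alpha> h = form h u" by auto
  then have "t \<alpha> = u" by (intro t_unique) auto
  then show "\<alpha> \<in> dual" "t \<alpha> \<in> H" "h \<in> H \<Longrightarrow> form h (t \<alpha>) = \<alpha> h" using u by auto
qed

lemma R_V: "\<alpha> \<in> R \<Longrightarrow> \<alpha> \<in> V"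
  by (simp add: V_def real_fun.span_base)

lemma V_zero: "0 \<in> V"
  unfolding V_def by (rule real_fun.span_zero)

lemma V_add: "v \<in> V \<Longrightarrow> w \<in> V \<Longrightarrow> v + w \<in> V"
  unfolding V_def by (rule real_fun.span_add)

lemma V_minus: "v \<in> V \<Longrightarrow> - v \<in> V"
  unfolding V_def by (rule real_fun.span_neg)

lemma V_diff: "v \<in> V \<Longrightarrow> w \<in> V \<Longrightarrow> v - w \<in> V"
  unfolding V_def by (rule real_fun.span_diff)

lemma V_rscale: "v \<in> V \<Longrightarrow> (\<lambda>x. complex_of_real r * v x) \<in> V"
  unfolding V_def by (rule real_fun.span_scale)

lemma t_add: "v \<in> V \<Longrightarrow> w \<in> V \<Longrightarrow> t (v + w) = t v + t w"
  by (rule t_unique) (auto simp: V_t H_add form_add_right)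

lemma t_minus: "v \<in> V \<Longrightarrow> t (- v) = - t v"
  by (rule t_unique) (auto simp: V_t H_minus form_minus_right)

lemma t_rscale: "v \<in> V \<Longrightarrow> t (\<lambda>x. complex_of_real r * v x) = scale (complex_of_real r) (t v)"
  by (rule t_unique) (auto simp: V_t H_scale form_scale_right)

lemma t_zero: "t 0 = 0"
  by (rule t_unique) (auto simp: H_zero)

lemma t_diff: "v \<in> V \<Longrightarrow> w \<in> V \<Longrightarrow> t (v - w) = t v - t w"
  by (rule t_unique) (auto simp: V_t H_diff form_diff_right)

lemma dform_sym: "dform v w = dform w v"
  by (simp add: dform_def form_sym)

lemma dform_linear:
  assumes "v \<in> V" "w \<in> V"
  shows dform_add: "dform (v + w) u = dform v u + dform w u"
    and dform_add_right: "dform u (v + w) = dform u v + dform u w"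
    and dform_diff: "dform (v - w) u = dform v u - dform w u"
    and dform_diff_right: "dform u (v - w) = dform u v - dform u w"
    and dform_minus: "dform (- v) u = - dform v u"
    and dform_minus_right: "dform u (- v) = - dform u v"
    and dform_rscale: "dform (\<lambda>x. complex_of_real r * v x) u = complex_of_real r * dform v u"
    and dform_rscale_right: "dform u (\<lambda>x. complex_of_real r * v x) = complex_of_real r * dform u v"
  by (auto simp: dform_def assms t_add t_minus t_diff t_rscale form_linear)

lemma zscale_V: "v \<in> V \<Longrightarrow> (\<lambda>x. of_int n * v x) \<in> V"
  using V_rscale[of v "of_int n"] by simp

lemma dform_zscale:
  assumes "v \<in> V"
  shows "dform (\<lambda>x. of_int n * v x) u = of_int n * dform v u"
    "dform u (\<lambda>x. of_int n * v x) = of_int n * dform u v"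
  using dform_rscale[OF assms assms, of "of_int n" u] dform_rscale_right[OF assms assms, of u "of_int n"] by auto

lemma dform_minus_minus: "v \<in> V \<Longrightarrow> dform (- v) (- v) = dform v v"
  using dform_minus[of v v "- v"] dform_minus_right[of v v v] by simp

lemma dform_zero [simp]: "dform 0 w = 0" "dform w 0 = 0"
  by (auto simp: dform_def t_zero)

lemma dform_eval: "v \<in> V \<Longrightarrow> w \<in> V \<Longrightarrow> v (t w) = dform v w"
  unfolding dform_def by (metis V_t(2,3) form_sym)

lemma V0_subspace: "real_fun.subspace V0"
  unfolding real_fun.subspace_def V0_def
  by (auto simp: V_zero V_add V_rscale dform_add dform_rscale)

lemma V0_V: "\<delta> \<in> V0 \<Longrightarrow> \<delta> \<in> V"
  by (simp add: V0_def)

lemma V0_zero: "0 \<in> V0"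
  using real_fun.subspace_0[OF V0_subspace] .

lemma V0_add: "v \<in> V0 \<Longrightarrow> w \<in> V0 \<Longrightarrow> v + w \<in> V0"
  using real_fun.subspace_add[OF V0_subspace] .

lemma V0_minus: "v \<in> V0 \<Longrightarrow> - v \<in> V0"
  using real_fun.subspace_neg[OF V0_subspace] .

lemma V0_diff: "v \<in> V0 \<Longrightarrow> w \<in> V0 \<Longrightarrow> v - w \<in> V0"
  using real_fun.subspace_diff[OF V0_subspace] .

lemma V0_rscale: "v \<in> V0 \<Longrightarrow> (\<lambda>x. complex_of_real r * v x) \<in> V0"
  using real_fun.subspace_scale[OF V0_subspace] .

lemma V0_dform: "\<delta> \<in> V0 \<Longrightarrow> v \<in> V \<Longrightarrow> dform \<delta> v = 0" "\<delta> \<in> V0 \<Longrightarrow> v \<in> V \<Longrightarrow> dform v \<delta> = 0"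
  by (auto simp: V0_def dform_sym)

lemma R0_V0: "\<delta> \<in> R0 \<Longrightarrow> \<delta> \<in> V0"
  using A5_isotropic by auto

lemma R0_diff: "\<alpha> \<in> Rx \<Longrightarrow> \<beta> \<in> Rx \<Longrightarrow> \<alpha> - \<beta> \<in> V0 \<Longrightarrow> \<alpha> - \<beta> \<in> R0"
  using A5_isotropic by auto

lemma Rx_iff: "\<alpha> \<in> Rx \<longleftrightarrow> \<alpha> \<in> R \<and> dform \<alpha> \<alpha> \<noteq> 0"
  by (auto simp: Rx_def R0_def)

lemma Rx_R: "\<alpha> \<in> Rx \<Longrightarrow> \<alpha> \<in> R" and Rx_V: "\<alpha> \<in> Rx \<Longrightarrow> \<alpha> \<in> V"
  and Rx_norm: "\<alpha> \<in> Rx \<Longrightarrow> dform \<alpha> \<alpha> \<noteq> 0"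
  using R_V by (auto simp: Rx_iff)

text \<open>By \<open>A5_isotropic\<close> an isotropic root lies in the radical, so for roots being
  nonisotropic means being nonzero modulo \<open>V0\<close>.\<close>

lemma Rx_iff_V0: "\<alpha> \<in> R \<Longrightarrow> \<alpha> \<in> Rx \<longleftrightarrow> \<alpha> \<notin> V0"
  using R0_V0 V0_dform(1) R_V by (auto simp: Rx_def R0_def)

lemma Rx_minus: "\<alpha> \<in> Rx \<Longrightarrow> - \<alpha> \<in> Rx"
  by (simp add: Rx_iff R_minus R_V dform_minus_minus)

text \<open>Both sides lie in \<open>H\<close> and, by invariance, pair equally with every element
  of \<open>H\<close>.\<close>

lemma lie_root_opposite:
  assumes "\<alpha> \<in> V" "x \<in> root_space \<alpha>" "y \<in> root_space (- \<alpha>)"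
  shows "lie x y = scale (form x y) (t \<alpha>)"
proof -
  have "lie x y \<in> H" using root_space_lie[OF assms(2,3)] A2_zero by simp
  moreover have "form h (lie x y) = form h (scale (form x y) (t \<alpha>))" if "h \<in> H" for h
    using assms that by (simp add: A1_invariant[symmetric] root_spaceD form_scale form_scale_right V_t)
  ultimately have "lie x y - scale (form x y) (t \<alpha>) = 0"
    using assms(1) by (intro H_nondeg) (auto simp: H_diff H_scale V_t form_diff_right)
  then show ?thesis by simp
qed

lemma coroot_H: "\<alpha> \<in> V \<Longrightarrow> coroot \<alpha> \<in> H"
  by (simp add: coroot_def H_scale V_t)

lemma coroot_eval: "\<beta> \<in> V \<Longrightarrow> \<alpha> \<in> V \<Longrightarrow> \<beta> (coroot \<alpha>) = 2 * dform \<beta> \<alpha> / dform \<alpha> \<alpha>"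
  by (simp add: coroot_def dual_eval_scale[OF V_t(1) V_t(2)] dform_eval)

lemma coroot_minus: "\<alpha> \<in> V \<Longrightarrow> coroot (- \<alpha>) = - coroot \<alpha>"
  by (simp add: coroot_def t_minus dform_minus dform_minus_right V_minus)

lemma coroot_self: "\<alpha> \<in> Rx \<Longrightarrow> \<alpha> (coroot \<alpha>) = 2"
  by (simp add: coroot_eval Rx_V Rx_norm)

end

subsection \<open>Chevalley systems\<close>

locale eala_chevalley = eala scale lie form H
  for scale :: "complex \<Rightarrow> 'g::ab_group_add \<Rightarrow> 'g" and lie form H +
  fixes \<tau> :: "'g \<Rightarrow> 'g" and X :: "('g \<Rightarrow> complex) \<Rightarrow> 'g" and B :: "('g \<Rightarrow> complex) set"
  assumes reduced: "reduced" and rank: "rank > 1" and nullity: "nullity \<ge> 1"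
    and lifted_base: "lifted_base B"
    and chev_aut: "chevalley_automorphism \<tau>" and chev_sys: "chevalley_system \<tau> X"
begin

lemma X_root: "\<alpha> \<in> Rx \<Longrightarrow> X \<alpha> \<in> root_space \<alpha>"
  and X_lie: "\<alpha> \<in> Rx \<Longrightarrow> lie (X \<alpha>) (X (- \<alpha>)) = coroot \<alpha>"
  and X_tau: "\<alpha> \<in> Rx \<Longrightarrow> \<tau> (X \<alpha>) = - X (- \<alpha>)"
  using chev_sys by (auto simp: chevalley_system_def)

lemma X_root_minus: "\<alpha> \<in> Rx \<Longrightarrow> X (- \<alpha>) \<in> root_space (- \<alpha>)"
  by (simp add: X_root Rx_minus)

lemma tau_add: "\<tau> (u + v) = \<tau> u + \<tau> v" and tau_scale: "\<tau> (scale c u) = scale c (\<tau> u)"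
  and tau_lie: "\<tau> (lie u v) = lie (\<tau> u) (\<tau> v)"
  using chev_aut by (auto simp: chevalley_automorphism_def lie_automorphism_def)

lemma tau_minus: "\<tau> (- u) = - \<tau> u"
  using tau_scale[of "- 1" u] by simp

lemma X_tau_minus: "\<alpha> \<in> Rx \<Longrightarrow> \<tau> (X (- \<alpha>)) = - X \<alpha>"
  using X_tau[of "- \<alpha>"] by (simp add: Rx_minus)

lemma t_nonzero: "\<alpha> \<in> Rx \<Longrightarrow> t \<alpha> \<noteq> 0"
  using Rx_norm[of \<alpha>] by (auto simp: dform_def)

lemma form_X:
  assumes "\<alpha> \<in> Rx" shows "form (X \<alpha>) (X (- \<alpha>)) = 2 / dform \<alpha> \<alpha>"
proof -
  have "scale (form (X \<alpha>) (X (- \<alpha>))) (t \<alpha>) = scale (2 / dform \<alpha> \<alpha>) (t \<alpha>)"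
    using lie_root_opposite[OF Rx_V X_root X_root_minus, of \<alpha>] X_lie[of \<alpha>] assms
    unfolding coroot_def by argo
  then show ?thesis using t_nonzero[OF assms] scale_cancel_right by blast
qed

lemma X_nonzero: "\<alpha> \<in> Rx \<Longrightarrow> X \<alpha> \<noteq> 0"
  using form_X[of \<alpha>] Rx_norm[of \<alpha>] by auto

lemma X_sl2:
  assumes "\<alpha> \<in> Rx" shows "sl2_triple (X \<alpha>) (X (- \<alpha>)) (coroot \<alpha>)"
  unfolding sl2_triple_def
proof (intro conjI)
  have h: "coroot \<alpha> \<in> H" using assms by (simp add: coroot_H Rx_V)
  show "lie (X \<alpha>) (X (- \<alpha>)) = coroot \<alpha>" using X_lie[OF assms] .
  show "lie (coroot \<alpha>) (X \<alpha>) = scale 2 (X \<alpha>)"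
    using root_spaceD[OF X_root[OF assms] h] by (simp add: coroot_self assms)
  show "lie (coroot \<alpha>) (X (- \<alpha>)) = scale (- 2) (X (- \<alpha>))"
    using root_spaceD[OF X_root_minus[OF assms] h] by (simp add: coroot_self assms)
qed

lemma root_nilpotent: "\<alpha> \<in> Rx \<Longrightarrow> y \<in> root_space \<alpha> \<Longrightarrow> locally_nilpotent y"
  using A3 by (simp add: locally_nilpotent_def)

lemma X_nilpotent: "\<alpha> \<in> Rx \<Longrightarrow> locally_nilpotent (X \<alpha>)"
  using X_root root_nilpotent by blast

lemma X_nilpotent_minus: "\<alpha> \<in> Rx \<Longrightarrow> locally_nilpotent (X (- \<alpha>))"
  using X_nilpotent Rx_minus by blast

lemma lie_coroot: "\<alpha> \<in> V \<Longrightarrow> v \<in> root_space \<beta> \<Longrightarrow> lie (coroot \<alpha>) v = scale (\<beta> (coroot \<alpha>)) v"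
  using root_spaceD coroot_H by blast

text \<open>A vector of the root space orthogonal to \<open>X (- \<alpha>)\<close> would be a lowest weight vector of weight 2.\<close>
lemma root_space_X:
  assumes a: "\<alpha> \<in> Rx" and y: "y \<in> root_space \<alpha>"
  obtains c where "y = scale c (X \<alpha>)"
proof -
  define c where "c = form y (X (- \<alpha>)) * dform \<alpha> \<alpha> / 2"
  define w where "w = y - scale c (X \<alpha>)"
  have w: "w \<in> root_space \<alpha>"
    unfolding w_def using y X_root[OF a] by (intro root_space_diff root_space_scale)
  have "form w (X (- \<alpha>)) = 0"
    using Rx_norm[OF a] by (simp add: w_def c_def form_diff form_scale form_X[OF a])
  then have "lie w (X (- \<alpha>)) = 0"
    using lie_root_opposite[OF Rx_V[OF a] w X_root_minus[OF a]] by simp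
  then have f: "lie (X (- \<alpha>)) w = 0" by (metis lie_anti neg_equal_0_iff_equal)
  have h: "lie (coroot \<alpha>) w = scale 2 w"
    using lie_coroot[OF Rx_V[OF a] w] coroot_self[OF a] by simp
  have "w = 0"
  proof (rule ccontr)
    assume "w \<noteq> 0"
    obtain n where "(2::complex) = - of_nat n"
      by (rule sl2_lowest_weight[OF X_sl2[OF a] h f \<open>w \<noteq> 0\<close> X_nilpotent[OF a]])
    then have "Re 2 = Re (- of_nat n)" by simp
    then show False by simp
  qed
  then show thesis using that[of c] by (simp add: w_def)
qed

text \<open>On roots the value is an integer already; the floor only changes its type.\<close>
definition cartan :: "('g \<Rightarrow> complex) \<Rightarrow> ('g \<Rightarrow> complex) \<Rightarrow> int" where
  "cartan \<beta> \<alpha> = \<lfloor>Re (\<beta> (coroot \<alpha>))\<rfloor>"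

lemma cartan:
  assumes "\<beta> \<in> R" "\<alpha> \<in> Rx" shows "\<beta> (coroot \<alpha>) = of_int (cartan \<beta> \<alpha>)"
proof -
  obtain v where v: "v \<in> root_space \<beta>" "v \<noteq> 0" using assms(1) root_space_zero by (auto simp: R_def)
  obtain z where "\<beta> (coroot \<alpha>) = of_int z"
    by (rule sl2_weight_int[OF X_sl2[OF assms(2)] lie_coroot[OF Rx_V[OF assms(2)] v(1)] v(2)
          X_nilpotent[OF assms(2)] X_nilpotent_minus[OF assms(2)]])
  then show ?thesis by (simp add: cartan_def)
qed

lemma cartan_eqI: "\<beta> (coroot \<alpha>) = of_int z \<Longrightarrow> cartan \<beta> \<alpha> = z"
  by (simp add: cartan_def)

text \<open>If \<open>X (- \<alpha>)\<close> killed a vector of the root space of \<beta>, that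
  vector would be a lowest weight vector, and its weight could not be positive.\<close>

lemma root_diff:
  assumes "\<beta> \<in> R" "\<alpha> \<in> Rx" "cartan \<beta> \<alpha> > 0" shows "\<beta> - \<alpha> \<in> R"
proof -
  obtain v where v: "v \<in> root_space \<beta>" "v \<noteq> 0" using assms(1) root_space_zero by (auto simp: R_def)
  have w: "lie (X (- \<alpha>)) v \<in> root_space (\<beta> - \<alpha>)"
    using root_space_lie[OF X_root_minus[OF assms(2)] v(1)] by (simp add: add.commute)
  have "lie (X (- \<alpha>)) v \<noteq> 0"
  proof
    assume f: "lie (X (- \<alpha>)) v = 0"
    obtain n where n: "\<beta> (coroot \<alpha>) = - of_nat n"
      by (rule sl2_lowest_weight[OF X_sl2[OF assms(2)] lie_coroot[OF Rx_V[OF assms(2)] v(1)] f v(2)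
            X_nilpotent[OF assms(2)]])
    then have "cartan \<beta> \<alpha> = - int n" by (intro cartan_eqI) simp
    then show False using assms(3) by simp
  qed
  then show ?thesis using w assms by (intro RI[of _ "lie (X (- \<alpha>)) v"])
    (auto simp: R_dual Rx_R V_t(1) V_diff R_V)
qed

lemma cartan_minus_left: "\<beta> \<in> R \<Longrightarrow> \<alpha> \<in> Rx \<Longrightarrow> cartan (- \<beta>) \<alpha> = - cartan \<beta> \<alpha>"
  by (rule cartan_eqI) (simp add: cartan)

lemma cartan_minus_right: "\<beta> \<in> R \<Longrightarrow> \<alpha> \<in> Rx \<Longrightarrow> cartan \<beta> (- \<alpha>) = - cartan \<beta> \<alpha>"
  by (rule cartan_eqI) (simp add: coroot_minus Rx_V dual_eval_minus[OF R_dual coroot_H] cartan)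

lemma cartan_self: "\<alpha> \<in> Rx \<Longrightarrow> cartan \<alpha> \<alpha> = 2"
  by (rule cartan_eqI) (simp add: coroot_self)

lemma cartan_dform:
  "\<beta> \<in> R \<Longrightarrow> \<alpha> \<in> Rx \<Longrightarrow> of_int (cartan \<beta> \<alpha>) * dform \<alpha> \<alpha> = 2 * dform \<beta> \<alpha>"
  using cartan[of \<beta> \<alpha>, symmetric] by (simp add: coroot_eval R_V Rx_V Rx_norm)

lemma cartan_diff: "\<beta> \<in> R \<Longrightarrow> \<gamma> \<in> R \<Longrightarrow> \<alpha> \<in> Rx \<Longrightarrow> cartan (\<beta> - \<gamma>) \<alpha> = cartan \<beta> \<alpha> - cartan \<gamma> \<alpha>"
  by (rule cartan_eqI) (simp add: cartan)

lemma cartan_cong: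
  assumes "\<beta> \<in> R" "\<beta>' \<in> R" "\<alpha> \<in> Rx" "\<alpha>' \<in> Rx" "\<beta>' - \<beta> \<in> V0" "\<alpha>' - \<alpha> \<in> V0"
  shows "cartan \<beta>' \<alpha>' = cartan \<beta> \<alpha>"
proof (rule cartan_eqI)
  have 1: "dform \<beta>' \<mu> = dform \<beta> \<mu>" if "\<mu> \<in> V" for \<mu>
    using V0_dform(1)[OF assms(5) that] assms(1,2) by (simp add: dform_diff R_V)
  have 2: "dform \<mu> \<alpha>' = dform \<mu> \<alpha>" if "\<mu> \<in> V" for \<mu>
    using V0_dform(2)[OF assms(6) that] assms(3,4) by (simp add: dform_diff_right Rx_V)
  have "dform \<beta>' \<alpha>' = dform \<beta> \<alpha>" "dform \<alpha>' \<alpha>' = dform \<alpha> \<alpha>"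
    using 1[of \<alpha>] 2[of \<beta>'] 2[of \<alpha>] 2[of \<alpha>'] assms by (simp_all add: R_V Rx_V dform_sym)
  then show "\<beta>' (coroot \<alpha>') = of_int (cartan \<beta> \<alpha>)"
    using assms cartan[of \<beta> \<alpha>, symmetric] by (simp add: coroot_eval R_V Rx_V)
qed

end

section \<open>Exponentials of low nilpotency degree\<close>

context eala_data
begin

lemma ad_divpow_zero_mono: "ad_divpow y n v = 0 \<Longrightarrow> n \<le> k \<Longrightarrow> ad_divpow y k v = 0"
  using lie_funpow_eq_zero_mono by (simp add: ad_divpow_eq_zero_iff)

lemma Exp_1:
  assumes "lie y (lie y v) = 0" shows "Exp y v = v + lie y v"
proof -
  have "ad_divpow y 2 v = 0" using assms by (simp add: ad_divpow_2)
  then have "Exp y v = (\<Sum>k<2. ad_divpow y k v)"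
    by (intro Exp_eq_sum) (rule ad_divpow_zero_mono)
  then show ?thesis by (simp add: numeral_2_eq_2)
qed

lemma Exp_2:
  assumes "lie y (lie y (lie y v)) = 0" shows "Exp y v = v + lie y v + scale (1 / 2) (lie y (lie y v))"
proof -
  have "ad_divpow y (Suc 2) v = 0" using assms by (subst ad_divpow_Suc) (simp add: ad_divpow_2 lie_scale_right)
  then have "Exp y v = (\<Sum>k<Suc 2. ad_divpow y k v)"
    by (intro Exp_eq_sum) (rule ad_divpow_zero_mono)
  then have "Exp y v = ad_divpow y 0 v + ad_divpow y (Suc 0) v + ad_divpow y 2 v"
    by (simp add: numeral_2_eq_2)
  then show ?thesis by (simp add: ad_divpow_2)
qed

lemma Exp_sl2:
  assumes "sl2_triple e f h"
  shows "Exp e e = e" "Exp e h = h - scale 2 e" "Exp e f = f + h - e"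
    "Exp (- f) e = e + h - f" "Exp (- f) h = h - scale 2 f" "Exp (- f) f = f"
proof -
  have br: "lie e f = h" "lie f e = - h" "lie h e = scale 2 e" "lie e h = scale (- 2) e"
    "lie h f = scale (- 2) f" "lie f h = scale 2 f" "lie e e = 0" "lie f f = 0"
    using assms unfolding sl2_triple_def by (metis lie_anti lie_self minus_minus scale_minus_left)+
  show "Exp e e = e" "Exp e h = h - scale 2 e" "Exp (- f) h = h - scale 2 f" "Exp (- f) f = f"
    by (subst Exp_1; simp add: br lie_linear)+
  show "Exp e f = f + h - e" "Exp (- f) e = e + h - f"
    by (subst Exp_2; simp add: br lie_linear)+
qed

end

context eala_chevalley
begin

subsection \<open>Reflections\<close>

definition refl :: "('g \<Rightarrow> complex) \<Rightarrow> ('g \<Rightarrow> complex) \<Rightarrow> ('g \<Rightarrow> complex)" where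
  "refl \<gamma> \<beta> = \<beta> - (\<lambda>x. of_int (cartan \<beta> \<gamma>) * \<gamma> x)"

text \<open>The usual lift of the reflection in \<gamma>: in SL2 the product is the matrix with rows
  (0, 1) and (-1, 0).\<close>

definition weyl :: "('g \<Rightarrow> complex) \<Rightarrow> 'g \<Rightarrow> 'g" where
  "weyl \<gamma> v = Exp (X \<gamma>) (Exp (- X (- \<gamma>)) (Exp (X \<gamma>) v))"

context
  fixes \<gamma> assumes \<gamma>: "\<gamma> \<in> Rx"
begin

lemma weyl_nilpotent: "locally_nilpotent (X \<gamma>)" "locally_nilpotent (- X \<gamma>)"
  "locally_nilpotent (- X (- \<gamma>))" "locally_nilpotent (X (- \<gamma>))"
  using \<gamma> by (auto intro: X_nilpotent X_nilpotent_minus locally_nilpotent_minus)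

lemma weyl_add: "weyl \<gamma> (u + v) = weyl \<gamma> u + weyl \<gamma> v"
  by (simp add: weyl_def Exp_add weyl_nilpotent)

lemma weyl_scale: "weyl \<gamma> (scale c v) = scale c (weyl \<gamma> v)"
  by (simp add: weyl_def Exp_scale weyl_nilpotent)

lemma weyl_lie: "weyl \<gamma> (lie u v) = lie (weyl \<gamma> u) (weyl \<gamma> v)"
  by (simp add: weyl_def Exp_lie weyl_nilpotent)

lemma weyl_eq_zero: "weyl \<gamma> v = 0 \<Longrightarrow> v = 0"
proof -
  have 1: "v = 0" if "Exp y v = 0" "locally_nilpotent y" for y v
    using Exp_minus_inverse[OF locally_nilpotent_minus[OF that(2)], of v] that
      Exp_scale[OF locally_nilpotent_minus[OF that(2)], of 0 0] by simp
  show "weyl \<gamma> v = 0 \<Longrightarrow> v = 0"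
    unfolding weyl_def using 1 weyl_nilpotent by metis
qed

lemma weyl_X_self: "weyl \<gamma> (X \<gamma>) = - X (- \<gamma>)"
  and weyl_X_self_minus: "weyl \<gamma> (X (- \<gamma>)) = - X \<gamma>"
proof -
  note E = Exp_sl2[OF X_sl2[OF \<gamma>]]
  have minus: "Exp y (- v) = - Exp y v" if "locally_nilpotent y" for y v
    using Exp_scale[OF that, of "- 1" v] by simp
  have diff: "Exp y (u - v) = Exp y u - Exp y v" if "locally_nilpotent y" for y u v
    using Exp_add[OF that, of u "- v"] minus[OF that] by simp
  show "weyl \<gamma> (X \<gamma>) = - X (- \<gamma>)"
    unfolding weyl_def by (simp add: E diff Exp_add weyl_nilpotent scale_left_distrib[of 1 1, simplified])
  show "weyl \<gamma> (X (- \<gamma>)) = - X \<gamma>"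
    unfolding weyl_def by (simp add: E diff minus Exp_add Exp_scale weyl_nilpotent scale_left_distrib[of 1 1, simplified])
qed

lemma weyl_H:
  assumes h: "h \<in> H" shows "weyl \<gamma> h = h - scale (\<gamma> h) (coroot \<gamma>)"
proof -
  let ?e = "X \<gamma>" and ?f = "X (- \<gamma>)" and ?k = "coroot \<gamma>"
  note E = Exp_sl2[OF X_sl2[OF \<gamma>]]
  have diff: "Exp y (u - v) = Exp y u - Exp y v" if "locally_nilpotent y" for y u v
    using Exp_add[OF that, of u "- v"] Exp_scale[OF that, of "- 1" v] by simp
  have e: "lie ?e h = - scale (\<gamma> h) ?e"
    using root_spaceD[OF X_root[OF \<gamma>] h] by (metis lie_anti)
  have f: "lie ?f h = scale (\<gamma> h) ?f"
    using root_spaceD[OF X_root_minus[OF \<gamma>] h] lie_anti[of ?f h] by simp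
  have 1: "Exp ?e h = h - scale (\<gamma> h) ?e"
    by (subst Exp_1) (simp_all add: e lie_linear lie_self)
  have 2: "Exp (- ?f) h = h - scale (\<gamma> h) ?f"
    by (subst Exp_1) (simp_all add: f lie_linear lie_self)
  have "weyl \<gamma> h = Exp ?e (h - scale (\<gamma> h) ?f - scale (\<gamma> h) (?e + ?k - ?f))"
    by (simp add: weyl_def 1 2 E diff Exp_scale weyl_nilpotent)
  also have "h - scale (\<gamma> h) ?f - scale (\<gamma> h) (?e + ?k - ?f) = h - scale (\<gamma> h) (?e + ?k)"
    by (simp add: scale_right_diff_distrib)
  also have "Exp ?e \<dots> = h - scale (\<gamma> h) ?e - scale (\<gamma> h) (?e + (?k - scale 2 ?e))"
    by (simp add: diff Exp_scale Exp_add weyl_nilpotent 1 E)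
  also have "?e + (?k - scale 2 ?e) = ?k - ?e"
    by (simp add: scale_left_distrib[of 1 1, simplified])
  finally show ?thesis by (simp add: scale_right_diff_distrib)
qed

lemma weyl_root_space:
  assumes "\<beta> \<in> R" "v \<in> root_space \<beta>" shows "weyl \<gamma> v \<in> root_space (refl \<gamma> \<beta>)"
  unfolding root_space_def
proof safe
  fix h assume h: "h \<in> H"
  \<comment> \<open>On \<open>H\<close> the map \<open>weyl \<gamma>\<close> is an involution, so
    \<open>h'\<close> is the image of \<open>h\<close> and also its preimage; this lets the bracket
    with \<open>h\<close> be pulled back through \<open>weyl \<gamma>\<close>.\<close>
  define h' where "h' = weyl \<gamma> h"
  have k: "coroot \<gamma> \<in> H" by (simp add: coroot_H Rx_V[OF \<gamma>])
  have h': "h' = h - scale (\<gamma> h) (coroot \<gamma>)" "h' \<in> H"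
    using h k by (auto simp: h'_def weyl_H H_diff H_scale)
  have eval: "\<alpha> h' = \<alpha> h - \<gamma> h * \<alpha> (coroot \<gamma>)" if "\<alpha> \<in> dual" for \<alpha>
    using that h k by (simp add: h' dual_eval_diff dual_eval_scale H_scale)
  have "\<gamma> h' = - \<gamma> h" using eval[OF R_dual[OF Rx_R[OF \<gamma>]]] coroot_self[OF \<gamma>] by simp
  then have "weyl \<gamma> h' = h" using weyl_H[OF h'(2)] h'(1) by simp
  then have "lie h (weyl \<gamma> v) = weyl \<gamma> (lie h' v)" by (simp add: weyl_lie)
  also have "\<dots> = scale (\<beta> h') (weyl \<gamma> v)"
    using root_spaceD[OF assms(2) h'(2)] by (simp add: weyl_scale)
  also have "\<beta> h' = refl \<gamma> \<beta> h"
    using eval[OF R_dual[OF assms(1)]] cartan[OF assms(1) \<gamma>] by (simp add: refl_def)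
  finally show "lie h (weyl \<gamma> v) = scale (refl \<gamma> \<beta> h) (weyl \<gamma> v)" .
qed

lemma refl_V: "\<beta> \<in> V \<Longrightarrow> refl \<gamma> \<beta> \<in> V"
  unfolding refl_def by (intro V_diff zscale_V Rx_V[OF \<gamma>])

lemma refl_R: "\<beta> \<in> R \<Longrightarrow> refl \<gamma> \<beta> \<in> R"
proof -
  assume b: "\<beta> \<in> R"
  then obtain v where v: "v \<in> root_space \<beta>" "v \<noteq> 0" using root_space_zero by (auto simp: R_def)
  show ?thesis
    by (rule RI[OF V_t(1)[OF refl_V[OF R_V[OF b]]] weyl_root_space[OF b v(1)]]) (use weyl_eq_zero v in auto)
qed

lemma refl_dform: "\<beta> \<in> R \<Longrightarrow> dform (refl \<gamma> \<beta>) (refl \<gamma> \<beta>) = dform \<beta> \<beta>"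
proof -
  assume b: "\<beta> \<in> R"
  define n :: complex where "n = of_int (cartan \<beta> \<gamma>)"
  define g where "g = (\<lambda>x. n * \<gamma> x)"
  have g: "g \<in> V" "dform g u = n * dform \<gamma> u" "dform u g = n * dform u \<gamma>" for u
    using zscale_V[OF Rx_V[OF \<gamma>]] dform_zscale[OF Rx_V[OF \<gamma>]] by (auto simp: g_def n_def)
  have "dform (\<beta> - g) (\<beta> - g) = dform \<beta> \<beta> - n * (2 * dform \<beta> \<gamma> - n * dform \<gamma> \<gamma>)"
    using dform_sym[of \<gamma> \<beta>] by (simp add: dform_diff dform_diff_right g R_V b algebra_simps)
  also have "n * dform \<gamma> \<gamma> = 2 * dform \<beta> \<gamma>"
    using cartan_dform[OF b \<gamma>] by (simp add: n_def)
  also have "dform \<beta> \<beta> - n * (2 * dform \<beta> \<gamma> - 2 * dform \<beta> \<gamma>) = dform \<beta> \<beta>" by simp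
  finally show ?thesis unfolding refl_def g_def n_def .
qed

lemma refl_Rx: "\<beta> \<in> Rx \<Longrightarrow> refl \<gamma> \<beta> \<in> Rx"
  using refl_R[of \<beta>] refl_dform[of \<beta>] by (simp add: Rx_iff)

lemma refl_minus: "\<beta> \<in> R \<Longrightarrow> refl \<gamma> (- \<beta>) = - refl \<gamma> \<beta>"
  by (simp add: refl_def cartan_minus_left \<gamma> fun_eq_iff)

text \<open>The automorphism \<open>weyl \<gamma>\<close> sends \<open>X \<gamma>\<close> to
  \<open>- X (- \<gamma>)\<close> and so conjugates one exponential into the other; cancelling
  \<open>Exp (X \<gamma>)\<close> leaves the second expression for the same map.\<close>

lemma weyl_braid: "Exp (- X (- \<gamma>)) (Exp (X \<gamma>) (Exp (- X (- \<gamma>)) v)) = weyl \<gamma> v"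
proof -
  have "weyl \<gamma> (Exp (X \<gamma>) u) = Exp (- X (- \<gamma>)) (weyl \<gamma> u)" for u
    using Exp_hom[of "weyl \<gamma>", OF weyl_add weyl_scale weyl_lie weyl_nilpotent(1)] by (simp add: weyl_X_self)
  from this[of "Exp (- X \<gamma>) v"] show ?thesis
    by (simp add: Exp_minus_inverse[OF weyl_nilpotent(1)]) (simp add: weyl_def Exp_minus_inverse[OF weyl_nilpotent(1)])
qed

text \<open>\<tau> exchanges \<open>X \<gamma>\<close> and \<open>- X (- \<gamma>)\<close>, hence
  the two sides of the braid relation.\<close>

lemma tau_weyl: "\<tau> (weyl \<gamma> v) = weyl \<gamma> (\<tau> v)"
proof -
  note E = Exp_hom[of \<tau>, OF tau_add tau_scale tau_lie]
  have "\<tau> (weyl \<gamma> v) = Exp (- X (- \<gamma>)) (Exp (X \<gamma>) (Exp (- X (- \<gamma>)) (\<tau> v)))"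
    using \<gamma> by (simp add: weyl_def E weyl_nilpotent X_tau X_tau_minus tau_minus)
  then show ?thesis by (simp add: weyl_braid)
qed

text \<open>The scalar is the same for \<open>\<beta>\<close> and \<open>- \<beta>\<close> because \<open>weyl \<gamma>\<close> commutes with \<open>\<tau>\<close>, and the product
  of the two is 1 because coroots go to coroots.\<close>
lemma weyl_X:
  assumes b: "\<beta> \<in> Rx"
  obtains s :: int where "s = 1 \<or> s = - 1" "weyl \<gamma> (X \<beta>) = scale (of_int s) (X (refl \<gamma> \<beta>))"
proof -
  let ?b = "refl \<gamma> \<beta>"
  have b': "?b \<in> Rx" by (rule refl_Rx[OF b])
  obtain c where c: "weyl \<gamma> (X \<beta>) = scale c (X ?b)"
    using root_space_X[OF b' weyl_root_space[OF Rx_R[OF b] X_root[OF b]]] by auto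
  have "\<tau> (weyl \<gamma> (X \<beta>)) = weyl \<gamma> (- X (- \<beta>))" by (simp add: tau_weyl X_tau b)
  then have "weyl \<gamma> (- X (- \<beta>)) = - scale c (X (- ?b))"
    by (simp add: c tau_scale X_tau b')
  then have c': "weyl \<gamma> (X (- \<beta>)) = scale c (X (- ?b))"
    using weyl_scale[of "- 1" "X (- \<beta>)"] by simp
  have k: "weyl \<gamma> (coroot \<beta>) = scale (c * c) (coroot ?b)"
    using weyl_lie[of "X \<beta>" "X (- \<beta>)"] by (simp add: c c' X_lie b b' lie_scale_left lie_scale_right)
  have "weyl \<gamma> (lie (coroot \<beta>) (X \<beta>)) = scale 2 (weyl \<gamma> (X \<beta>))"
    using lie_coroot[OF Rx_V[OF b] X_root[OF b]] by (simp add: coroot_self b weyl_scale)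
  then have "scale (c * c * 2 * c) (X ?b) = scale (2 * c) (X ?b)"
    using lie_coroot[OF Rx_V[OF b'] X_root[OF b']]
    by (simp add: weyl_lie k c lie_scale_left lie_scale_right coroot_self b' algebra_simps)
  then have "c * c * 2 * c = 2 * c" using X_nonzero[OF b'] by (simp only: scale_cancel_right) simp
  moreover have "c \<noteq> 0" using weyl_eq_zero[of "X \<beta>"] X_nonzero[OF b] c by auto
  ultimately have "c * c = 1" by simp
  then have "c = 1 \<or> c = - 1" by (simp add: square_eq_1_iff)
  then show thesis using that[of 1] that[of "- 1"] c by auto
qed

end


subsection \<open>Cartan integers\<close>

definition shift :: "('g \<Rightarrow> complex) \<Rightarrow> ('g \<Rightarrow> complex) \<Rightarrow> int \<Rightarrow> ('g \<Rightarrow> complex)" where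
  "shift \<beta> \<alpha> n = \<beta> + (\<lambda>x. of_int n * \<alpha> x)"

lemma shift_simps [simp]:
  "shift \<beta> \<alpha> 0 = \<beta>" "shift \<beta> \<alpha> n + \<alpha> = shift \<beta> \<alpha> (n + 1)" "shift \<beta> \<alpha> n - \<alpha> = shift \<beta> \<alpha> (n - 1)"
  "shift (shift \<beta> \<alpha> m) \<alpha> n = shift \<beta> \<alpha> (m + n)" "- shift \<beta> \<alpha> n = shift (- \<beta>) \<alpha> (- n)"
  by (auto simp: shift_def fun_eq_iff algebra_simps)

lemma shift_1: "shift \<beta> \<alpha> 1 = \<beta> + \<alpha>" "shift \<beta> \<alpha> (- 1) = \<beta> - \<alpha>"
  by (auto simp: shift_def fun_eq_iff)

lemma shift_V: "\<beta> \<in> V \<Longrightarrow> \<alpha> \<in> V \<Longrightarrow> shift \<beta> \<alpha> n \<in> V"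
  by (simp add: shift_def V_add zscale_V)

lemma refl_shift: "refl \<gamma> \<beta> = shift \<beta> \<gamma> (- cartan \<beta> \<gamma>)"
  by (auto simp: refl_def shift_def fun_eq_iff)

lemma cartan_shift:
  "\<beta> \<in> R \<Longrightarrow> \<alpha> \<in> R \<Longrightarrow> \<gamma> \<in> Rx \<Longrightarrow> cartan (shift \<beta> \<alpha> n) \<gamma> = cartan \<beta> \<gamma> + n * cartan \<alpha> \<gamma>"
  by (rule cartan_eqI) (simp add: shift_def cartan)

lemma dform_shift:
  assumes "\<beta> \<in> V" "\<alpha> \<in> V"
  shows "dform (shift \<beta> \<alpha> n) u = dform \<beta> u + of_int n * dform \<alpha> u"
    "dform u (shift \<beta> \<alpha> n) = dform u \<beta> + of_int n * dform u \<alpha>"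
  using assms by (simp_all add: shift_def dform_add dform_add_right zscale_V dform_zscale)

lemma dform_shift_norm:
  assumes "\<beta> \<in> R" "\<alpha> \<in> Rx"
  shows "dform (shift \<beta> \<alpha> n) (shift \<beta> \<alpha> n) = dform \<beta> \<beta> + of_int (n * cartan \<beta> \<alpha> + n * n) * dform \<alpha> \<alpha>"
proof -
  have "dform (shift \<beta> \<alpha> n) (shift \<beta> \<alpha> n) = dform \<beta> \<beta> + of_int n * (2 * dform \<beta> \<alpha>) + of_int (n * n) * dform \<alpha> \<alpha>"
    using assms dform_sym[of \<alpha> \<beta>] by (simp add: dform_shift R_V Rx_V shift_V algebra_simps)
  also have "2 * dform \<beta> \<alpha> = of_int (cartan \<beta> \<alpha>) * dform \<alpha> \<alpha>" using cartan_dform[OF assms] by simp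
  finally show ?thesis by (simp add: algebra_simps)
qed

lemma cartan_V0: "\<delta> \<in> R \<Longrightarrow> \<delta> \<in> V0 \<Longrightarrow> \<alpha> \<in> Rx \<Longrightarrow> cartan \<delta> \<alpha> = 0"
  by (rule cartan_eqI) (simp add: coroot_eval R_V Rx_V V0_dform)

lemma cartan_eq_zero: "\<alpha> \<in> Rx \<Longrightarrow> \<beta> \<in> Rx \<Longrightarrow> cartan \<beta> \<alpha> = 0 \<longleftrightarrow> dform \<alpha> \<beta> = 0"
  using cartan_dform[of \<beta> \<alpha>] Rx_norm[of \<alpha>] by (auto simp: Rx_R dform_sym)

lemma cartan_norms:
  "\<alpha> \<in> Rx \<Longrightarrow> \<beta> \<in> Rx \<Longrightarrow> of_int (cartan \<beta> \<alpha>) * dform \<alpha> \<alpha> = of_int (cartan \<alpha> \<beta>) * dform \<beta> \<beta>"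
  using cartan_dform[of \<beta> \<alpha>] cartan_dform[of \<alpha> \<beta>] by (simp add: Rx_R dform_sym)

lemma cartan_sym:
  "\<alpha> \<in> Rx \<Longrightarrow> \<beta> \<in> Rx \<Longrightarrow> dform \<alpha> \<alpha> = dform \<beta> \<beta> \<Longrightarrow> cartan \<beta> \<alpha> = cartan \<alpha> \<beta>"
  using cartan_norms[of \<alpha> \<beta>] Rx_norm[of \<beta>] by simp

text \<open>Suppose k = \<open>cartan \<beta> \<alpha>\<close> is at least 5. Then \<beta> -
  2\<alpha> is a root whose Cartan integer at \<alpha> is k - 4 and whose norm is (5 - 2k) times
  that of \<alpha>. Comparing the two Cartan integers of this pair shows that 2k - 5 divides k - 4,
  although 0 < k - 4 < 2k - 5.\<close>

lemma cartan_same_norm_le: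
  assumes a: "\<alpha> \<in> Rx" and b: "\<beta> \<in> Rx" and norm: "dform \<alpha> \<alpha> = dform \<beta> \<beta>"
  shows "cartan \<beta> \<alpha> \<le> 4"
proof (rule ccontr)
  define k where "k = cartan \<beta> \<alpha>"
  assume "\<not> cartan \<beta> \<alpha> \<le> 4"
  then have k: "k \<ge> 5" by (simp add: k_def)
  have 1: "shift \<beta> \<alpha> (- 1) \<in> R"
    using root_diff[OF Rx_R[OF b] a] k by (simp add: k_def shift_1)
  have "shift \<beta> \<alpha> (- 1) - \<alpha> \<in> R"
    by (rule root_diff[OF 1 a]) (use k in \<open>simp add: cartan_shift a b Rx_R cartan_self k_def[symmetric]\<close>)
  then have g: "shift \<beta> \<alpha> (- 2) \<in> R" by simp
  have c: "cartan (shift \<beta> \<alpha> (- 2)) \<alpha> = k - 4"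
    by (simp add: cartan_shift a b Rx_R cartan_self k_def)
  have g: "shift \<beta> \<alpha> (- 2) \<in> Rx"
    using Rx_iff_V0[OF g] cartan_V0[OF g _ a] c k by force
  define z where "z = cartan \<alpha> (shift \<beta> \<alpha> (- 2))"
  have "of_int (k - 4) * dform \<alpha> \<alpha> = of_int (z * (5 - 2 * k)) * dform \<alpha> \<alpha>"
    using cartan_norms[OF a g] dform_shift_norm[OF Rx_R[OF b] a, of "- 2"] norm
    by (simp add: c z_def k_def algebra_simps)
  then have "k - 4 = z * (5 - 2 * k)" using Rx_norm[OF a] by (simp only: mult_cancel_right of_int_eq_iff) simp
  then have "(2 * k - 5) dvd (k - 4)" by (metis dvd_minus_iff dvd_triv_right minus_diff_eq minus_dvd_iff)
  then have "2 * k - 5 \<le> k - 4" using k by (intro zdvd_imp_le) auto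
  then show False using k by simp
qed

lemma cartan_same_norm:
  assumes "\<alpha> \<in> Rx" "\<beta> \<in> Rx" "dform \<alpha> \<alpha> = dform \<beta> \<beta>"
  shows "\<bar>cartan \<beta> \<alpha>\<bar> \<le> 4"
  using cartan_same_norm_le[OF assms] cartan_same_norm_le[of \<alpha> "- \<beta>"] assms
  by (simp add: Rx_minus Rx_R cartan_minus_left dform_minus_minus Rx_V)

lemma cartan_refl:
  "\<alpha> \<in> Rx \<Longrightarrow> \<beta> \<in> R \<Longrightarrow> \<gamma> \<in> Rx \<Longrightarrow> cartan (refl \<gamma> \<beta>) \<alpha> = cartan \<beta> \<alpha> - cartan \<beta> \<gamma> * cartan \<gamma> \<alpha>"
  by (simp add: refl_shift cartan_shift Rx_R)

text \<open>If the product were negative or above 4, then the iterated reflections of \<open>\<alpha>\<close> would yield roots of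
  the norm of \<open>\<alpha>\<close> with large Cartan integers.\<close>
lemma cartan_product:
  assumes a: "\<alpha> \<in> Rx" and b: "\<beta> \<in> Rx"
  shows "0 \<le> cartan \<alpha> \<beta> * cartan \<beta> \<alpha>" "cartan \<alpha> \<beta> * cartan \<beta> \<alpha> \<le> 4"
proof -
  define u where "u = refl \<beta> \<alpha>"
  define c where "c = 2 - cartan \<alpha> \<beta> * cartan \<beta> \<alpha>"
  have u: "u \<in> Rx" "dform u u = dform \<alpha> \<alpha>"
    using refl_Rx[OF b a] refl_dform[OF b Rx_R[OF a]] by (auto simp: u_def)
  have cu: "cartan u \<alpha> = c" by (simp add: u_def c_def cartan_refl a b Rx_R cartan_self)
  then have cu': "cartan \<alpha> u = c" using cartan_sym[OF a u(1)] u(2) by simp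
  have "cartan (refl u \<alpha>) \<alpha> = 2 - c * c"
    by (simp add: cartan_refl a u Rx_R cartan_self cu cu')
  moreover have "refl u \<alpha> \<in> Rx" "dform (refl u \<alpha>) (refl u \<alpha>) = dform \<alpha> \<alpha>"
    using refl_Rx[OF u(1) a] refl_dform[OF u(1) Rx_R[OF a]] by auto
  ultimately have "\<bar>2 - c * c\<bar> \<le> 4" using cartan_same_norm[OF a, of "refl u \<alpha>"] by simp
  then have cc: "c * c \<le> 6" by linarith
  have "\<bar>c\<bar> \<le> 2"
  proof (rule ccontr)
    assume "\<not> \<bar>c\<bar> \<le> 2"
    then have "3 * 3 \<le> \<bar>c\<bar> * \<bar>c\<bar>" by (intro mult_mono) auto
    then show False using cc by (simp add: abs_mult_self_eq)
  qed
  then show "0 \<le> cartan \<alpha> \<beta> * cartan \<beta> \<alpha>" "cartan \<alpha> \<beta> * cartan \<beta> \<alpha> \<le> 4" by (auto simp: c_def)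
qed

lemma cls_eq_iff: "cls v = cls w \<longleftrightarrow> v - w \<in> V0"
proof
  assume "cls v = cls w"
  moreover have "v \<in> cls v" using V0_zero by (force simp: cls_def)
  ultimately show "v - w \<in> V0" by (auto simp: cls_def)
next
  assume d: "v - w \<in> V0"
  have "v + u \<in> cls w" if "u \<in> V0" for u
    using V0_add[OF d that] by (auto simp: cls_def intro!: exI[of _ "v - w + u"])
  moreover have "w + u \<in> cls v" if "u \<in> V0" for u
    using V0_diff[OF that d] by (auto simp: cls_def intro!: exI[of _ "u - (v - w)"])
  ultimately show "cls v = cls w" by (auto simp: cls_def)
qed

lemma reduced_multiple:
  assumes "\<alpha> \<in> Rx" "\<beta> \<in> Rx" "\<beta> - (\<lambda>x. complex_of_real r * \<alpha> x) \<in> V0"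
  shows "r = 1 \<or> r = - 1"
proof -
  have "cls (\<lambda>x. complex_of_real r * \<alpha> x) = cls \<beta>"
    using V0_minus[OF assms(3)] by (simp add: cls_eq_iff)
  moreover have "cls \<beta> \<in> Rbar - {cls 0}" "cls \<alpha> \<noteq> cls 0"
    using assms(1,2) Rx_iff_V0[OF Rx_R[OF assms(1)]] Rx_iff_V0[OF Rx_R[OF assms(2)]]
    by (auto simp: Rbar_def cls_eq_iff Rx_R)
  ultimately show ?thesis using reduced assms(1) Rx_R unfolding reduced_def by metis
qed

text \<open>For roots, this means by reducedness that the classes modulo \<open>V0\<close> are not proportional.\<close>
definition nonpar :: "('g \<Rightarrow> complex) \<Rightarrow> ('g \<Rightarrow> complex) \<Rightarrow> bool" where
  "nonpar \<alpha> \<beta> \<longleftrightarrow> \<beta> - \<alpha> \<notin> V0 \<and> \<beta> + \<alpha> \<notin> V0"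

lemma nonpar_sym: "nonpar \<alpha> \<beta> \<Longrightarrow> nonpar \<beta> \<alpha>"
  using V0_minus[of "\<alpha> - \<beta>"] by (auto simp: nonpar_def add.commute)

lemma nonpar_minus: "nonpar \<alpha> \<beta> \<Longrightarrow> nonpar \<alpha> (- \<beta>)" "nonpar \<alpha> \<beta> \<Longrightarrow> nonpar (- \<alpha>) \<beta>"
  using V0_minus[of "- \<beta> - \<alpha>"] V0_minus[of "- \<beta> + \<alpha>"] by (auto simp: nonpar_def add.commute)

lemma nonpar_cong:
  assumes "nonpar \<alpha> \<beta>" "\<alpha>' - \<alpha> \<in> V0" "\<beta>' - \<beta> \<in> V0" shows "nonpar \<alpha>' \<beta>'"
proof -
  have "\<beta> - \<alpha> = (\<beta>' - \<alpha>') - (\<beta>' - \<beta>) + (\<alpha>' - \<alpha>)" "\<beta> + \<alpha> = (\<beta>' + \<alpha>') - (\<beta>' - \<beta>) - (\<alpha>' - \<alpha>)" by auto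
  then show ?thesis using assms V0_add V0_diff unfolding nonpar_def by metis
qed

text \<open>Up to signs and exchange the Cartan integers are (2, 2) or (4, 1). In the first case
  \<beta> - \<alpha> is an isotropic root, so it lies in \<open>V0\<close>; in the second \<beta> -
  2\<alpha> is one, which reducedness forbids.\<close>

lemma cartan_product_4:
  assumes a: "\<alpha> \<in> Rx" and b: "\<beta> \<in> Rx" and prod: "cartan \<alpha> \<beta> * cartan \<beta> \<alpha> = 4"
  shows "\<not> nonpar \<alpha> \<beta>"
proof -
  have main: "\<not> nonpar \<alpha> \<beta>" if a: "\<alpha> \<in> Rx" and b: "\<beta> \<in> Rx" and prod: "cartan \<alpha> \<beta> * cartan \<beta> \<alpha> = 4"
    and pos: "cartan \<beta> \<alpha> \<ge> 2" for \<alpha> \<beta>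
  proof -
    define k l where "k = cartan \<beta> \<alpha>" and "l = cartan \<alpha> \<beta>"
    have "k dvd 4" using prod by (metis dvd_triv_right k_def)
    then have "k \<le> 4" by (rule zdvd_imp_le) simp
    then have "k = 2 \<or> k = 3 \<or> k = 4" using pos by (auto simp: k_def)
    moreover have "k \<noteq> 3" using \<open>k dvd 4\<close> by auto
    ultimately consider "k = 2" "l = 2" | "k = 4" "l = 1" using prod by (auto simp: k_def l_def)
    then show ?thesis
    proof cases
      case 1
      then have n: "dform \<alpha> \<alpha> = dform \<beta> \<beta>" using cartan_norms[OF a b] by (simp add: k_def l_def)
      have r: "shift \<beta> \<alpha> (- 1) \<in> R" using root_diff[OF Rx_R[OF b] a] 1 by (simp add: k_def shift_1)
      have "dform (shift \<beta> \<alpha> (- 1)) (shift \<beta> \<alpha> (- 1)) = 0"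
        using dform_shift_norm[OF Rx_R[OF b] a, of "- 1"] 1 n by (simp add: k_def)
      then have "\<beta> - \<alpha> \<in> V0" using r Rx_iff Rx_iff_V0 by (metis shift_1(2))
      then show ?thesis by (simp add: nonpar_def)
    next
      case 2
      then have n: "4 * dform \<alpha> \<alpha> = dform \<beta> \<beta>" using cartan_norms[OF a b] by (simp add: k_def l_def)
      have r: "shift \<beta> \<alpha> (- 1) \<in> R" using root_diff[OF Rx_R[OF b] a] 2 by (simp add: k_def shift_1)
      have "shift \<beta> \<alpha> (- 1) - \<alpha> \<in> R"
        by (rule root_diff[OF r a]) (use 2 in \<open>simp add: cartan_shift a b Rx_R cartan_self k_def[symmetric]\<close>)
      then have r: "shift \<beta> \<alpha> (- 2) \<in> R" by simp
      have "dform (shift \<beta> \<alpha> (- 2)) (shift \<beta> \<alpha> (- 2)) = 0"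
        using dform_shift_norm[OF Rx_R[OF b] a, of "- 2"] 2 n by (simp add: k_def)
      then have "shift \<beta> \<alpha> (- 2) \<in> V0" using r Rx_iff Rx_iff_V0 by metis
      moreover have "shift \<beta> \<alpha> (- 2) = \<beta> - (\<lambda>x. complex_of_real 2 * \<alpha> x)"
        by (auto simp: shift_def fun_eq_iff)
      ultimately show ?thesis using reduced_multiple[OF a b, of 2] by simp
    qed
  qed
  have main2: "\<not> nonpar \<alpha> \<beta>" if a: "\<alpha> \<in> Rx" and b: "\<beta> \<in> Rx" and prod: "cartan \<alpha> \<beta> * cartan \<beta> \<alpha> = 4"
    and pos: "cartan \<beta> \<alpha> > 0" for \<alpha> \<beta>
  proof (cases "cartan \<beta> \<alpha> = 1")
    case True
    then show ?thesis using main[OF b a] prod nonpar_sym by (auto simp: mult.commute)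
  qed (use main[OF a b prod] pos in linarith)
  have "cartan \<beta> \<alpha> \<noteq> 0" using prod by auto
  then consider "cartan \<beta> \<alpha> > 0" | "cartan (- \<beta>) \<alpha> > 0"
    using cartan_minus_left[OF Rx_R[OF b] a] by linarith
  then show ?thesis
  proof cases
    case 2
    then have "\<not> nonpar \<alpha> (- \<beta>)"
      using prod by (intro main2) (auto simp: a b Rx_minus cartan_minus_left cartan_minus_right Rx_R)
    then show ?thesis using nonpar_minus by blast
  qed (rule main2[OF a b prod])
qed

text \<open>A nonzero Cartan integer divides the product, which is then positive because the two
  integers vanish together.\<close>

lemma cartan_abs_le:
  assumes a: "\<alpha> \<in> Rx" and b: "\<beta> \<in> Rx" and le: "cartan \<alpha> \<beta> * cartan \<beta> \<alpha> \<le> n"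
  shows "\<bar>cartan \<beta> \<alpha>\<bar> \<le> n"
proof (cases "cartan \<beta> \<alpha> = 0")
  case False
  then have "cartan \<alpha> \<beta> * cartan \<beta> \<alpha> \<noteq> 0"
    using cartan_eq_zero[OF a b] cartan_eq_zero[OF b a] by (auto simp: dform_sym)
  then have "0 < cartan \<alpha> \<beta> * cartan \<beta> \<alpha>"
    using cartan_product(1)[OF a b] by (simp add: order_less_le)
  moreover have "\<bar>cartan \<beta> \<alpha>\<bar> dvd cartan \<alpha> \<beta> * cartan \<beta> \<alpha>" by simp
  ultimately show ?thesis using zdvd_imp_le le by fastforce
qed (use le cartan_product(1)[OF a b] in simp)

lemma nonpar_cartan:
  assumes a: "\<alpha> \<in> Rx" and b: "\<beta> \<in> Rx" and "nonpar \<alpha> \<beta>"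
  shows "cartan \<alpha> \<beta> * cartan \<beta> \<alpha> \<in> {0..3}" "\<bar>cartan \<beta> \<alpha>\<bar> \<le> 3"
proof -
  show 1: "cartan \<alpha> \<beta> * cartan \<beta> \<alpha> \<in> {0..3}"
    using cartan_product[OF a b] cartan_product_4[OF a b] assms(3) by force
  then show "\<bar>cartan \<beta> \<alpha>\<bar> \<le> 3" by (intro cartan_abs_le[OF a b]) simp
qed

text \<open>If \<beta> + k\<alpha> were in \<open>V0\<close>, reducedness would give k = 1 or k = -
  1, which \<open>nonpar\<close> excludes. So the \<alpha>-string through \<beta> never meets the
  isotropic roots.\<close>

lemma nonpar_shift:
  assumes a: "\<alpha> \<in> Rx" and b: "\<beta> \<in> Rx" and np: "nonpar \<alpha> \<beta>" and s: "shift \<beta> \<alpha> n \<in> R"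
  shows "shift \<beta> \<alpha> n \<in> Rx" "nonpar \<alpha> (shift \<beta> \<alpha> n)"
proof -
  have main: False if "shift \<beta> \<alpha> k \<in> V0" for k
  proof -
    have "\<beta> - (\<lambda>x. complex_of_real (- of_int k) * \<alpha> x) = shift \<beta> \<alpha> k"
      by (auto simp: shift_def fun_eq_iff)
    then have "real_of_int (- k) = 1 \<or> real_of_int (- k) = - 1"
      using reduced_multiple[OF a b, of "- of_int k"] that by simp
    then have "k = - 1 \<or> k = 1" by linarith
    then show False using np that by (auto simp: nonpar_def shift_1)
  qed
  show "shift \<beta> \<alpha> n \<in> Rx" using main Rx_iff_V0[OF s] by blast
  show "nonpar \<alpha> (shift \<beta> \<alpha> n)" unfolding nonpar_def using main by auto
qed


subsection \<open>Root strings and structure constants\<close>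

lemma lie_not_root:
  assumes "u \<in> root_space \<alpha>" "v \<in> root_space \<beta>" "\<alpha> \<in> V" "\<beta> \<in> V" "\<beta> + \<alpha> \<notin> R"
  shows "lie u v = 0"
  using RI[OF V_t(1)[OF V_add[OF assms(3,4)]] root_space_lie[OF assms(1,2)]] assms(5)
  by (auto simp: add.commute)

text \<open>Pair both sides with \<open>X (- \<nu>)\<close>, and apply \<open>\<tau>\<close> to the assumption.\<close>
lemma lie_X_dual:
  assumes a: "\<alpha> \<in> Rx" and n: "\<nu> \<in> Rx" and an: "\<nu> + \<alpha> \<in> Rx"
    and c: "lie (X \<alpha>) (X \<nu>) = scale c (X (\<nu> + \<alpha>))"
  shows "lie (X (- \<alpha>)) (X (\<nu> + \<alpha>)) = scale (c * dform \<nu> \<nu> / dform (\<nu> + \<alpha>) (\<nu> + \<alpha>)) (X \<nu>)"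
proof -
  have "lie (X (- \<alpha>)) (X (\<nu> + \<alpha>)) \<in> root_space \<nu>"
    using root_space_lie[OF X_root_minus[OF a] X_root[OF an]] by simp
  then obtain d where d: "lie (X (- \<alpha>)) (X (\<nu> + \<alpha>)) = scale d (X \<nu>)" using root_space_X[OF n] by auto
  have "\<tau> (lie (X \<alpha>) (X \<nu>)) = \<tau> (scale c (X (\<nu> + \<alpha>)))" by (simp only: c)
  then have c': "lie (X (- \<alpha>)) (X (- \<nu>)) = - scale c (X (- (\<nu> + \<alpha>)))"
    using a n an by (simp only: tau_lie tau_scale X_tau lie_minus_left lie_minus_right) simp
  have "form (lie (X (- \<alpha>)) (X (\<nu> + \<alpha>))) (X (- \<nu>)) = - form (lie (X (\<nu> + \<alpha>)) (X (- \<alpha>))) (X (- \<nu>))"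
    by (subst lie_anti) (simp add: form_minus_left)
  also have "\<dots> = c * form (X (\<nu> + \<alpha>)) (X (- (\<nu> + \<alpha>)))"
    by (simp only: A1_invariant c' form_minus_right form_scale_right) simp
  finally have "d * (2 / dform \<nu> \<nu>) = c * (2 / dform (\<nu> + \<alpha>) (\<nu> + \<alpha>))"
    by (simp only: d form_scale form_X[OF n] form_X[OF an])
  then have "d = c * dform \<nu> \<nu> / dform (\<nu> + \<alpha>) (\<nu> + \<alpha>)"
    using Rx_norm[OF n] Rx_norm[OF an] by (simp add: field_simps)
  then show ?thesis using d by simp
qed

lemma ad_X_root_space:
  assumes "\<alpha> \<in> Rx" "v \<in> root_space \<beta>"
  shows "(lie (X \<alpha>) ^^ k) v \<in> root_space (shift \<beta> \<alpha> (int k))"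
proof (induction k)
  case (Suc k)
  have "\<alpha> + shift \<beta> \<alpha> (int k) = shift \<beta> \<alpha> (int (Suc k))"
    by (simp add: shift_def fun_eq_iff algebra_simps)
  then show ?case using root_space_lie[OF X_root[OF assms(1)] Suc] by simp
qed (use assms in simp)

lemma root_string:
  assumes a: "\<alpha> \<in> Rx" and b: "\<beta> \<in> Rx" and np: "nonpar \<alpha> \<beta>"
  obtains \<mu> m r where "\<beta> = shift \<mu> \<alpha> (int r)" "r \<le> m" "m \<le> 3" "\<mu> \<in> Rx" "nonpar \<alpha> \<mu>"
    "cartan \<mu> \<alpha> = - int m" "\<And>i. shift \<mu> \<alpha> i \<in> R \<longleftrightarrow> 0 \<le> i \<and> i \<le> int m"
proof -
  let ?P = "\<lambda>r. shift \<beta> \<alpha> (- int r) \<in> R"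
  define r where "r = Greatest ?P"
  \<comment> \<open>The Cartan integers of \<beta> and \<beta> - r\<alpha> both lie between - 3 and
    3 and differ by 2r.\<close>
  have bound: "r \<le> 3" if "?P r" for r
    using nonpar_cartan(2)[OF a nonpar_shift[OF a b np that]] nonpar_cartan(2)[OF a b np]
    by (simp add: cartan_shift a b Rx_R cartan_self)
  have r: "?P r" unfolding r_def using Rx_R[OF b] bound by (intro GreatestI_nat[of ?P 0 3]) auto
  have r': "k \<le> r" if "?P k" for k unfolding r_def using bound that by (intro Greatest_le_nat[of ?P _ 3]) auto
  define \<mu> where "\<mu> = shift \<beta> \<alpha> (- int r)"
  have b_mu: "\<beta> = shift \<mu> \<alpha> (int r)" by (simp add: \<mu>_def)
  have mu: "\<mu> \<in> Rx" "nonpar \<alpha> \<mu>" using nonpar_shift[OF a b np r] by (auto simp: \<mu>_def)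
  have low: "shift \<mu> \<alpha> i \<notin> R" if "i < 0" for i
  proof
    assume "shift \<mu> \<alpha> i \<in> R"
    then have "nat (int r - i) \<le> r" using that by (intro r') (simp add: \<mu>_def)
    then show False using that by simp
  qed
  define m where "m = nat (- cartan \<mu> \<alpha>)"
  have "\<not> cartan \<mu> \<alpha> > 0"
    using root_diff[OF Rx_R[OF mu(1)] a] low[of "- 1"] by (auto simp: shift_1)
  then have c: "cartan \<mu> \<alpha> = - int m" by (simp add: m_def)
  have "m \<le> 3" using nonpar_cartan(2)[OF a mu] c by simp
  have f: "lie (X (- \<alpha>)) (X \<mu>) = 0"
    using low[of "- 1"] by (intro lie_not_root[OF X_root_minus[OF a] X_root[OF mu(1)]])
      (auto simp: shift_1 V_minus Rx_V a mu)
  have w: "lie (coroot \<alpha>) (X \<mu>) = scale (- of_nat m) (X \<mu>)"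
    using lie_coroot[OF Rx_V[OF a] X_root[OF mu(1)]] cartan[OF Rx_R[OF mu(1)] a] c by simp
  obtain n where n: "- of_nat m = (- of_nat n :: complex)" "\<And>k. k \<le> n \<Longrightarrow> (lie (X \<alpha>) ^^ k) (X \<mu>) \<noteq> 0"
    using sl2_lowest_weight[OF X_sl2[OF a] w f X_nonzero[OF mu(1)] X_nilpotent[OF a]] by metis
  have "m = n" using n(1) by simp
  have up: "shift \<mu> \<alpha> i \<in> R" if "0 \<le> i" "i \<le> int m" for i
    using RI[OF V_t(1)[OF shift_V[OF Rx_V[OF mu(1)] Rx_V[OF a]]] ad_X_root_space[OF a X_root[OF mu(1)], of "nat i"]]
      n(2)[of "nat i"] that \<open>m = n\<close> by simp
  \<comment> \<open>The reflection in \<alpha> reverses the string: index \<open>i\<close> goes to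
    \<open>m - i\<close>, which is negative here.\<close>
  have "shift \<mu> \<alpha> i \<notin> R" if "i > int m" for i
  proof
    assume s: "shift \<mu> \<alpha> i \<in> R"
    have "refl \<alpha> (shift \<mu> \<alpha> i) = shift \<mu> \<alpha> (int m - i)"
      by (simp add: refl_shift cartan_shift a mu Rx_R c cartan_self)
    then show False using refl_R[OF a s] low[of "int m - i"] that by simp
  qed
  then have iff: "shift \<mu> \<alpha> i \<in> R \<longleftrightarrow> 0 \<le> i \<and> i \<le> int m" for i
    using low up by (meson not_le)
  moreover have "r \<le> m" using iff[of "int r"] b_mu Rx_R[OF b] by simp
  ultimately show thesis using that b_mu mu c \<open>m \<le> 3\<close> by blast
qed

text \<open>The Chevalley rule. By \<open>lie_X_dual\<close> the coefficients going up and down the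
  string differ by a ratio of norms, so the sl2 formula reads c^2 |n1|^2 = (i + 1)(m - i) |n2|^2,
  where | |^2 denotes the values of \<open>dform\<close>. The root lengths in the string then leave
  c^2 = (i + 1)^2.\<close>

lemma string_coeff:
  assumes a: "\<alpha> \<in> Rx" and mu: "\<mu> \<in> Rx" "nonpar \<alpha> \<mu>" "cartan \<mu> \<alpha> = - int m" and m: "m \<le> 3"
    and iff: "\<And>i. shift \<mu> \<alpha> i \<in> R \<longleftrightarrow> 0 \<le> i \<and> i \<le> int m" and i: "i < m"
  obtains s :: int where "s = 1 \<or> s = - 1"
    "lie (X \<alpha>) (X (shift \<mu> \<alpha> (int i))) = scale (of_int (s * (int i + 1))) (X (shift \<mu> \<alpha> (int i + 1)))"
proof -
  define n1 where "n1 = shift \<mu> \<alpha> (int i)"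
  define n2 where "n2 = shift \<mu> \<alpha> (int i + 1)"
  have n12: "n2 = n1 + \<alpha>" by (simp add: n1_def n2_def)
  have n1: "n1 \<in> Rx" and n2: "n2 \<in> Rx"
    using nonpar_shift(1)[OF a mu(1,2)] iff i by (auto simp: n1_def n2_def)
  let ?E = "\<lambda>k. (lie (X \<alpha>) ^^ k) (X \<mu>)"
  have f: "lie (X (- \<alpha>)) (X \<mu>) = 0"
    using iff[of "- 1"] by (intro lie_not_root[OF X_root_minus[OF a] X_root[OF mu(1)]])
      (auto simp: shift_1 V_minus Rx_V a mu)
  have w: "lie (coroot \<alpha>) (X \<mu>) = scale (- of_nat m) (X \<mu>)"
    using lie_coroot[OF Rx_V[OF a] X_root[OF mu(1)]] cartan[OF Rx_R[OF mu(1)] a] mu(3) by simp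
  obtain n where n: "- of_nat m = (- of_nat n :: complex)" "\<And>k. k \<le> n \<Longrightarrow> ?E k \<noteq> 0"
    using sl2_lowest_weight[OF X_sl2[OF a] w f X_nonzero[OF mu(1)] X_nilpotent[OF a]] by metis
  have "m = n" using n(1) by simp
  obtain p where p: "?E i = scale p (X n1)"
    using root_space_X[OF n1] ad_X_root_space[OF a X_root[OF mu(1)], of i] by (metis n1_def)
  have "p \<noteq> 0" using n(2)[of i] i \<open>m = n\<close> p by auto
  obtain c where c: "lie (X \<alpha>) (X n1) = scale c (X n2)"
    using root_space_X[OF n2] root_space_lie[OF X_root[OF a] X_root[OF n1]] by (metis n12 add.commute)
  have d: "lie (X (- \<alpha>)) (X n2) = scale (c * dform n1 n1 / dform n2 n2) (X n1)"
    using lie_X_dual[OF a n1] n2 c by (simp add: n12)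
  have "lie (X (- \<alpha>)) (?E (Suc i)) = scale (- (of_nat (Suc i) * (- of_nat m + of_nat i))) (?E i)"
    by (rule sl2_lowest[OF X_sl2[OF a] w f])
  then have "scale (p * c * (c * dform n1 n1 / dform n2 n2)) (X n1) =
      scale (- (of_nat (Suc i) * (- of_nat m + of_nat i)) * p) (X n1)"
    by (simp only: p c d funpow.simps o_apply lie_scale_right) (simp add: c d lie_scale_right mult.assoc)
  then have "p * c * (c * dform n1 n1 / dform n2 n2) = - (of_nat (Suc i) * (- of_nat m + of_nat i)) * p"
    using X_nonzero[OF n1] by (simp only: scale_cancel_right) simp
  then have cc: "c * c * dform n1 n1 = of_nat (Suc i) * (of_nat m - of_nat i) * dform n2 n2"
  proof -
    let ?K = "of_nat (Suc i) * (of_nat m - of_nat i) :: complex"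
    assume "p * c * (c * dform n1 n1 / dform n2 n2) = - (of_nat (Suc i) * (- of_nat m + of_nat i)) * p"
    then have "p * (c * (c * dform n1 n1 / dform n2 n2)) = p * ?K" by (simp add: algebra_simps)
    then have "c * (c * dform n1 n1 / dform n2 n2) = ?K" using \<open>p \<noteq> 0\<close> by (simp only: mult_cancel_left) simp
    then show ?thesis using Rx_norm[OF n2] by (simp add: divide_eq_eq mult.assoc)
  qed
  let ?q = "dform \<alpha> \<alpha>" and ?r = "dform \<mu> \<mu>"
  have norm: "dform (shift \<mu> \<alpha> k) (shift \<mu> \<alpha> k) = ?r + of_int (k * (k - int m)) * ?q" for k
    using dform_shift_norm[OF Rx_R[OF mu(1)] a, of k] mu(3) by (simp add: algebra_simps)
  \<comment> \<open>For m = 2 or 3 the product of the Cartan integers is nonzero and at most 3, so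
    the other one is - 1 and the bottom \<mu> of the string is a long root.\<close>
  have r: "?r = of_nat m * ?q" if "m > 1"
  proof -
    have "cartan \<alpha> \<mu> * (- int m) \<in> {0..3}" using nonpar_cartan(1)[OF a mu(1,2)] mu(3) by simp
    moreover have "cartan \<alpha> \<mu> \<noteq> 0"
      using cartan_eq_zero[OF a mu(1)] cartan_eq_zero[OF mu(1) a] mu(3) that by (simp add: dform_sym)
    moreover have "m = 2 \<or> m = 3" using that m by auto
    ultimately have "cartan \<alpha> \<mu> = - 1" by auto
    then show ?thesis using cartan_norms[OF a mu(1)] mu(3) by simp
  qed
  have nz: "?q \<noteq> 0" "?r \<noteq> 0" using Rx_norm a mu(1) by auto
  have "c * c = (of_nat i + 1) * (of_nat i + 1)"
  proof -
    consider "m = 1" "i = 0" | "m = 2" "i = 0" | "m = 2" "i = 1" | "m = 3" "i = 0" | "m = 3" "i = 1" | "m = 3" "i = 2"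
      using m i by linarith
    then show ?thesis
      using cc r nz by cases (auto simp: n1_def n2_def norm)
  qed
  then have "c = of_nat i + 1 \<or> c = - (of_nat i + 1)" by (simp only: square_eq_iff)
  then have "c = of_int (1 * (int i + 1)) \<or> c = of_int ((- 1) * (int i + 1))" by simp
  then show thesis using that c unfolding n1_def n2_def by metis
qed

lemma nonpar_lie:
  assumes a: "\<alpha> \<in> Rx" and b: "\<beta> \<in> Rx" and np: "nonpar \<alpha> \<beta>" and ab: "\<beta> + \<alpha> \<in> R"
  obtains s r m :: int where "s = 1 \<or> s = - 1" "cartan \<beta> \<alpha> = 2 * r - m" "0 \<le> r" "r < m" "m \<le> 3"
    "lie (X \<alpha>) (X \<beta>) = scale (of_int (s * (r + 1))) (X (\<beta> + \<alpha>))" "r \<ge> 1 \<Longrightarrow> \<beta> - \<alpha> \<in> R"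
proof -
  obtain \<mu> m r where s: "\<beta> = shift \<mu> \<alpha> (int r)" "r \<le> m" "m \<le> 3" "\<mu> \<in> Rx" "nonpar \<alpha> \<mu>"
    "cartan \<mu> \<alpha> = - int m" "\<And>i. shift \<mu> \<alpha> i \<in> R \<longleftrightarrow> 0 \<le> i \<and> i \<le> int m"
    using root_string[OF a b np] by metis
  have "shift \<mu> \<alpha> (int r + 1) \<in> R" using ab s(1) by simp
  then have rm: "r < m" using s(7) by simp
  obtain t where t: "t = 1 \<or> t = - 1"
    "lie (X \<alpha>) (X (shift \<mu> \<alpha> (int r))) = scale (of_int (t * (int r + 1))) (X (shift \<mu> \<alpha> (int r + 1)))"
    by (rule string_coeff[OF a s(4-6,3,7) rm])
  have "cartan \<beta> \<alpha> = 2 * int r - int m"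
    by (simp add: s(1) cartan_shift s(4,6) a Rx_R cartan_self)
  moreover have "\<beta> - \<alpha> \<in> R" if "int r \<ge> 1" using that s(7)[of "int r - 1"] rm by (simp add: s(1))
  ultimately show thesis using that[of t "int r" "int m"] t rm s(3) s(1) by simp
qed

text \<open>The value 0 outside \<open>Rx\<close> lets one bracket formula cover the case in which
  the sum is not a nonisotropic root.\<close>

definition X0 :: "('g \<Rightarrow> complex) \<Rightarrow> 'g" where
  "X0 \<gamma> = (if \<gamma> \<in> Rx then X \<gamma> else 0)"

text \<open>A divisor of the structure constant that depends only on the Cartan integer, and hence
  only on the classes modulo \<open>V0\<close>. In \<open>nonpar_lie\<close> the constant is r + 1
  up to sign, with r < m \<le> 3; here 2r - m = 0 forces r = 1, and 2r - m = 1 forces r = 2.\<close>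

lemma nonpar_lie_int:
  assumes a: "\<alpha> \<in> Rx" and b: "\<beta> \<in> Rx" and np: "nonpar \<alpha> \<beta>"
  obtains k where "lie (X \<alpha>) (X \<beta>) =
    scale (of_int ((if cartan \<beta> \<alpha> = 0 then 2 else if cartan \<beta> \<alpha> = 1 then 3 else 1) * k)) (X0 (\<beta> + \<alpha>))"
proof (cases "\<beta> + \<alpha> \<in> R")
  case True
  then have x: "\<beta> + \<alpha> \<in> Rx" using nonpar_shift(1)[OF a b np, of 1] by (simp add: shift_1)
  obtain s r m :: int where *: "cartan \<beta> \<alpha> = 2 * r - m" "0 \<le> r" "r < m" "m \<le> 3"
    "lie (X \<alpha>) (X \<beta>) = scale (of_int (s * (r + 1))) (X (\<beta> + \<alpha>))"
    using nonpar_lie[OF a b np True] by metis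
  consider "cartan \<beta> \<alpha> = 0" "r = 1" | "cartan \<beta> \<alpha> = 1" "r = 2" | "cartan \<beta> \<alpha> \<noteq> 0" "cartan \<beta> \<alpha> \<noteq> 1"
    using * by linarith
  then show thesis
  proof cases
    case 1 then show ?thesis using that[of s] * x by (simp add: X0_def mult.commute)
  next
    case 2 then show ?thesis using that[of s] * x by (simp add: X0_def mult.commute)
  next
    case 3 then show ?thesis using that[of "s * (r + 1)"] * x by (simp add: X0_def)
  qed
next
  case False
  then have "lie (X \<alpha>) (X \<beta>) = 0"
    by (intro lie_not_root[OF X_root[OF a] X_root[OF b]]) (auto simp: a b Rx_V)
  then show thesis using that[of 0] by simp
qed

text \<open>If \<beta> has position \<open>r\<close> in its string, the successive constants are r +
  1, ..., r + k up to sign; dividing their product by k! gives the binomial coefficient of r + k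
  over k.\<close>

lemma ad_divpow_nonpar:
  assumes a: "\<alpha> \<in> Rx" and b: "\<beta> \<in> Rx" and np: "nonpar \<alpha> \<beta>"
  obtains n where "ad_divpow (X \<alpha>) k (X \<beta>) = scale (of_int n) (X0 (shift \<beta> \<alpha> (int k)))"
proof -
  obtain \<mu> m r where s: "\<beta> = shift \<mu> \<alpha> (int r)" "r \<le> m" "m \<le> 3" "\<mu> \<in> Rx" "nonpar \<alpha> \<mu>"
    "cartan \<mu> \<alpha> = - int m" "\<And>i. shift \<mu> \<alpha> i \<in> R \<longleftrightarrow> 0 \<le> i \<and> i \<le> int m"
    using root_string[OF a b np] by metis
  have "\<exists>t::int. ad_divpow (X \<alpha>) k (X \<beta>) =
      (if r + k \<le> m then scale (of_int (t * int ((r + k) choose k))) (X (shift \<mu> \<alpha> (int (r + k)))) else 0)"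
  proof (induction k)
    case 0
    show ?case using s(1,2) by (intro exI[of _ 1]) simp
  next
    case (Suc k)
    then obtain t where t: "ad_divpow (X \<alpha>) k (X \<beta>) =
      (if r + k \<le> m then scale (of_int (t * int ((r + k) choose k))) (X (shift \<mu> \<alpha> (int (r + k)))) else 0)" by auto
    show ?case
    proof (cases "r + k < m")
      case True
      obtain u where u: "lie (X \<alpha>) (X (shift \<mu> \<alpha> (int (r + k)))) =
          scale (of_int (u * (int (r + k) + 1))) (X (shift \<mu> \<alpha> (int (r + k) + 1)))"
        using string_coeff[OF a s(4-6,3,7) True] by metis
      have "of_nat (Suc k) * of_nat (Suc (r + k) choose Suc k) =
          (of_nat (Suc (r + k)) * of_nat ((r + k) choose k) :: complex)"
        by (metis Suc_times_binomial of_nat_mult)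
      then have "of_nat ((r + Suc k) choose Suc k) =
          (of_nat (Suc (r + k)) * of_nat ((r + k) choose k) / of_nat (Suc k) :: complex)"
        by (simp add: field_simps del: of_nat_Suc)
      then have eq: "1 / of_nat (Suc k) * (of_int (t * int ((r + k) choose k)) * of_int (u * (int (r + k) + 1))) =
          (of_int (t * u * int ((r + Suc k) choose Suc k)) :: complex)"
        by (simp add: mult_ac add_ac del: binomial_Suc_Suc)
      have "ad_divpow (X \<alpha>) (Suc k) (X \<beta>) = scale (1 / of_nat (Suc k)) (lie (X \<alpha>)
          (scale (of_int (t * int ((r + k) choose k))) (X (shift \<mu> \<alpha> (int (r + k))))))"
        by (subst ad_divpow_Suc, subst t) (use True in simp)
      also have "\<dots> = scale (1 / of_nat (Suc k) * (of_int (t * int ((r + k) choose k)) * of_int (u * (int (r + k) + 1))))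
         (X (shift \<mu> \<alpha> (int (r + k) + 1)))"
        by (simp only: lie_scale_right u scale_scale)
      also have "\<dots> = scale (of_int (t * u * int ((r + Suc k) choose Suc k))) (X (shift \<mu> \<alpha> (int (r + Suc k))))"
        unfolding eq by (simp add: add.commute add.left_commute)
      finally show ?thesis using True by (intro exI[of _ "t * u"]) simp
    next
      case False
      have "ad_divpow (X \<alpha>) (Suc k) (X \<beta>) = 0"
      proof (cases "r + k = m")
        case True
        have "lie (X \<alpha>) (X (shift \<mu> \<alpha> (int (r + k)))) = 0"
          using s(7)[of "int m + 1"] s(7)[of "int m"] True
          by (intro lie_not_root[OF X_root[OF a] X_root[OF nonpar_shift(1)[OF a s(4,5)]]])
            (auto simp: a s(4) Rx_V shift_V)
        then show ?thesis by (subst ad_divpow_Suc, subst t) (simp add: lie_scale_right)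
      qed (use False in \<open>subst ad_divpow_Suc, subst t, simp\<close>)
      then show ?thesis using False by simp
    qed
  qed
  then obtain t where t: "ad_divpow (X \<alpha>) k (X \<beta>) =
      (if r + k \<le> m then scale (of_int (t * int ((r + k) choose k))) (X (shift \<mu> \<alpha> (int (r + k)))) else 0)" by auto
  show thesis
  proof (cases "r + k \<le> m")
    case True
    then have "shift \<mu> \<alpha> (int (r + k)) \<in> Rx" using nonpar_shift(1)[OF a s(4,5)] s(7) by simp
    then have "X (shift \<mu> \<alpha> (int (r + k))) = X0 (shift \<beta> \<alpha> (int k))" by (simp add: X0_def s(1))
    then show ?thesis using t True that by metis
  qed (use t that[of 0] in simp)
qed

end

section \<open>Integral spans\<close>

context lie_algebra
begin

interpretation zmod: Modules.module "\<lambda>(n::int) x. scale (of_int n) x"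
  by unfold_locales (auto simp: scale_right_distrib scale_left_distrib)

lemma zspan_base: "x \<in> S \<Longrightarrow> x \<in> zspan S"
  and zspan_0: "0 \<in> zspan S"
  and zspan_add: "x \<in> zspan S \<Longrightarrow> y \<in> zspan S \<Longrightarrow> x + y \<in> zspan S"
  and zspan_minus: "x \<in> zspan S \<Longrightarrow> - x \<in> zspan S"
  and zspan_scale: "x \<in> zspan S \<Longrightarrow> scale (of_int n) x \<in> zspan S"
  unfolding zspan_def
  by (blast intro: zmod.span_base zmod.span_zero zmod.span_add zmod.span_neg zmod.span_scale)+

lemma zspan_induct [consumes 1, case_names base zero add scale]:
  assumes "x \<in> zspan S" "\<And>x. x \<in> S \<Longrightarrow> P x" "P 0" "\<And>x y. P x \<Longrightarrow> P y \<Longrightarrow> P (x + y)"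
    "\<And>n x. P x \<Longrightarrow> P (scale (of_int n) x)"
  shows "P x"
  using assms(1) unfolding zspan_def
  by (induction rule: zmod.span_induct) (auto simp: zmod.subspace_def assms)

end

context eala_chevalley
begin

subsection \<open>Isotropic root vectors\<close>

lemma multiple_not_root:
  assumes a: "\<alpha> \<in> Rx" and "shift \<beta> \<alpha> (- n) \<in> V0" and n: "n \<noteq> 0" "n \<noteq> 1" "n \<noteq> - 1"
  shows "\<beta> \<notin> R"
proof
  assume b: "\<beta> \<in> R"
  have eq: "shift \<beta> \<alpha> (- n) = \<beta> - (\<lambda>x. complex_of_real (of_int n) * \<alpha> x)"
    by (auto simp: shift_def fun_eq_iff)
  show False
  proof (cases "\<beta> \<in> V0")
    case True
    have "(\<lambda>x. complex_of_real (of_int n) * \<alpha> x) = \<beta> - shift \<beta> \<alpha> (- n)" unfolding eq by simp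
    then have "(\<lambda>x. complex_of_real (of_int n) * \<alpha> x) \<in> V0" using V0_diff[OF True assms(2)] by metis
    then have "(\<lambda>x. complex_of_real (1 / of_int n) * (complex_of_real (of_int n) * \<alpha> x)) \<in> V0"
      by (rule V0_rscale)
    then have "\<alpha> \<in> V0" using n by simp
    then show False using Rx_iff_V0[OF Rx_R[OF a]] a by simp
  next
    case False
    then have "\<beta> \<in> Rx" using Rx_iff_V0[OF b] by simp
    then have "real_of_int n = 1 \<or> real_of_int n = - 1"
      using reduced_multiple[OF a, of \<beta> "of_int n"] assms(2) eq by simp
    then show False using n by linarith
  qed
qed

text \<open>Otherwise the roots congruent to \<gamma> or - \<gamma> modulo \<open>V0\<close> would
  be orthogonal to all other nonisotropic roots. By indecomposability there would be no others, so
  \<gamma> and \<open>V0\<close> would span \<open>V\<close> and the rank would be at most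
  1.\<close>

lemma exists_nonpar:
  assumes g: "\<gamma> \<in> Rx"
  obtains \<beta> where "\<beta> \<in> Rx" "nonpar \<gamma> \<beta>" "dform \<gamma> \<beta> \<noteq> 0"
proof (rule ccontr)
  assume "\<not> thesis"
  then have orth: "\<And>\<beta>. \<beta> \<in> Rx \<Longrightarrow> nonpar \<gamma> \<beta> \<Longrightarrow> dform \<gamma> \<beta> = 0" using that by blast
  define A where "A = {\<beta> \<in> Rx. \<not> nonpar \<gamma> \<beta>}"
  have "dform \<alpha> \<beta> = 0" if "\<alpha> \<in> A" "\<beta> \<in> Rx - A" for \<alpha> \<beta>
  proof -
    have b: "dform \<gamma> \<beta> = 0" "\<beta> \<in> V" using orth that(2) by (auto simp: A_def Rx_V)
    have a: "\<alpha> \<in> V" using that(1) by (auto simp: A_def Rx_V)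
    have "\<alpha> - \<gamma> \<in> V0 \<or> \<alpha> + \<gamma> \<in> V0" using that(1) by (auto simp: A_def nonpar_def)
    then have "dform (\<alpha> - \<gamma>) \<beta> = 0 \<or> dform (\<alpha> + \<gamma>) \<beta> = 0" using V0_dform(1) b(2) by blast
    then show ?thesis using b a Rx_V[OF g] by (auto simp: dform_add dform_diff)
  qed
  moreover have "\<gamma> \<in> A" using g V0_zero by (simp add: A_def nonpar_def)
  moreover have sub: "A \<subseteq> Rx" by (auto simp: A_def)
  ultimately have "\<not> Rx - A \<noteq> {}"
  proof -
    assume *: "\<And>\<alpha> \<beta>. \<alpha> \<in> A \<Longrightarrow> \<beta> \<in> Rx - A \<Longrightarrow> dform \<alpha> \<beta> = 0" "\<gamma> \<in> A" "A \<subseteq> Rx"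
    have "A \<noteq> {} \<and> Rx - A \<noteq> {} \<and> A \<inter> (Rx - A) = {} \<and> A \<union> (Rx - A) = Rx \<and>
        (\<forall>\<alpha>\<in>A. \<forall>\<beta>\<in>Rx - A. dform \<alpha> \<beta> = 0)" if "Rx - A \<noteq> {}"
      using * that by blast
    then show ?thesis
      using notE[OF A5_indecomposable exI[of _ A, OF exI[of _ "Rx - A"]]] by argo
  qed
  then have A: "A = Rx" using sub by blast
  obtain S where S: "S \<subseteq> V0" "real_fun.independent S" "V0 \<subseteq> real_fun.span S" "card S = real_fun.dim V0"
    using real_fun.basis_exists by blast
  obtain T where T: "T \<subseteq> V" "real_fun.independent T" "V \<subseteq> real_fun.span T" "card T = real_fun.dim V"
    using real_fun.basis_exists by blast
  \<comment> \<open>As \<open>card\<close> is 0 on infinite sets, the assumption on the rank also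
    yields that \<open>V\<close> has a finite basis.\<close>
  have "card T > 1" using rank unfolding rank_def T by linarith
  then have "finite T" by (metis card.infinite not_one_less_zero)
  then have "finite S"
    using real_fun.independent_span_bound[of T S] S(1,2) T(3) V0_V by blast
  have "R \<subseteq> real_fun.span (insert \<gamma> S)"
  proof
    fix \<beta> assume b: "\<beta> \<in> R"
    have sub: "V0 \<subseteq> real_fun.span (insert \<gamma> S)"
      using S(3) real_fun.span_mono[of S "insert \<gamma> S"] by blast
    have gs: "\<gamma> \<in> real_fun.span (insert \<gamma> S)" by (simp add: real_fun.span_base)
    show "\<beta> \<in> real_fun.span (insert \<gamma> S)"
    proof (cases "\<beta> \<in> Rx")
      case True
      then have "\<beta> - \<gamma> \<in> V0 \<or> \<beta> + \<gamma> \<in> V0" using A by (auto simp: A_def nonpar_def)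
      then show ?thesis
        using sub gs real_fun.span_add[of "\<beta> - \<gamma>" "insert \<gamma> S" \<gamma>] real_fun.span_diff[of "\<beta> + \<gamma>" "insert \<gamma> S" \<gamma>]
        by auto
    qed (use b Rx_iff_V0 sub in blast)
  qed
  then have "V \<subseteq> real_fun.span (insert \<gamma> S)"
    unfolding V_def by (intro real_fun.span_minimal) auto
  then have "T \<subseteq> real_fun.span (insert \<gamma> S)" using T(1) by blast
  then have "card T \<le> card (insert \<gamma> S)"
    using real_fun.independent_span_bound[of "insert \<gamma> S" T] T(2) \<open>finite S\<close> by blast
  also have "\<dots> \<le> Suc (card S)" by (rule card_insert_le_m1) auto
  finally show False using rank S(4) T(4) unfolding rank_def by linarith
qed

lemma lie_shifted_pair:
  assumes a: "\<nu>1 \<in> Rx" "\<nu>2 \<in> Rx" "nonpar \<nu>1 \<nu>2" and a': "\<nu>1' \<in> Rx" "\<nu>2' \<in> Rx" "\<nu>1' - \<nu>1 \<in> V0" "\<nu>2' - \<nu>2 \<in> V0"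
    and N: "N = (if cartan \<nu>2 \<nu>1 = 0 then 2 else if cartan \<nu>2 \<nu>1 = 1 then 3 else 1)"
  shows "\<exists>k. lie (X \<nu>1') (X \<nu>2') = scale (of_int (N * k)) (X0 (\<nu>1' + \<nu>2'))"
proof -
  have c: "cartan \<nu>2' \<nu>1' = cartan \<nu>2 \<nu>1"
    by (rule cartan_cong[OF Rx_R[OF a(2)] Rx_R[OF a'(2)] a(1) a'(1) a'(4,3)])
  obtain k where "lie (X \<nu>1') (X \<nu>2') = scale (of_int (N * k)) (X0 (\<nu>2' + \<nu>1'))"
    by (rule nonpar_lie_int[OF a'(1,2) nonpar_cong[OF a(3) a'(3,4)], unfolded c N[symmetric]])
  then show ?thesis by (auto simp: add.commute)
qed

text \<open>Reduces the integrality of the action of an isotropic element on \<open>X \<mu>\<close> to directions different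
  from that of \<open>\<mu>\<close>; the divisibility by \<open>N\<close> makes up for the division by \<open>N\<close>.\<close>
lemma decompose_root:
  assumes mu: "\<mu> \<in> Rx"
  obtains \<nu>1 \<nu>2 N s :: _ where "\<nu>1 \<in> Rx" "\<nu>2 \<in> Rx" "\<nu>1 + \<nu>2 = \<mu>" "nonpar \<mu> \<nu>1" "nonpar \<mu> \<nu>2" "N \<noteq> (0::int)"
    "s = 1 \<or> s = - 1" "lie (X \<nu>1) (X \<nu>2) = scale (of_int (s * N)) (X \<mu>)"
    "\<forall>\<nu>1' \<nu>2'. \<nu>1' \<in> Rx \<and> \<nu>2' \<in> Rx \<and> \<nu>1' - \<nu>1 \<in> V0 \<and> \<nu>2' - \<nu>2 \<in> V0 \<longrightarrow>
      (\<exists>k. lie (X \<nu>1') (X \<nu>2') = scale (of_int (N * k)) (X0 (\<nu>1' + \<nu>2')))"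
proof -
  obtain \<beta> where b: "\<beta> \<in> Rx" "nonpar \<mu> \<beta>" "cartan \<mu> \<beta> > 0"
  proof -
    obtain \<beta> where b: "\<beta> \<in> Rx" "nonpar \<mu> \<beta>" "dform \<mu> \<beta> \<noteq> 0" using exists_nonpar[OF mu] by metis
    then have "cartan \<mu> \<beta> \<noteq> 0" using cartan_eq_zero[OF b(1) mu] by (simp add: dform_sym)
    then show thesis
      using that[of \<beta>] that[of "- \<beta>"] b Rx_minus[OF b(1)] nonpar_minus(1)[OF b(2)]
        cartan_minus_right[OF Rx_R[OF mu] b(1)] by linarith
  qed
  have np: "nonpar \<beta> \<mu>" by (rule nonpar_sym[OF b(2)])
  have "\<mu> - \<beta> \<in> R" by (rule root_diff[OF Rx_R[OF mu] b(1,3)])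
  then have mb: "\<mu> - \<beta> \<in> Rx" "nonpar \<beta> (\<mu> - \<beta>)"
    using nonpar_shift[OF b(1) mu np, of "- 1"] by (auto simp: shift_1)
  have "shift \<beta> \<mu> (- 1) \<in> R" using R_minus[OF Rx_R[OF mb(1)]] by (simp add: shift_1)
  then have "nonpar \<mu> (shift \<beta> \<mu> (- 1))" by (rule nonpar_shift(2)[OF mu b(1,2)])
  then have mb': "nonpar \<mu> (\<mu> - \<beta>)" using nonpar_minus(1)[of \<mu> "shift \<beta> \<mu> (- 1)"] by (simp add: shift_1)
  have cmb: "cartan (\<mu> - \<beta>) \<beta> = cartan \<mu> \<beta> - 2"
    by (simp add: cartan_diff Rx_R mu b(1) cartan_self)
  obtain s r m :: int where *: "s = 1 \<or> s = - 1" "cartan (\<mu> - \<beta>) \<beta> = 2 * r - m" "0 \<le> r" "r < m" "m \<le> 3"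
    "lie (X \<beta>) (X (\<mu> - \<beta>)) = scale (of_int (s * (r + 1))) (X \<mu>)" "r \<ge> 1 \<Longrightarrow> \<mu> - \<beta> - \<beta> \<in> R"
    using nonpar_lie[OF b(1) mb] Rx_R[OF mu] by (metis diff_add_cancel)
  \<comment> \<open>\<open>N\<close> must be the exact constant of the pair and also divide the
    constants of all pairs congruent to it modulo \<open>V0\<close>. The divisor from
    \<open>nonpar_lie_int\<close> is exact for \<beta> and \<mu> - \<beta> unless the constant is 2
    while the Cartan integer is - 1.\<close>
  show thesis
  proof (cases "cartan \<mu> \<beta> = 1 \<and> r = 1")
    case False
    let ?N = "if cartan (\<mu> - \<beta>) \<beta> = 0 then 2 else if cartan (\<mu> - \<beta>) \<beta> = 1 then 3 else 1 :: int"
    have "?N = r + 1"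
    proof -
      consider "cartan \<mu> \<beta> = 1" "r = 0" | "cartan \<mu> \<beta> = 2" "r = 1" | "cartan \<mu> \<beta> = 3" "r = 2"
        using *(2-5) b(3) cmb False by linarith
      then show ?thesis using cmb by cases auto
    qed
    then show thesis
      using that[OF b(1) mb(1) _ b(2) mb' _ *(1), of ?N] lie_shifted_pair[OF b(1) mb] *(3,6) by simp
  next
    case True
    \<comment> \<open>In the exceptional case the \<beta>-string has length 3, running from \<mu> -
      2\<beta> to \<mu> + \<beta>. Its top root gives a better decomposition, \<mu> = (\<mu> +
      \<beta>) + (- \<beta>): since \<mu> + 2\<beta> is not a root, the constant is 1 up to
      sign.\<close>
    let ?l = "shift \<mu> \<beta> 1" and ?w = "shift \<mu> \<beta> (- 2)"
    have "\<mu> - \<beta> - \<beta> = ?w" by (auto simp: shift_def fun_eq_iff)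
    then have w: "?w \<in> R" using *(7) True by simp
    then have w: "?w \<in> Rx" "nonpar \<beta> ?w" using nonpar_shift[OF b(1) mu np] by auto
    have cw: "cartan ?w \<beta> = - 3" using True by (simp add: cartan_shift mu b(1) Rx_R cartan_self)
    have l: "?l = refl \<beta> ?w" by (simp add: refl_shift cw)
    have lR: "?l \<in> Rx" unfolding l by (rule refl_Rx[OF b(1) w(1)])
    have lnp: "nonpar \<beta> ?l" "nonpar \<mu> ?l"
      using nonpar_shift(2)[OF b(1) mu np Rx_R[OF lR]] nonpar_shift(2)[OF mu b(1,2), of 1] lR
      by (auto simp: shift_1 add.commute Rx_R)
    have lb: "cartan ?l \<beta> = 3" using True by (simp add: cartan_shift mu b(1) Rx_R cartan_self)
    have "cartan \<beta> ?l * cartan ?l \<beta> \<in> {0..3}" by (rule nonpar_cartan(1)[OF b(1) lR lnp(1)])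
    moreover have "cartan \<beta> ?l \<noteq> 0" using lb cartan_eq_zero[OF lR b(1)] cartan_eq_zero[OF b(1) lR] by (simp add: dform_sym)
    ultimately have bl: "cartan \<beta> ?l = 1" using lb by simp
    have mb: "- \<beta> \<in> Rx" by (rule Rx_minus[OF b(1)])
    have np': "nonpar ?l (- \<beta>)" by (rule nonpar_minus(1)[OF nonpar_sym[OF lnp(1)]])
    have sum: "- \<beta> + ?l = \<mu>" by (simp add: shift_1)
    have nr: "- \<beta> - ?l \<notin> R"
    proof
      assume "- \<beta> - ?l \<in> R"
      moreover have "- (- \<beta> - ?l) = shift \<mu> \<beta> 2" by (auto simp: shift_def fun_eq_iff)
      ultimately have "shift \<mu> \<beta> 2 \<in> R" using R_minus by metis
      then show False using nonpar_cartan(2)[OF b(1) nonpar_shift[OF b(1) mu np], of 2] True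
        by (simp add: cartan_shift mu b(1) Rx_R cartan_self)
    qed
    have cm: "cartan (- \<beta>) ?l = - 1" using bl by (simp add: cartan_minus_left b(1) lR Rx_R)
    obtain s' r' :: int where **: "s' = 1 \<or> s' = - 1" "0 \<le> r'"
      "lie (X ?l) (X (- \<beta>)) = scale (of_int (s' * (r' + 1))) (X \<mu>)" "r' \<ge> 1 \<Longrightarrow> - \<beta> - ?l \<in> R"
      using nonpar_lie[OF lR mb np'] Rx_R[OF mu] sum by metis
    then have "r' = 0" using nr by force
    then show thesis
      using that[OF lR mb _ lnp(2) nonpar_minus(1)[OF b(2)] _ **(1), of 1] sum **(3)
        lie_shifted_pair[OF lR mb np'] cm by (simp add: add.commute)
  qed
qed

lemma nonpar_lie_lie_int:
  assumes a: "\<alpha> \<in> Rx" and a': "\<alpha>' \<in> Rx" and s: "\<alpha>' + \<alpha> \<in> V0" and m: "\<mu> \<in> Rx" and np: "nonpar \<alpha> \<mu>"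
  obtains n where "lie (X \<alpha>') (lie (X \<alpha>) (X \<mu>)) = scale (of_int n) (X0 (\<mu> + (\<alpha>' + \<alpha>)))"
proof -
  obtain k where k: "lie (X \<alpha>) (X \<mu>) = scale (of_int k) (X0 (\<mu> + \<alpha>))"
    using nonpar_lie_int[OF a m np] by metis
  show thesis
  proof (cases "\<mu> + \<alpha> \<in> Rx")
    case True
    have np': "nonpar \<alpha> (\<mu> + \<alpha>)" using nonpar_shift(2)[OF a m np, of 1] True by (simp add: shift_1 Rx_R)
    have "nonpar \<alpha>' (\<mu> + \<alpha>)"
      using nonpar_cong[OF nonpar_minus(2)[OF np'], of \<alpha>' "\<mu> + \<alpha>"] s V0_zero by simp
    then obtain l where l: "lie (X \<alpha>') (X (\<mu> + \<alpha>)) = scale (of_int l) (X0 (\<mu> + \<alpha> + \<alpha>'))"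
      using nonpar_lie_int[OF a' True] by metis
    have "lie (X \<alpha>') (lie (X \<alpha>) (X \<mu>)) = scale (of_int (k * l)) (X0 (\<mu> + (\<alpha>' + \<alpha>)))"
      using True k l by (simp add: X0_def lie_scale_right add_ac)
    then show thesis by (rule that)
  next
    case False
    then show thesis using that[of 0] k by (simp add: X0_def)
  qed
qed

text \<open>By the Jacobi identity the action is a difference of two double brackets, and each of
  these stays among nonisotropic root vectors with integral constants.\<close>

lemma isotropic_lie_nonpar:
  assumes a: "\<alpha> \<in> Rx" and b: "\<beta> \<in> Rx" and s: "\<alpha> + \<beta> \<in> V0" and m: "\<mu> \<in> Rx" and np: "nonpar \<alpha> \<mu>"
  obtains n where "lie (lie (X \<alpha>) (X \<beta>)) (X \<mu>) = scale (of_int n) (X0 (\<mu> + (\<alpha> + \<beta>)))"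
proof -
  have np': "nonpar \<beta> \<mu>"
    using nonpar_cong[OF nonpar_minus(2)[OF np], of \<beta> \<mu>] s V0_zero by (simp add: add.commute)
  obtain n n' where "lie (X \<alpha>) (lie (X \<beta>) (X \<mu>)) = scale (of_int n) (X0 (\<mu> + (\<alpha> + \<beta>)))"
    "lie (X \<beta>) (lie (X \<alpha>) (X \<mu>)) = scale (of_int n') (X0 (\<mu> + (\<alpha> + \<beta>)))"
    using nonpar_lie_lie_int[OF b a s m np'] nonpar_lie_lie_int[OF a b _ m np] s by (metis add.commute)
  then have "lie (lie (X \<alpha>) (X \<beta>)) (X \<mu>) = scale (of_int (n - n')) (X0 (\<mu> + (\<alpha> + \<beta>)))"
    using lie_derivation[of "X \<alpha>" "X \<beta>" "X \<mu>"] by (simp add: scale_left_diff_distrib eq_diff_eq)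
  then show thesis by (rule that)
qed

text \<open>If \<mu> is parallel to \<alpha>, one of the double brackets passes through an isotropic
  root space, where no constants are known. Instead \<open>X \<mu>\<close> is written as
  \<open>lie (X \<nu>1) (X \<nu>2)\<close> divided by \<open>N\<close> up to sign, and the isotropic
  element acts as a derivation. Both terms carry a factor \<open>N\<close>, so the division stays
  integral.\<close>

lemma isotropic_lie:
  assumes a: "\<alpha> \<in> Rx" and b: "\<beta> \<in> Rx" and s: "\<alpha> + \<beta> \<in> V0" and m: "\<mu> \<in> Rx"
  obtains n where "lie (lie (X \<alpha>) (X \<beta>)) (X \<mu>) = scale (of_int n) (X0 (\<mu> + (\<alpha> + \<beta>)))"
proof (cases "nonpar \<alpha> \<mu>")
  case True
  then show thesis using isotropic_lie_nonpar[OF a b s m] that by metis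
next
  case False
  let ?D = "lie (X \<alpha>) (X \<beta>)" and ?d = "\<alpha> + \<beta>"
  obtain \<nu>1 \<nu>2 N t where d: "\<nu>1 \<in> Rx" "\<nu>2 \<in> Rx" "\<nu>1 + \<nu>2 = \<mu>" "nonpar \<mu> \<nu>1" "nonpar \<mu> \<nu>2" "N \<noteq> (0::int)"
    "t = 1 \<or> t = - 1" "lie (X \<nu>1) (X \<nu>2) = scale (of_int (t * N)) (X \<mu>)"
    "\<forall>\<nu>1' \<nu>2'. \<nu>1' \<in> Rx \<and> \<nu>2' \<in> Rx \<and> \<nu>1' - \<nu>1 \<in> V0 \<and> \<nu>2' - \<nu>2 \<in> V0 \<longrightarrow>
      (\<exists>k. lie (X \<nu>1') (X \<nu>2') = scale (of_int (N * k)) (X0 (\<nu>1' + \<nu>2')))"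
    by (rule decompose_root[OF m])
  have np: "nonpar \<alpha> \<nu>" if "nonpar \<mu> \<nu>" for \<nu>
  proof -
    consider "\<mu> - \<alpha> \<in> V0" | "\<mu> + \<alpha> \<in> V0" using False by (auto simp: nonpar_def)
    then show ?thesis
    proof cases
      case 1
      then show ?thesis using nonpar_cong[OF that, of \<alpha> \<nu>] V0_minus[OF 1] V0_zero by simp
    next
      case 2
      then show ?thesis using nonpar_cong[OF nonpar_minus(2)[OF that], of \<alpha> \<nu>] V0_zero by (simp add: add.commute)
    qed
  qed
  obtain n1 where n1: "lie ?D (X \<nu>1) = scale (of_int n1) (X0 (\<nu>1 + ?d))"
    using isotropic_lie_nonpar[OF a b s d(1) np[OF d(4)]] by metis
  obtain n2 where n2: "lie ?D (X \<nu>2) = scale (of_int n2) (X0 (\<nu>2 + ?d))"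
    using isotropic_lie_nonpar[OF a b s d(2) np[OF d(5)]] by metis
  obtain k1 where k1: "lie (X0 (\<nu>1 + ?d)) (X \<nu>2) = scale (of_int (N * k1)) (X0 (\<mu> + ?d))"
  proof (cases "\<nu>1 + ?d \<in> Rx")
    case True
    obtain k where "lie (X (\<nu>1 + ?d)) (X \<nu>2) = scale (of_int (N * k)) (X0 (\<nu>1 + ?d + \<nu>2))"
      using d(9)[rule_format, of "\<nu>1 + ?d" \<nu>2] True d(2) s V0_zero by auto
    moreover have "\<nu>1 + ?d + \<nu>2 = \<mu> + ?d" using d(3) by auto
    moreover have "X0 (\<nu>1 + ?d) = X (\<nu>1 + ?d)" using True by (simp add: X0_def)
    ultimately show thesis using that[of k] by (simp only:)
  qed (use that[of 0] in \<open>simp add: X0_def\<close>)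
  obtain k2 where k2: "lie (X \<nu>1) (X0 (\<nu>2 + ?d)) = scale (of_int (N * k2)) (X0 (\<mu> + ?d))"
  proof (cases "\<nu>2 + ?d \<in> Rx")
    case True
    obtain k where "lie (X \<nu>1) (X (\<nu>2 + ?d)) = scale (of_int (N * k)) (X0 (\<nu>1 + (\<nu>2 + ?d)))"
      using d(9)[rule_format, of \<nu>1 "\<nu>2 + ?d"] d(1) True s V0_zero by auto
    moreover have "\<nu>1 + (\<nu>2 + ?d) = \<mu> + ?d" using d(3) by auto
    moreover have "X0 (\<nu>2 + ?d) = X (\<nu>2 + ?d)" using True by (simp add: X0_def)
    ultimately show thesis using that[of k] by (simp only:)
  qed (use that[of 0] in \<open>simp add: X0_def\<close>)
  have "scale (of_int (t * N)) (lie ?D (X \<mu>)) = lie ?D (lie (X \<nu>1) (X \<nu>2))"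
    by (simp only: d(8) lie_scale_right)
  also have "\<dots> = scale (of_int (n1 * (N * k1))) (X0 (\<mu> + ?d)) + scale (of_int (n2 * (N * k2))) (X0 (\<mu> + ?d))"
    by (simp only: lie_derivation[of ?D] n1 n2 lie_scale_left lie_scale_right k1 k2 scale_scale of_int_mult)
  also have "\<dots> = scale (of_int (t * N)) (scale (of_int (t * (n1 * k1 + n2 * k2))) (X0 (\<mu> + ?d)))"
    using d(7) by (auto simp: scale_left_distrib algebra_simps)
  finally have "lie ?D (X \<mu>) = scale (of_int (t * (n1 * k1 + n2 * k2))) (X0 (\<mu> + ?d))"
    using d(6,7) by (simp only: scale_cancel_left of_int_eq_0_iff) auto
  then show thesis by (rule that)
qed


subsection \<open>The integral form\<close>

abbreviation M :: "'g set" where "M \<equiv> core_Z X"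

lemma M_zero: "0 \<in> M" and M_add: "u \<in> M \<Longrightarrow> v \<in> M \<Longrightarrow> u + v \<in> M"
  and M_minus: "u \<in> M \<Longrightarrow> - u \<in> M" and M_scale: "u \<in> M \<Longrightarrow> scale (of_int n) u \<in> M"
  unfolding core_Z_def by (blast intro: zspan_0 zspan_add zspan_minus zspan_scale)+

lemma X_M: "\<alpha> \<in> Rx \<Longrightarrow> X \<alpha> \<in> M"
  unfolding core_Z_def by (rule zspan_base) blast

lemma X0_M: "X0 \<alpha> \<in> M"
  by (simp add: X0_def X_M M_zero)

lemma isotropic_M:
  assumes a: "\<alpha> \<in> Rx" and b: "\<beta> \<in> Rx" and s: "\<alpha> + \<beta> \<in> V0" shows "lie (X \<alpha>) (X \<beta>) \<in> M"
proof (cases "\<alpha> + \<beta> = 0")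
  case True
  then have "\<beta> = - \<alpha>" by (metis add_eq_0_iff)
  then show ?thesis using a X_lie[OF a] unfolding core_Z_def by (intro zspan_base) auto
next
  case False
  have "\<alpha> - (- \<beta>) \<in> R0" by (rule R0_diff[OF a Rx_minus[OF b]]) (use s in simp)
  then have d: "\<alpha> + \<beta> \<in> R0" by simp
  \<comment> \<open>With \<gamma> = - \<beta> and \<delta> = \<alpha> + \<beta> the bracket is
    literally one of the generators of \<open>core_Z X\<close>.\<close>
  have "\<exists>\<gamma> \<delta>. lie (X \<alpha>) (X \<beta>) = lie (X (\<gamma> + \<delta>)) (X (- \<gamma>)) \<and> \<gamma> \<in> Rx \<and> \<delta> \<in> R0 \<and> \<delta> \<noteq> 0 \<and> \<gamma> + \<delta> \<in> R"
    by (rule exI[of _ "- \<beta>"], rule exI[of _ "\<alpha> + \<beta>"]) (use False d a b in \<open>auto simp: Rx_minus Rx_R\<close>)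
  then show ?thesis unfolding core_Z_def by (intro zspan_base) blast
qed

text \<open>Coroots and isotropic generators are treated alike: each is a bracket of two root
  vectors whose roots add up to an element of \<open>V0\<close>, with sum 0 for the coroots.\<close>

lemma M_induct [consumes 1, case_names root isotropic zero add scale]:
  assumes "v \<in> M" and root: "\<And>\<alpha>. \<alpha> \<in> Rx \<Longrightarrow> P (X \<alpha>)"
    and iso: "\<And>\<alpha> \<beta>. \<alpha> \<in> Rx \<Longrightarrow> \<beta> \<in> Rx \<Longrightarrow> \<alpha> + \<beta> \<in> V0 \<Longrightarrow> P (lie (X \<alpha>) (X \<beta>))"
    and "P 0" "\<And>u v. P u \<Longrightarrow> P v \<Longrightarrow> P (u + v)" "\<And>n v. P v \<Longrightarrow> P (scale (of_int n) v)"
  shows "P v"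
  using assms(1) unfolding core_Z_def
proof (induction rule: zspan_induct)
  case (base v)
  then consider \<alpha> where "\<alpha> \<in> Rx" "v = X \<alpha>"
    | \<alpha> \<delta> where "\<alpha> \<in> Rx" "\<delta> \<in> R0" "\<alpha> + \<delta> \<in> R" "v = lie (X (\<alpha> + \<delta>)) (X (- \<alpha>))"
    | \<alpha> where "\<alpha> \<in> Rx" "v = coroot \<alpha>" by blast
  then show ?case
  proof cases
    case (2 \<alpha> \<delta>)
    have "\<alpha> + \<delta> \<notin> V0"
      using V0_diff[of "\<alpha> + \<delta>" \<delta>] R0_V0[OF 2(2)] Rx_iff_V0[OF Rx_R[OF 2(1)]] 2(1) by auto
    then have "\<alpha> + \<delta> \<in> Rx" using Rx_iff_V0[OF 2(3)] by simp
    then show ?thesis using iso[of "\<alpha> + \<delta>" "- \<alpha>"] 2 by (simp add: Rx_minus R0_V0)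
  next
    case (3 \<alpha>)
    then show ?thesis using iso[of \<alpha> "- \<alpha>"] X_lie[of \<alpha>] by (simp add: Rx_minus V0_zero)
  qed (use root in simp)
qed (use assms in auto)

lemma par_sum_not_root:
  assumes "\<alpha> \<in> Rx" "\<beta> - \<alpha> \<in> V0" shows "\<beta> + \<alpha> \<notin> R"
proof (rule multiple_not_root[OF assms(1), of _ 2])
  have "shift (\<beta> + \<alpha>) \<alpha> (- 2) = \<beta> - \<alpha>" by (auto simp: shift_def fun_eq_iff)
  then show "shift (\<beta> + \<alpha>) \<alpha> (- 2) \<in> V0" using assms(2) by simp
qed auto

lemma lie_par_zero:
  assumes "\<alpha> \<in> Rx" "\<beta> \<in> Rx" "\<beta> - \<alpha> \<in> V0" shows "lie (X \<alpha>) (X \<beta>) = 0"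
  by (rule lie_not_root[OF X_root X_root]) (use assms par_sum_not_root in \<open>auto simp: Rx_V\<close>)

lemma lie_X_X_M:
  assumes a: "\<alpha> \<in> Rx" and b: "\<beta> \<in> Rx" shows "lie (X \<alpha>) (X \<beta>) \<in> M"
proof -
  consider "nonpar \<alpha> \<beta>" | "\<beta> - \<alpha> \<in> V0" | "\<alpha> + \<beta> \<in> V0" by (auto simp: nonpar_def add.commute)
  then show ?thesis
  proof cases
    case 1
    then show ?thesis using nonpar_lie_int[OF a b] X0_M M_scale by metis
  next
    case 2
    then show ?thesis using lie_par_zero[OF a b] M_zero by simp
  qed (rule isotropic_M[OF a b])
qed

lemma lie_X0_X_M: "\<beta> \<in> Rx \<Longrightarrow> lie (X0 \<alpha>) (X \<beta>) \<in> M" "\<beta> \<in> Rx \<Longrightarrow> lie (X \<beta>) (X0 \<alpha>) \<in> M"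
  by (auto simp: X0_def lie_X_X_M M_zero)

text \<open>On a generator \<open>lie (X \<gamma>) (X \<gamma>')\<close> the isotropic element acts
  as a derivation and moves each factor to a multiple of a root vector, so only brackets of root
  vectors remain.\<close>

lemma isotropic_lie_M:
  assumes ab: "\<alpha> \<in> Rx" "\<beta> \<in> Rx" "\<alpha> + \<beta> \<in> V0" and "v \<in> M"
  shows "lie (lie (X \<alpha>) (X \<beta>)) v \<in> M"
  using \<open>v \<in> M\<close>
proof (induction rule: M_induct)
  case (root \<gamma>)
  then show ?case using isotropic_lie[OF ab] X0_M M_scale by metis
next
  case (isotropic \<gamma> \<gamma>')
  let ?D = "lie (X \<alpha>) (X \<beta>)"
  obtain n n' where "lie ?D (X \<gamma>) = scale (of_int n) (X0 (\<gamma> + (\<alpha> + \<beta>)))"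
    "lie ?D (X \<gamma>') = scale (of_int n') (X0 (\<gamma>' + (\<alpha> + \<beta>)))"
    using isotropic_lie[OF ab] isotropic by metis
  then have "lie ?D (lie (X \<gamma>) (X \<gamma>')) = scale (of_int n) (lie (X0 (\<gamma> + (\<alpha> + \<beta>))) (X \<gamma>')) +
      scale (of_int n') (lie (X \<gamma>) (X0 (\<gamma>' + (\<alpha> + \<beta>))))"
    by (simp only: lie_derivation[of ?D] lie_scale_left lie_scale_right)
  then show ?case using lie_X0_X_M isotropic M_scale M_add by metis
qed (auto simp: lie_add_right lie_scale_right M_zero M_add M_scale)

lemma lie_X_M:
  assumes a: "\<alpha> \<in> Rx" and "v \<in> M" shows "lie (X \<alpha>) v \<in> M"
  using assms(2)
proof (induction rule: M_induct)
  case (isotropic \<gamma> \<gamma>')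
  have "lie (lie (X \<gamma>) (X \<gamma>')) (X \<alpha>) \<in> M" by (rule isotropic_lie_M[OF isotropic X_M[OF a]])
  then show ?case using M_minus lie_anti by metis
qed (auto simp: lie_add_right lie_scale_right M_zero M_add M_scale lie_X_X_M a)

lemma M_lie: "u \<in> M \<Longrightarrow> v \<in> M \<Longrightarrow> lie u v \<in> M"
proof (induction rule: M_induct)
  case (isotropic \<alpha> \<beta>)
  then show ?case by (rule isotropic_lie_M)
qed (auto simp: lie_X_M lie_add_left lie_scale_left M_zero M_add M_scale)

text \<open>Here \<open>X \<beta>\<close> is a lowest weight vector of weight \<open>- 2\<close>.\<close>
lemma opposite_string:
  assumes a: "\<alpha> \<in> Rx" and b: "\<beta> \<in> Rx" and s: "\<beta> + \<alpha> \<in> V0"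
  shows "(lie (X \<alpha>) ^^ 3) (X \<beta>) = 0" "ad_divpow (X \<alpha>) 2 (X \<beta>) = weyl \<alpha> (X \<beta>)"
proof -
  let ?e = "X \<alpha>" and ?f = "X (- \<alpha>)" and ?v = "X \<beta>"
  have "shift \<beta> \<alpha> 3 \<notin> R"
    by (rule multiple_not_root[OF a, of _ 2]) (use s in \<open>auto simp: shift_1\<close>)
  then have "(lie ?e ^^ 3) ?v = 0"
    using RI[OF V_t(1)[OF shift_V[OF Rx_V[OF b] Rx_V[OF a]]] ad_X_root_space[OF a X_root[OF b], of 3]] by auto
  then show e3: "(lie ?e ^^ 3) ?v = 0" .
  then have eee: "lie ?e (lie ?e (lie ?e ?v)) = 0" by (simp add: numeral_3_eq_3)
  have f: "lie ?f ?v = 0"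
  proof (rule lie_not_root[OF X_root_minus[OF a] X_root[OF b]])
    show "\<beta> + - \<alpha> \<notin> R"
      by (rule multiple_not_root[OF a, of _ "- 2"])
        (use s in \<open>auto simp: shift_def fun_eq_iff plus_fun_def add.commute\<close>)
  qed (auto simp: a b Rx_V V_minus)
  have "\<beta> (coroot \<alpha>) = - 2"
  proof -
    have "(\<beta> + \<alpha>) (coroot \<alpha>) = 0"
      using coroot_eval[OF V0_V[OF s] Rx_V[OF a]] V0_dform(1)[OF s Rx_V[OF a]] by simp
    then show ?thesis using coroot_self[OF a] by (simp add: add_eq_0_iff2)
  qed
  then have w: "lie (coroot \<alpha>) ?v = scale (- 2) ?v" using lie_coroot[OF Rx_V[OF a] X_root[OF b]] by metis
  have fe: "lie ?f (lie ?e ?v) = scale 2 ?v" using sl2_lowest[OF X_sl2[OF a] w f, of 0] by simp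
  have fee: "lie ?f (lie ?e (lie ?e ?v)) = scale 2 (lie ?e ?v)"
    using sl2_lowest[OF X_sl2[OF a] w f, of 1] by simp
  let ?u = "lie ?e ?v" and ?w = "lie ?e (lie ?e ?v)"
  have "Exp ?e ?v = ?v + ?u + scale (1 / 2) ?w" by (rule Exp_2[OF eee])
  moreover have "Exp (- ?f) ?v = ?v" by (subst Exp_1) (simp_all add: f lie_minus_left)
  moreover have "Exp (- ?f) ?u = ?u - scale 2 ?v"
    by (subst Exp_1) (simp_all add: fe f lie_linear)
  moreover have "Exp (- ?f) ?w = ?w - scale 2 ?u + scale 2 ?v"
    by (subst Exp_2) (simp_all add: fee fe f lie_linear)
  ultimately have "Exp (- ?f) (Exp ?e ?v) = ?v + (?u - scale 2 ?v) + scale (1 / 2) (?w - scale 2 ?u + scale 2 ?v)"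
    using locally_nilpotent_minus[OF X_nilpotent_minus[OF a]] by (simp add: Exp_add Exp_scale)
  also have "\<dots> = scale (1 / 2) ?w"
    using scale_left_distrib[of "1 / 2" "1 / 2" ?v] scale_left_distrib[of 1 1 ?v]
    by (simp add: scale_right_distrib scale_right_diff_distrib)
  finally have "weyl \<alpha> ?v = Exp ?e (scale (1 / 2) ?w)" by (simp add: weyl_def)
  also have "\<dots> = scale (1 / 2) ?w" by (subst Exp_1) (simp_all add: lie_scale_right eee)
  finally show "ad_divpow ?e 2 ?v = weyl \<alpha> ?v" by (simp add: ad_divpow_2)
qed

text \<open>The delicate case is the second divided power towards the opposite class, where the
  division by 2 has to be harmless: by \<open>opposite_string\<close> it is
  \<open>weyl \<alpha> (X \<beta>)\<close>, a root vector up to sign.\<close>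

lemma ad_divpow_X_M:
  assumes a: "\<alpha> \<in> Rx" and b: "\<beta> \<in> Rx" shows "ad_divpow (X \<alpha>) k (X \<beta>) \<in> M"
proof -
  consider "nonpar \<alpha> \<beta>" | "\<beta> - \<alpha> \<in> V0" | "\<beta> + \<alpha> \<in> V0" by (auto simp: nonpar_def)
  then show ?thesis
  proof cases
    case 1
    then show ?thesis using ad_divpow_nonpar[OF a b] X0_M M_scale by metis
  next
    case 2
    then have "ad_divpow (X \<alpha>) (Suc 0) (X \<beta>) = 0" using lie_par_zero[OF a b] by simp
    then have "ad_divpow (X \<alpha>) k (X \<beta>) = 0" if "k \<noteq> 0"
      using that by (intro ad_divpow_zero_mono[of _ "Suc 0" _ k]) auto
    then show ?thesis using M_zero X_M[OF b] by (cases "k = 0") auto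
  next
    case 3
    have "ad_divpow (X \<alpha>) 3 (X \<beta>) = 0" using opposite_string(1)[OF a b 3] by (simp add: ad_divpow_eq_zero_iff)
    then have big: "ad_divpow (X \<alpha>) k (X \<beta>) = 0" if "k \<ge> 3" using that ad_divpow_zero_mono by blast
    have two: "ad_divpow (X \<alpha>) 2 (X \<beta>) \<in> M"
      using opposite_string(2)[OF a b 3] weyl_X[OF a b] X_M[OF refl_Rx[OF a b]] M_scale by metis
    consider "k = 0" | "k = Suc 0" | "k = 2" | "k \<ge> 3" by linarith
    then show ?thesis using big two X_M[OF b] M_zero lie_X_X_M[OF a b] by cases auto
  qed
qed

text \<open>On an isotropic generator the square of ad (X \<alpha>) vanishes, because no root is
  congruent to 2\<alpha> modulo \<open>V0\<close>; so no denominators arise there.\<close>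

lemma ad_divpow_M:
  assumes a: "\<alpha> \<in> Rx" and "v \<in> M" shows "ad_divpow (X \<alpha>) k v \<in> M"
  using assms(2)
proof (induction rule: M_induct)
  case (isotropic \<gamma> \<gamma>')
  let ?D = "lie (X \<gamma>) (X \<gamma>')"
  have D: "?D \<in> root_space (\<gamma> + \<gamma>')" using isotropic by (intro root_space_lie X_root)
  have "lie (X \<alpha>) ?D \<in> root_space (\<alpha> + (\<gamma> + \<gamma>'))" by (rule root_space_lie[OF X_root[OF a] D])
  moreover have "\<alpha> + (\<gamma> + \<gamma>') + \<alpha> \<notin> R"
    by (rule par_sum_not_root[OF a]) (use isotropic in simp)
  ultimately have "lie (X \<alpha>) (lie (X \<alpha>) ?D) = 0"
    using isotropic a by (intro lie_not_root[OF X_root[OF a]]) (auto simp: Rx_V V_add)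
  then have "ad_divpow (X \<alpha>) 2 ?D = 0" by (simp add: ad_divpow_2)
  then have big: "ad_divpow (X \<alpha>) k ?D = 0" if "k \<ge> 2" using that ad_divpow_zero_mono by blast
  have M: "?D \<in> M" using isotropic by (intro isotropic_M)
  consider "k = 0" | "k = Suc 0" | "k \<ge> 2" by linarith
  then show ?case using big M M_zero lie_X_M[OF a M] by cases auto
qed (auto simp: ad_divpow_X_M a ad_divpow_add ad_divpow_scale M_zero M_add M_scale)

subsection \<open>Coefficients of root vectors\<close>

text \<open>Pairing with \<open>X (- \<alpha>)\<close>, normalised by \<open>form_X\<close>, gives
  the coordinate along \<open>X \<alpha>\<close> without a basis of \<open>core_Z X\<close>. On
  \<open>M\<close> the value is an integer, and the floor only changes its type.\<close>

definition coef :: "('g \<Rightarrow> complex) \<Rightarrow> 'g \<Rightarrow> int" where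
  "coef \<alpha> v = \<lfloor>Re (dform \<alpha> \<alpha> / 2 * form v (X (- \<alpha>)))\<rfloor>"

lemma form_X_other:
  "\<alpha> \<in> Rx \<Longrightarrow> \<beta> \<in> V \<Longrightarrow> v \<in> root_space \<beta> \<Longrightarrow> \<beta> \<noteq> \<alpha> \<Longrightarrow> form v (X (- \<alpha>)) = 0"
  by (rule root_space_form[of _ \<beta> _ "- \<alpha>"]) (auto simp: X_root Rx_minus V_t(1) V_minus Rx_V)

text \<open>Among the generators only \<open>X \<alpha>\<close> itself pairs nontrivially with
  \<open>X (- \<alpha>)\<close>.\<close>

lemma coef:
  assumes a: "\<alpha> \<in> Rx" and "v \<in> M" shows "dform \<alpha> \<alpha> / 2 * form v (X (- \<alpha>)) = of_int (coef \<alpha> v)"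
proof -
  define k w where "k = dform \<alpha> \<alpha> / 2" and "w = X (- \<alpha>)"
  have "\<exists>n::int. k * form v w = of_int n"
    using assms(2)
  proof (induction rule: M_induct)
    case (root \<beta>)
    show ?case
    proof (cases "\<beta> = \<alpha>")
      case True
      then have "k * form (X \<beta>) w = of_int 1"
        unfolding k_def w_def using form_X[OF a] Rx_norm[OF a] by simp
      then show ?thesis by blast
    next
      case False
      then have "form (X \<beta>) w = 0"
        unfolding w_def by (rule form_X_other[OF a Rx_V[OF root] X_root[OF root]])
      then show ?thesis by (intro exI[of _ 0]) simp
    qed
  next
    case (isotropic \<beta> \<beta>')
    have "\<beta> + \<beta>' \<noteq> \<alpha>" using isotropic(3) Rx_iff_V0[OF Rx_R[OF a]] a by auto
    then have "form (lie (X \<beta>) (X \<beta>')) w = 0"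
      unfolding w_def using isotropic
      by (intro form_X_other[OF a _ root_space_lie[OF X_root X_root]]) (auto simp: V0_V)
    then show ?case by (intro exI[of _ 0]) simp
  next
    case (add u v)
    then obtain n m where "k * form u w = of_int n" "k * form v w = of_int m" by blast
    then show ?case by (intro exI[of _ "n + m"]) (simp add: form_add distrib_left)
  next
    case (scale n v)
    then obtain m where "k * form v w = of_int m" by blast
    then show ?case by (intro exI[of _ "n * m"]) (simp add: form_scale)
  qed (auto intro: exI[of _ 0])
  then show ?thesis unfolding k_def w_def coef_def by (metis Re_complex_of_real floor_of_int of_real_of_int_eq)
qed

lemma coef_add: "\<alpha> \<in> Rx \<Longrightarrow> u \<in> M \<Longrightarrow> v \<in> M \<Longrightarrow> coef \<alpha> (u + v) = coef \<alpha> u + coef \<alpha> v"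
proof -
  assume *: "\<alpha> \<in> Rx" "u \<in> M" "v \<in> M"
  have "of_int (coef \<alpha> (u + v)) = (of_int (coef \<alpha> u + coef \<alpha> v) :: complex)"
    using coef[OF *(1,2)] coef[OF *(1,3)] coef[OF *(1) M_add[OF *(2,3)]]
    by (simp add: form_add distrib_left)
  then show ?thesis by (simp only: of_int_eq_iff)
qed

lemma coef_X: "\<alpha> \<in> Rx \<Longrightarrow> coef \<alpha> (X \<alpha>) = 1"
  by (simp add: coef_def form_X Rx_norm)

lemma coef_other: "\<alpha> \<in> Rx \<Longrightarrow> \<beta> \<in> V \<Longrightarrow> v \<in> root_space \<beta> \<Longrightarrow> \<beta> \<noteq> \<alpha> \<Longrightarrow> coef \<alpha> v = 0"
  by (simp add: coef_def form_X_other)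

end

section \<open>Extension of scalars\<close>

definition biadditive :: "'a::ab_group_add set \<Rightarrow> ('b, 'm) monoid_scheme \<Rightarrow> ('a \<Rightarrow> 'k::field \<Rightarrow> 'b) \<Rightarrow> bool" where
  "biadditive M A f \<longleftrightarrow> (\<forall>x\<in>M. \<forall>c. f x c \<in> carrier A) \<and>
     (\<forall>x\<in>M. \<forall>y\<in>M. \<forall>c. f (x + y) c = f x c \<otimes>\<^bsub>A\<^esub> f y c) \<and>
     (\<forall>x\<in>M. \<forall>c d. f x (c + d) = f x c \<otimes>\<^bsub>A\<^esub> f x d)"

lemma biadditiveI:
  assumes "\<And>x c. x \<in> M \<Longrightarrow> f x c \<in> carrier A" "\<And>x y c. x \<in> M \<Longrightarrow> y \<in> M \<Longrightarrow> f (x + y) c = f x c \<otimes>\<^bsub>A\<^esub> f y c"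
    "\<And>x c d. x \<in> M \<Longrightarrow> f x (c + d) = f x c \<otimes>\<^bsub>A\<^esub> f x d"
  shows "biadditive M A f"
  using assms by (auto simp: biadditive_def)

locale ztensor =
  fixes M :: "'a::ab_group_add set" and K :: "'k::field itself"
  assumes module_zero: "0 \<in> M" and module_add: "x \<in> M \<Longrightarrow> y \<in> M \<Longrightarrow> x + y \<in> M"
    and module_minus: "x \<in> M \<Longrightarrow> - x \<in> M"
begin

abbreviation F :: "('a \<times> 'k \<Rightarrow>\<^sub>0 int) monoid" where "F \<equiv> free_Abelian_group (M \<times> UNIV)"
abbreviation N :: "('a \<times> 'k \<Rightarrow>\<^sub>0 int) set" where "N \<equiv> tensor_rel M"
abbreviation T :: "('a \<times> 'k \<Rightarrow>\<^sub>0 int) set monoid" where "T \<equiv> tensor M"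
abbreviation pt :: "'a \<Rightarrow> 'k \<Rightarrow> ('a \<times> 'k \<Rightarrow>\<^sub>0 int) set" where "pt \<equiv> pure_tensor M"

abbreviation relations :: "('a \<times> 'k \<Rightarrow>\<^sub>0 int) set" where
  "relations \<equiv> {frag_of (x + y, c) - frag_of (x, c) - frag_of (y, c) | x y c. x \<in> M \<and> y \<in> M} \<union>
      {frag_of (x, c + d) - frag_of (x, c) - frag_of (x, d) | x c d. x \<in> M}"

sublocale F: comm_group F
  by (rule abelian_free_Abelian_group)

lemma F_diff: "u \<in> carrier F \<Longrightarrow> v \<in> carrier F \<Longrightarrow> u - v \<in> carrier F"
  using keys_diff[of u v] by auto

lemma frag_F: "x \<in> M \<Longrightarrow> frag_of (x, c) \<in> carrier F"
  by simp

lemma relations_F: "relations \<subseteq> carrier F"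
proof
  fix r assume "r \<in> relations"
  then consider x y c where "x \<in> M" "y \<in> M" "r = frag_of (x + y, c) - frag_of (x, c) - frag_of (y, c)"
    | x c d where "x \<in> M" "r = frag_of (x, c + d) - frag_of (x, c) - frag_of (x, d)" by blast
  then show "r \<in> carrier F" by cases (auto intro!: F_diff frag_F module_add simp del: carrier_free_Abelian_group_iff)
qed

lemma N_generate: "N = generate F relations"
  by (simp add: tensor_rel_def)

lemma N_subgroup: "subgroup N F"
  unfolding N_generate by (rule F.generate_is_subgroup[OF relations_F])

lemma N_normal: "N \<lhd> F"
  by (rule F.subgroup_imp_normal[OF N_subgroup])

sublocale N: normal N F
  by (rule N_normal)

lemma T_def: "T = F Mod N"
  by (simp add: tensor_def)

sublocale T: comm_group T
  unfolding T_def by (rule F.abelian_FactGroup[OF N_subgroup])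

lemma coset_hom: "(\<lambda>a. N #>\<^bsub>F\<^esub> a) \<in> hom F T"
  unfolding T_def by (rule N.r_coset_hom_Mod)

lemma coset_mult: "u \<in> carrier F \<Longrightarrow> v \<in> carrier F \<Longrightarrow> N #>\<^bsub>F\<^esub> (u + v) = (N #>\<^bsub>F\<^esub> u) \<otimes>\<^bsub>T\<^esub> (N #>\<^bsub>F\<^esub> v)"
  using hom_mult[OF coset_hom] by simp

lemma coset_eq:
  assumes "u \<in> carrier F" "v \<in> carrier F" "u - v \<in> N" shows "N #>\<^bsub>F\<^esub> u = N #>\<^bsub>F\<^esub> v"
proof -
  have "u \<in> N #>\<^bsub>F\<^esub> v" unfolding r_coset_def using assms(3) by force
  then show ?thesis using F.repr_independence[OF _ assms(2) N_subgroup] by simp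
qed

lemma pt_closed [simp]: "x \<in> M \<Longrightarrow> pt x c \<in> carrier T"
  using hom_in_carrier[OF coset_hom frag_F] by (simp add: pure_tensor_def)

lemma pt_add_left:
  assumes "x \<in> M" "y \<in> M" shows "pt (x + y) c = pt x c \<otimes>\<^bsub>T\<^esub> pt y c"
proof -
  have "frag_of (x + y, c) - frag_of (x, c) - frag_of (y, c) \<in> relations" using assms by blast
  then have "frag_of (x + y, c) - (frag_of (x, c) + frag_of (y, c)) \<in> N"
    unfolding N_generate diff_diff_eq[symmetric] by (rule generate.incl)
  then have "N #>\<^bsub>F\<^esub> frag_of (x + y, c) = N #>\<^bsub>F\<^esub> (frag_of (x, c) + frag_of (y, c))"
    using F.m_closed[OF frag_F frag_F] assms by (intro coset_eq frag_F module_add) auto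
  then show ?thesis unfolding pure_tensor_def using coset_mult[OF frag_F frag_F] assms by simp
qed

lemma pt_add_right:
  assumes "x \<in> M" shows "pt x (c + d) = pt x c \<otimes>\<^bsub>T\<^esub> pt x d"
proof -
  have "frag_of (x, c + d) - frag_of (x, c) - frag_of (x, d) \<in> relations" using assms by blast
  then have "frag_of (x, c + d) - (frag_of (x, c) + frag_of (x, d)) \<in> N"
    unfolding N_generate diff_diff_eq[symmetric] by (rule generate.incl)
  then have "N #>\<^bsub>F\<^esub> frag_of (x, c + d) = N #>\<^bsub>F\<^esub> (frag_of (x, c) + frag_of (x, d))"
    using F.m_closed[OF frag_F frag_F] assms by (intro coset_eq frag_F module_add) auto
  then show ?thesis unfolding pure_tensor_def using coset_mult[OF frag_F frag_F] assms by simp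
qed

text \<open>The division step is that of the induction principle for free abelian groups. The unit
  needs no case of its own, being the quotient of a pure tensor by itself.\<close>

lemma T_induct [consumes 1, case_names pt div]:
  assumes "u \<in> carrier T" and "\<And>x c. x \<in> M \<Longrightarrow> P (pt x c)"
    "\<And>u v. u \<in> carrier T \<Longrightarrow> v \<in> carrier T \<Longrightarrow> P u \<Longrightarrow> P v \<Longrightarrow> P (u \<otimes>\<^bsub>T\<^esub> inv\<^bsub>T\<^esub> v)"
  shows "P u"
proof -
  interpret q: group_hom F T "\<lambda>a. N #>\<^bsub>F\<^esub> a"
    by (simp add: group_hom_def group_hom_axioms_def coset_hom F.is_group T.is_group)
  have one: "P \<one>\<^bsub>T\<^esub>"
    using assms(3)[OF pt_closed pt_closed assms(2) assms(2), of 0 0 0 0] module_zero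
    by (simp add: T.r_inv)
  have "u \<in> carrier (F Mod N)" using assms(1) by (simp add: T_def)
  then obtain w where w: "w \<in> carrier F" "u = N #>\<^bsub>F\<^esub> w" by (auto simp: FactGroup_def RCOSETS_def)
  have "P (N #>\<^bsub>F\<^esub> w)"
  proof (rule free_Abelian_group_induct[of w "M \<times> UNIV"])
    show "Poly_Mapping.keys w \<subseteq> M \<times> UNIV" using w(1) by simp
    show "P (N #>\<^bsub>F\<^esub> 0)" using one q.hom_one by simp
    show "P (N #>\<^bsub>F\<^esub> frag_of a)" if "a \<in> M \<times> UNIV" for a
      using that assms(2) by (auto simp: pure_tensor_def)
    fix x y :: "'a \<times> 'k \<Rightarrow>\<^sub>0 int"
    assume *: "Poly_Mapping.keys x \<subseteq> M \<times> UNIV" "Poly_Mapping.keys y \<subseteq> M \<times> UNIV"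
      "P (N #>\<^bsub>F\<^esub> x)" "P (N #>\<^bsub>F\<^esub> y)"
    then have xy: "x \<in> carrier F" "y \<in> carrier F" by auto
    have "N #>\<^bsub>F\<^esub> (x \<otimes>\<^bsub>F\<^esub> inv\<^bsub>F\<^esub> y) = (N #>\<^bsub>F\<^esub> x) \<otimes>\<^bsub>T\<^esub> inv\<^bsub>T\<^esub> (N #>\<^bsub>F\<^esub> y)"
      by (simp only: q.hom_mult[OF xy(1) F.inv_closed[OF xy(2)]] q.hom_inv[OF xy(2)])
    then have "N #>\<^bsub>F\<^esub> (x - y) = (N #>\<^bsub>F\<^esub> x) \<otimes>\<^bsub>T\<^esub> inv\<^bsub>T\<^esub> (N #>\<^bsub>F\<^esub> y)" using * by simp
    then show "P (N #>\<^bsub>F\<^esub> (x - y))" using assms(3) * q.hom_closed by simp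
  qed
  then show ?thesis using w by simp
qed

lemma hom_ext:
  assumes "group A" "h \<in> hom T A" "h' \<in> hom T A" "\<And>x c. x \<in> M \<Longrightarrow> h (pt x c) = h' (pt x c)" "u \<in> carrier T"
  shows "h u = h' u"
proof -
  interpret h: group_hom T A h using assms by (simp add: group_hom_def group_hom_axioms_def T.is_group)
  interpret h': group_hom T A h' using assms by (simp add: group_hom_def group_hom_axioms_def T.is_group)
  show ?thesis using assms(5) by (induction rule: T_induct) (auto simp: assms(4))
qed

text \<open>The universal property: the map induced on the free abelian group kills the relations.
  The target is arbitrary because \<open>E_inj\<close> needs a homomorphism into the additive group
  of the field.\<close>

lemma lift_hom:
  assumes A: "comm_group A" and f: "biadditive M A f"
  obtains h where "h \<in> hom T A" "\<And>x c. x \<in> M \<Longrightarrow> h (pt x c) = f x c"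
proof -
  interpret A: comm_group A by (rule A)
  have "case_prod f ` (M \<times> UNIV) \<subseteq> carrier A" using f by (auto simp: biadditive_def)
  then obtain g where g: "g \<in> hom F A" "\<And>p. p \<in> M \<times> UNIV \<Longrightarrow> g (frag_of p) = case_prod f p"
    by (rule A.free_Abelian_group_universal) blast
  interpret g: group_hom F A g by (simp add: group_hom_def group_hom_axioms_def g F.is_group A.is_group)
  have diff: "g (u - v) = g u \<otimes>\<^bsub>A\<^esub> inv\<^bsub>A\<^esub> g v" if "u \<in> carrier F" "v \<in> carrier F" for u v
  proof -
    have "g (u \<otimes>\<^bsub>F\<^esub> inv\<^bsub>F\<^esub> v) = g u \<otimes>\<^bsub>A\<^esub> inv\<^bsub>A\<^esub> g v"
      by (simp only: g.hom_mult[OF that(1) F.inv_closed[OF that(2)]] g.hom_inv[OF that(2)])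
    then show ?thesis using that by simp
  qed
  have cancel: "x \<otimes>\<^bsub>A\<^esub> y \<otimes>\<^bsub>A\<^esub> inv\<^bsub>A\<^esub> x \<otimes>\<^bsub>A\<^esub> inv\<^bsub>A\<^esub> y = \<one>\<^bsub>A\<^esub>"
    if "x \<in> carrier A" "y \<in> carrier A" for x y
    using that by (simp add: A.m_comm[of x y] A.m_assoc)
  have fc: "f x c \<in> carrier A" if "x \<in> M" for x c using f that by (simp add: biadditive_def)
  have gd: "g (frag_of (x, a) - frag_of (y, b) - frag_of (z, c)) = f x a \<otimes>\<^bsub>A\<^esub> inv\<^bsub>A\<^esub> f y b \<otimes>\<^bsub>A\<^esub> inv\<^bsub>A\<^esub> f z c"
    if "x \<in> M" "y \<in> M" "z \<in> M" for x y z a b c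
    by (simp only: diff[OF F_diff[OF frag_F[OF that(1)] frag_F[OF that(2)]] frag_F[OF that(3)]]
        diff[OF frag_F[OF that(1)] frag_F[OF that(2)]]) (simp add: g(2) that)
  have "relations \<subseteq> kernel F A g"
  proof
    fix r assume r: "r \<in> relations"
    then have "r \<in> carrier F" using relations_F by blast
    moreover consider x y c where "x \<in> M" "y \<in> M" "r = frag_of (x + y, c) - frag_of (x, c) - frag_of (y, c)"
      | x c d where "x \<in> M" "r = frag_of (x, c + d) - frag_of (x, c) - frag_of (x, d)" using r by blast
    then have "g r = \<one>\<^bsub>A\<^esub>"
    proof cases
      case 1
      then show ?thesis using f by (simp add: gd module_add biadditive_def cancel)
    next
      case 2
      then show ?thesis using f by (simp add: gd biadditive_def cancel)
    qed
    ultimately show "r \<in> kernel F A g" by (simp add: kernel_def)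
  qed
  then have "N \<subseteq> kernel F A g"
    unfolding N_generate by (rule F.generate_subgroup_incl[OF _ g.subgroup_kernel])
  then obtain h where h: "h \<in> hom (F Mod N) A" "\<And>x. x \<in> carrier F \<Longrightarrow> h (N #>\<^bsub>F\<^esub> x) = g x"
    using g.FactGroup_universal_kernel[OF N_normal] by metis
  have "h (pt x c) = f x c" if "x \<in> M" for x c
    using h(2)[OF frag_F[OF that]] g(2) that by (simp add: pure_tensor_def)
  then show thesis using that h(1) by (simp add: T_def)
qed

text \<open>Turns the definite description into usable facts. Restricting the homomorphism to the
  carrier makes it extensional, and extensionality makes it unique.\<close>

lemma tensor_lift:
  assumes f: "biadditive M T f"
  shows "tensor_lift M f \<in> hom T T" "tensor_lift M f \<in> extensional (carrier T)"
    "x \<in> M \<Longrightarrow> tensor_lift M f (pt x c) = f x c"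
proof -
  obtain h where h: "h \<in> hom T T" "\<And>x c. x \<in> M \<Longrightarrow> h (pt x c) = f x c"
    using lift_hom[OF T.comm_group_axioms f] by metis
  let ?P = "\<lambda>h. h \<in> hom T T \<and> h \<in> extensional (carrier T) \<and> (\<forall>x\<in>M. \<forall>c. h (pt x c) = f x c)"
  have "?P (restrict h (carrier T))" using h by (auto simp: hom_def)
  moreover have "h1 = h2" if "?P h1" "?P h2" for h1 h2
    by (rule extensionalityI[of _ "carrier T"]) (use that hom_ext[OF T.is_group, of h1 h2] in auto)
  ultimately have "\<exists>!h. ?P h" by blast
  then have "?P (tensor_lift M f)" unfolding tensor_lift_def by (rule theI')
  then show "tensor_lift M f \<in> hom T T" "tensor_lift M f \<in> extensional (carrier T)"
    "x \<in> M \<Longrightarrow> tensor_lift M f (pt x c) = f x c" by auto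
qed

lemma tensor_lift_eqI:
  assumes "biadditive M T f" "h \<in> hom T T" "\<And>x c. x \<in> M \<Longrightarrow> h (pt x c) = f x c" "u \<in> carrier T"
  shows "tensor_lift M f u = h u"
  using hom_ext[OF T.is_group tensor_lift(1)[OF assms(1)] assms(2) _ assms(4)] tensor_lift(3)[OF assms(1)] assms(3)
  by simp

lemma biadditive_scale: "biadditive M T (\<lambda>x c. pt x (s * c))"
  by (rule biadditiveI) (auto simp: pt_add_left pt_add_right distrib_left)

lemma tensor_scale_hom: "tensor_scale M s \<in> hom T T"
  and tensor_scale_pt: "x \<in> M \<Longrightarrow> tensor_scale M s (pt x c) = pt x (s * c)"
  unfolding tensor_scale_def using tensor_lift[OF biadditive_scale] by auto

lemma hom_mult2:
  assumes "g \<in> hom T T" "h \<in> hom T T" shows "(\<lambda>u. g u \<otimes>\<^bsub>T\<^esub> h u) \<in> hom T T"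
  using assms by (auto simp: hom_def Pi_def T.m_ac)

definition bracket :: "('a \<Rightarrow> 'a \<Rightarrow> 'a) \<Rightarrow> bool" where
  "bracket br \<longleftrightarrow> (\<forall>x\<in>M. \<forall>y\<in>M. br x y \<in> M) \<and> (\<forall>x\<in>M. \<forall>y\<in>M. \<forall>z\<in>M. br (x + y) z = br x z + br y z) \<and>
     (\<forall>x\<in>M. \<forall>y\<in>M. \<forall>z\<in>M. br x (y + z) = br x y + br x z)"

context
  fixes br assumes br: "bracket br"
begin

lemma biadditive_inner: "y \<in> M \<Longrightarrow> biadditive M T (\<lambda>x c. pt (br x y) (c * d))"
  by (rule biadditiveI) (use br in \<open>auto simp: bracket_def pt_add_left pt_add_right distrib_right\<close>)

lemma biadditive_outer:
  assumes u: "u \<in> carrier T"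
  shows "biadditive M T (\<lambda>y d. tensor_lift M (\<lambda>x c. pt (br x y) (c * d)) u)"
proof (rule biadditiveI)
  let ?g = "\<lambda>y d. tensor_lift M (\<lambda>x c. pt (br x y) (c * d))"
  show "?g y d u \<in> carrier T" if "y \<in> M" for y d
    by (rule hom_in_carrier[OF tensor_lift(1)[OF biadditive_inner[OF that]] u])
  show "?g (y + z) d u = ?g y d u \<otimes>\<^bsub>T\<^esub> ?g z d u" if "y \<in> M" "z \<in> M" for y z d
    by (rule tensor_lift_eqI[OF biadditive_inner[OF module_add[OF that]]
          hom_mult2[OF tensor_lift(1)[OF biadditive_inner[OF that(1)]] tensor_lift(1)[OF biadditive_inner[OF that(2)]]] _ u])
      (use that br in \<open>simp add: tensor_lift(3) biadditive_inner bracket_def pt_add_left\<close>)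
  show "?g y (d + e) u = ?g y d u \<otimes>\<^bsub>T\<^esub> ?g y e u" if "y \<in> M" for y d e
    by (rule tensor_lift_eqI[OF biadditive_inner[OF that]
          hom_mult2[OF tensor_lift(1)[OF biadditive_inner[OF that]] tensor_lift(1)[OF biadditive_inner[OF that]]] _ u])
      (use that br in \<open>simp add: tensor_lift(3) biadditive_inner bracket_def pt_add_right distrib_left\<close>)
qed

lemma tensor_lie_hom_right: "u \<in> carrier T \<Longrightarrow> tensor_lie br M u \<in> hom T T"
  using tensor_lift(1)[OF biadditive_outer] unfolding tensor_lie_def[abs_def] by simp

lemma tensor_lie_pt_right:
  "u \<in> carrier T \<Longrightarrow> y \<in> M \<Longrightarrow> tensor_lie br M u (pt y d) = tensor_lift M (\<lambda>x c. pt (br x y) (c * d)) u"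
  unfolding tensor_lie_def by (rule tensor_lift(3)[OF biadditive_outer])

lemma tensor_lie_pt: "x \<in> M \<Longrightarrow> y \<in> M \<Longrightarrow> tensor_lie br M (pt x c) (pt y d) = pt (br x y) (c * d)"
  by (simp add: tensor_lie_pt_right tensor_lift(3) biadditive_inner)

lemma tensor_lie_closed: "u \<in> carrier T \<Longrightarrow> v \<in> carrier T \<Longrightarrow> tensor_lie br M u v \<in> carrier T"
  using hom_in_carrier[OF tensor_lie_hom_right] .

text \<open>\<open>tensor_lie\<close> is a lift in its second argument only, so additivity in the
  first is proved by induction on the second; for a pure tensor there it is additivity of the inner
  lift.\<close>

lemma tensor_lie_hom_left:
  assumes "v \<in> carrier T" shows "(\<lambda>u. tensor_lie br M u v) \<in> hom T T"
proof -
  have "\<forall>u\<in>carrier T. \<forall>u'\<in>carrier T. tensor_lie br M (u \<otimes>\<^bsub>T\<^esub> u') v = tensor_lie br M u v \<otimes>\<^bsub>T\<^esub> tensor_lie br M u' v"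
    using assms
  proof (induction rule: T_induct)
    case (pt y d)
    then show ?case using hom_mult[OF tensor_lift(1)[OF biadditive_inner[OF pt, of d]]]
      by (simp add: tensor_lie_pt_right)
  next
    case (div v w)
    have d: "tensor_lie br M u (v \<otimes>\<^bsub>T\<^esub> inv\<^bsub>T\<^esub> w) = tensor_lie br M u v \<otimes>\<^bsub>T\<^esub> inv\<^bsub>T\<^esub> tensor_lie br M u w"
      if "u \<in> carrier T" for u
    proof -
      interpret l: group_hom T T "tensor_lie br M u"
        by (simp add: group_hom_def group_hom_axioms_def tensor_lie_hom_right that T.is_group)
      show ?thesis using div by simp
    qed
    show ?case using div by (simp add: d tensor_lie_closed T.inv_mult T.m_ac)
  qed
  then show ?thesis using assms by (auto simp: hom_def tensor_lie_closed)
qed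

lemma tensor_Aut_subgroup: "subgroup (carrier (tensor_Aut br M)) (BijGroup (carrier T))"
proof -
  let ?S = "carrier (tensor_Aut br M) :: (('a \<times> 'k \<Rightarrow>\<^sub>0 int) set \<Rightarrow> _) set"
  have S: "f \<in> ?S \<longleftrightarrow> f \<in> Bij (carrier T) \<and> f \<in> hom T T \<and>
        (\<forall>s. \<forall>u\<in>carrier T. f (tensor_scale M s u) = tensor_scale M s (f u)) \<and>
        (\<forall>u\<in>carrier T. \<forall>v\<in>carrier T. f (tensor_lie br M u v) = tensor_lie br M (f u) (f v))" for f
    by (simp add: tensor_Aut_def)
  interpret G: group "BijGroup (carrier T)" by (rule group_BijGroup)
  have sc: "tensor_scale M s \<in> carrier T \<rightarrow> carrier T" for s using tensor_scale_hom by (auto simp: hom_def)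
  show ?thesis
  proof (rule G.subgroupI)
    show "?S \<subseteq> carrier (BijGroup (carrier T))" by (auto simp: S BijGroup_def)
    have "(\<lambda>u\<in>carrier T. u) \<in> ?S"
      unfolding S using sc by (auto simp: id_Bij hom_def tensor_lie_closed)
    then show "?S \<noteq> {}" by auto
  next
    fix f assume f: "f \<in> ?S"
    then have fB: "f \<in> Bij (carrier T)" by (simp add: S)
    let ?i = "inv_into (carrier T) f"
    have i: "inv\<^bsub>BijGroup (carrier T)\<^esub> f = (\<lambda>u\<in>carrier T. ?i u)" by (rule inv_BijGroup[OF fB])
    have bij: "bij_betw f (carrier T) (carrier T)" using fB by (simp add: Bij_def)
    have ic: "?i u \<in> carrier T" if "u \<in> carrier T" for u by (rule Bij_inv_into_mem[OF fB that])
    have fi: "f (?i u) = u" if "u \<in> carrier T" for u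
      using that bij by (simp add: bij_betw_def f_inv_into_f)
    have if': "?i (f u) = u" if "u \<in> carrier T" for u
      using that bij by (simp add: bij_betw_def inv_into_f_f)
    have "?i (u \<otimes>\<^bsub>T\<^esub> v) = ?i u \<otimes>\<^bsub>T\<^esub> ?i v" if "u \<in> carrier T" "v \<in> carrier T" for u v
    proof -
      have "f \<in> hom T T" using f by (simp add: S)
      then have "f (?i u \<otimes>\<^bsub>T\<^esub> ?i v) = u \<otimes>\<^bsub>T\<^esub> v" using hom_mult[OF _ ic[OF that(1)] ic[OF that(2)]] fi that by metis
      then show ?thesis using if'[of "?i u \<otimes>\<^bsub>T\<^esub> ?i v"] ic that by simp
    qed
    moreover have "?i (tensor_scale M s u) = tensor_scale M s (?i u)" if "u \<in> carrier T" for s u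
    proof -
      have "f (tensor_scale M s (?i u)) = tensor_scale M s u" using f that ic fi by (simp add: S)
      then show ?thesis using if'[of "tensor_scale M s (?i u)"] ic that sc by fastforce
    qed
    moreover have "?i (tensor_lie br M u v) = tensor_lie br M (?i u) (?i v)" if "u \<in> carrier T" "v \<in> carrier T" for u v
    proof -
      have "f (tensor_lie br M (?i u) (?i v)) = tensor_lie br M u v" using f that ic fi by (simp add: S)
      then show ?thesis using if'[of "tensor_lie br M (?i u) (?i v)"] ic that by (simp add: tensor_lie_closed)
    qed
    ultimately show "inv\<^bsub>BijGroup (carrier T)\<^esub> f \<in> ?S"
      unfolding i S using restrict_inv_into_Bij[OF fB] sc ic
      by (auto simp: hom_def tensor_lie_closed Pi_def)
  next
    fix f g assume f: "f \<in> ?S" and g: "g \<in> ?S"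
    have "f \<otimes>\<^bsub>BijGroup (carrier T)\<^esub> g = compose (carrier T) f g" using f g by (simp add: S BijGroup_def)
    moreover have "(\<lambda>u\<in>carrier T. f (g u)) \<in> Bij (carrier T)"
      using compose_Bij[of f _ g] f g by (simp add: S compose_def)
    moreover have "g u \<in> carrier T" if "u \<in> carrier T" for u using g that by (auto simp: S hom_def)
    ultimately show "f \<otimes>\<^bsub>BijGroup (carrier T)\<^esub> g \<in> ?S"
      using f g sc unfolding S by (auto simp: compose_Bij hom_def compose_def tensor_lie_closed Pi_def)
  qed
qed

lemma tensor_Aut_group: "group (tensor_Aut br M :: (('a \<times> 'k \<Rightarrow>\<^sub>0 int) set \<Rightarrow> _) monoid)"
proof -
  have eq: "tensor_Aut br M = (BijGroup (carrier T))\<lparr>carrier := carrier (tensor_Aut br M)\<rparr>"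
    by (simp add: tensor_Aut_def)
  show ?thesis by (subst eq) (rule subgroup.subgroup_is_group[OF tensor_Aut_subgroup group_BijGroup])
qed

text \<open>Both sides of each compatibility are homomorphisms in every argument, so
  \<open>hom_ext\<close>, applied to one argument at a time, reduces them to pure tensors.\<close>

lemma tensor_AutI:
  assumes f: "f \<in> hom T T" "f \<in> Bij (carrier T)"
    and s: "\<And>x c s. x \<in> M \<Longrightarrow> f (pt x (s * c)) = tensor_scale M s (f (pt x c))"
    and l: "\<And>x y c d. x \<in> M \<Longrightarrow> y \<in> M \<Longrightarrow> f (pt (br x y) (c * d)) = tensor_lie br M (f (pt x c)) (f (pt y d))"
  shows "f \<in> carrier (tensor_Aut br M)"
proof -
  have fc: "f u \<in> carrier T" if "u \<in> carrier T" for u using f(1) that by (auto simp: hom_def)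
  have "f (tensor_scale M s u) = tensor_scale M s (f u)" if "u \<in> carrier T" for s u
    using hom_ext[OF T.is_group hom_compose[OF tensor_scale_hom f(1)] hom_compose[OF f(1) tensor_scale_hom] _ that, of s s]
      assms(3) by (simp add: tensor_scale_pt)
  moreover have "f (tensor_lie br M u v) = tensor_lie br M (f u) (f v)" if "u \<in> carrier T" "v \<in> carrier T" for u v
  proof -
    have 1: "f (tensor_lie br M (pt x c) v) = tensor_lie br M (f (pt x c)) (f v)" if "x \<in> M" for x c
      using hom_ext[OF T.is_group hom_compose[OF tensor_lie_hom_right f(1)]
          hom_compose[OF f(1) tensor_lie_hom_right] _ \<open>v \<in> carrier T\<close>, of "pt x c" "f (pt x c)"]
        that l by (simp add: tensor_lie_pt fc)
    show ?thesis
      using hom_ext[OF T.is_group hom_compose[OF tensor_lie_hom_left f(1)]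
          hom_compose[OF f(1) tensor_lie_hom_left] _ \<open>u \<in> carrier T\<close>, of v "f v"]
        1 that by (simp add: fc)
  qed
  ultimately show ?thesis using f by (simp add: tensor_Aut_def)
qed

end

end

section \<open>Double products in commutative monoids\<close>

lemma (in comm_monoid) finprod_Sigma:
  assumes "finite A" "\<And>i. i \<in> A \<Longrightarrow> finite (B i)" "\<And>i j. i \<in> A \<Longrightarrow> j \<in> B i \<Longrightarrow> f i j \<in> carrier G"
  shows "finprod G (\<lambda>i. finprod G (f i) (B i)) A = finprod G (\<lambda>(i, j). f i j) (Sigma A B)"
proof -
  have "finprod G (\<lambda>(i, j). f i j) (\<Union>i\<in>A. Pair i ` B i) = finprod G (\<lambda>i. finprod G (\<lambda>(i, j). f i j) (Pair i ` B i)) A"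
    using assms by (intro finprod_UN_disjoint) (auto simp: pairwise_def disjnt_def)
  also have "\<dots> = finprod G (\<lambda>i. finprod G (f i) (B i)) A"
  proof (rule finprod_cong')
    fix i assume i: "i \<in> A"
    show "finprod G (\<lambda>(i, j). f i j) (Pair i ` B i) = finprod G (f i) (B i)"
      using assms i by (subst finprod_reindex) (auto simp: inj_on_def)
  qed (use assms in auto)
  also have "(\<Union>i\<in>A. Pair i ` B i) = Sigma A B" by auto
  finally show ?thesis by simp
qed

text \<open>The multiplicative form of \<open>sum_triangle\<close>, for use in the group
  \<open>tensor M\<close>.\<close>

lemma (in comm_monoid) finprod_triangle:
  fixes n :: nat
  assumes f: "\<And>i j. f i j \<in> carrier G" and z: "\<And>i j. i \<ge> n \<or> j \<ge> n \<Longrightarrow> f i j = \<one>"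
  shows "finprod G (\<lambda>k. finprod G (\<lambda>i. f i (k - i)) {..k}) {..<2*n} = finprod G (\<lambda>i. finprod G (f i) {..<n}) {..<n}"
proof -
  let ?g = "\<lambda>(i, j). f i j" and ?h = "\<lambda>(k, i). (i, k - i)" and ?S = "SIGMA k:{..<2*n}. {..k}"
  have "finprod G (\<lambda>k. finprod G (\<lambda>i. f i (k - i)) {..k}) {..<2*n} = finprod G (\<lambda>p. ?g (?h p)) ?S"
    using f by (subst finprod_Sigma) (auto intro!: finprod_cong' split: prod.splits)
  also have "\<dots> = finprod G ?g (?h ` ?S)"
    using f by (intro finprod_reindex[symmetric]) (auto simp: inj_on_def)
  also have "\<dots> = finprod G ?g ({..<n} \<times> {..<n})"
  proof (rule finprod_mono_neutral_cong_right)
    show "{..<n} \<times> {..<n} \<subseteq> ?h ` ?S"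
    proof safe
      fix i j assume "i < n" "j < n"
      then show "(i, j) \<in> ?h ` ?S" by (intro image_eqI[of _ _ "(i + j, i)"]) auto
    qed
    show "?g p = \<one>" if "p \<in> ?h ` ?S - {..<n} \<times> {..<n}" for p
    proof -
      from that obtain i j where p: "p = (i, j)" "\<not> (i < n \<and> j < n)" by (cases p) auto
      then show ?thesis using z[of i j] by (auto simp: not_less)
    qed
  qed (use f in auto)
  also have "\<dots> = finprod G (\<lambda>i. finprod G (f i) {..<n}) {..<n}"
    using f by (subst finprod_Sigma) auto
  finally show ?thesis .
qed

lemma hom_finprod:
  assumes "comm_group G" "comm_group A" "h \<in> hom G A" "\<And>i. i \<in> I \<Longrightarrow> f i \<in> carrier G"
  shows "h (finprod G f I) = finprod A (\<lambda>i. h (f i)) I"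
proof -
  interpret G: comm_group G by fact
  interpret A: comm_group A by fact
  interpret h: group_hom G A h
    using assms(3) by (simp add: group_hom_def group_hom_axioms_def G.is_group A.is_group)
  show ?thesis using assms(4)
  proof (induction I rule: infinite_finite_induct)
    case (insert i I)
    then have "f \<in> I \<rightarrow> carrier G" by auto
    then show ?case using insert by (simp add: Pi_def)
  qed auto
qed

context ztensor
begin

lemma pt_zero_left [simp]: "pt 0 c = \<one>\<^bsub>T\<^esub>"
proof -
  have "pt 0 c \<otimes>\<^bsub>T\<^esub> pt 0 c = pt 0 c" using pt_add_left[of 0 0 c] module_zero by simp
  then show ?thesis using module_zero T.l_cancel_one[of "pt 0 c" "pt 0 c"] by simp
qed

lemma pt_zero_right [simp]: "x \<in> M \<Longrightarrow> pt x 0 = \<one>\<^bsub>T\<^esub>"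
  using pt_add_right[of x 0 0] T.l_cancel_one[of "pt x 0" "pt x 0"] by simp

lemma module_sum: "(\<And>i. i \<in> A \<Longrightarrow> g i \<in> M) \<Longrightarrow> (\<Sum>i\<in>A. g i) \<in> M"
  by (induction A rule: infinite_finite_induct) (auto simp: module_zero module_add)

lemma pt_sum_left: "(\<And>i. i \<in> A \<Longrightarrow> g i \<in> M) \<Longrightarrow> pt (\<Sum>i\<in>A. g i) c = finprod T (\<lambda>i. pt (g i) c) A"
proof (induction A rule: infinite_finite_induct)
  case (insert i A)
  then show ?case by (simp add: pt_add_left module_sum Pi_def)
qed auto

lemma pt_sum_right: "x \<in> M \<Longrightarrow> pt x (\<Sum>i\<in>A. g i) = finprod T (\<lambda>i. pt x (g i)) A"
proof (induction A rule: infinite_finite_induct)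
  case (insert i A)
  then show ?case by (simp add: pt_add_right Pi_def)
qed auto

lemma pt_minus: assumes "x \<in> M" shows "pt (- x) c = pt x (- c)"
proof -
  have "pt (- x) c \<otimes>\<^bsub>T\<^esub> pt x c = pt x (- c) \<otimes>\<^bsub>T\<^esub> pt x c"
    using pt_add_left[of "- x" x c] pt_add_right[of x "- c" c] assms module_minus by simp
  then show ?thesis using assms module_minus by simp
qed

end

section \<open>Exponentials over the field \<open>K\<close>\<close>

locale eala_K = eala_chevalley scale lie form H \<tau> X B
  for scale :: "complex \<Rightarrow> 'g::ab_group_add \<Rightarrow> 'g" and lie form H \<tau> X B +
  fixes K :: "'k::field itself"
begin

sublocale Z: ztensor "core_Z X" K
  by unfold_locales (auto simp: M_zero M_add M_minus)

abbreviation T :: "('g \<times> 'k \<Rightarrow>\<^sub>0 int) set monoid" where "T \<equiv> tensor (core_Z X)"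
abbreviation pt :: "'g \<Rightarrow> 'k \<Rightarrow> ('g \<times> 'k \<Rightarrow>\<^sub>0 int) set" where "pt \<equiv> pure_tensor (core_Z X)"
abbreviation D :: "('g \<Rightarrow> complex) \<Rightarrow> nat \<Rightarrow> 'g \<Rightarrow> 'g" where "D \<alpha> \<equiv> ad_divpow (X \<alpha>)"
abbreviation E :: "('g \<Rightarrow> complex) \<Rightarrow> 'k \<Rightarrow> ('g \<times> 'k \<Rightarrow>\<^sub>0 int) set \<Rightarrow> ('g \<times> 'k \<Rightarrow>\<^sub>0 int) set" where
  "E \<equiv> exp_ad X"

lemma M_scale_nat: "v \<in> M \<Longrightarrow> scale (of_nat n) v \<in> M"
  using M_scale[of v "int n"] by simp

lemma pt_scale_nat: "v \<in> M \<Longrightarrow> pt (scale (of_nat n) v) c = pt v (of_nat n * c)"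
  by (induction n) (auto simp: scale_left_distrib Z.pt_add_left Z.pt_add_right distrib_right M_scale_nat)

lemma pt_scale: assumes "v \<in> M" shows "pt (scale (of_int n) v) c = pt v (of_int n * c)"
proof (cases n rule: int_cases2)
  case (nonneg m)
  then show ?thesis using pt_scale_nat[OF assms, of m c] by simp
next
  case (nonpos m)
  then show ?thesis using pt_scale_nat[OF assms, of m "- c"] Z.pt_minus[OF M_scale_nat[OF assms, of m], of c]
      pt_scale_nat[OF assms, of m "- c"] by simp
qed

context
  fixes \<alpha> assumes a: "\<alpha> \<in> Rx"
begin

lemma D_M: "v \<in> M \<Longrightarrow> D \<alpha> k v \<in> M"
  by (rule ad_divpow_M[OF a])

text \<open>The index set in \<open>exp_ad\<close> varies with the vector. A common range makes
  terms comparable, and the added factors are pure tensors of 0, that is, trivial.\<close>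

lemma exp_ad_terms:
  assumes "v \<in> M" "\<And>k. k \<ge> n \<Longrightarrow> D \<alpha> k v = 0"
  shows "finprod T (\<lambda>k. pt (D \<alpha> k v) (c ^ k * s)) {k. D \<alpha> k v \<noteq> 0} = finprod T (\<lambda>k. pt (D \<alpha> k v) (c ^ k * s)) {..<n}"
proof (rule Z.T.finprod_mono_neutral_cong_left)
  show "{k. D \<alpha> k v \<noteq> 0} \<subseteq> {..<n}" using assms(2) by (auto simp: not_le[symmetric])
qed (auto simp: assms(1) D_M)

lemma biadditive_exp_ad:
  "biadditive M T (\<lambda>v s. finprod T (\<lambda>k. pt (D \<alpha> k v) (c ^ k * s)) {k. D \<alpha> k v \<noteq> 0})"
proof (rule biadditiveI)
  show "finprod T (\<lambda>k. pt (D \<alpha> k v) (c ^ k * s)) {k. D \<alpha> k v \<noteq> 0} \<in> carrier T" if "v \<in> M" for v s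
    using that by (intro Z.T.finprod_closed) (auto simp: D_M)
next
  fix u v s assume uv: "u \<in> M" "v \<in> M"
  obtain n where n: "\<And>k. k \<ge> n \<Longrightarrow> D \<alpha> k u = 0" "\<And>k. k \<ge> n \<Longrightarrow> D \<alpha> k v = 0"
    using ad_divpow_bound2[OF X_nilpotent[OF a]] by metis
  show "finprod T (\<lambda>k. pt (D \<alpha> k (u + v)) (c ^ k * s)) {k. D \<alpha> k (u + v) \<noteq> 0} =
     finprod T (\<lambda>k. pt (D \<alpha> k u) (c ^ k * s)) {k. D \<alpha> k u \<noteq> 0} \<otimes>\<^bsub>T\<^esub>
     finprod T (\<lambda>k. pt (D \<alpha> k v) (c ^ k * s)) {k. D \<alpha> k v \<noteq> 0}"
    using uv n by (subst (1 2 3) exp_ad_terms[where n = n])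
      (auto simp: M_add ad_divpow_add Z.pt_add_left D_M intro!: Z.T.finprod_multf)
next
  fix v s s' assume v: "v \<in> M"
  obtain n where n: "\<And>k. k \<ge> n \<Longrightarrow> D \<alpha> k v = 0" using ad_divpow_bound[OF X_nilpotent[OF a]] by metis
  show "finprod T (\<lambda>k. pt (D \<alpha> k v) (c ^ k * (s + s'))) {k. D \<alpha> k v \<noteq> 0} =
     finprod T (\<lambda>k. pt (D \<alpha> k v) (c ^ k * s)) {k. D \<alpha> k v \<noteq> 0} \<otimes>\<^bsub>T\<^esub>
     finprod T (\<lambda>k. pt (D \<alpha> k v) (c ^ k * s')) {k. D \<alpha> k v \<noteq> 0}"
    using v n by (subst (1 2 3) exp_ad_terms[where n = n])
      (auto simp: Z.pt_add_right D_M distrib_left intro!: Z.T.finprod_multf)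
qed

lemma E_hom: "E \<alpha> c \<in> hom T T" and E_ext: "E \<alpha> c \<in> extensional (carrier T)"
  unfolding exp_ad_def using Z.tensor_lift[OF biadditive_exp_ad] by auto

lemma E_closed: "u \<in> carrier T \<Longrightarrow> E \<alpha> c u \<in> carrier T"
  using hom_in_carrier[OF E_hom] .

lemma E_pt:
  assumes "v \<in> M" "\<And>k. k \<ge> n \<Longrightarrow> D \<alpha> k v = 0"
  shows "E \<alpha> c (pt v s) = finprod T (\<lambda>k. pt (D \<alpha> k v) (c ^ k * s)) {..<n}"
  unfolding exp_ad_def Z.tensor_lift(3)[OF biadditive_exp_ad assms(1)] by (rule exp_ad_terms[OF assms])

lemma E_finprod: "(\<And>i. i \<in> I \<Longrightarrow> f i \<in> carrier T) \<Longrightarrow> E \<alpha> c (finprod T f I) = finprod T (\<lambda>i. E \<alpha> c (f i)) I"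
  by (rule hom_finprod[OF Z.T.comm_group_axioms Z.T.comm_group_axioms E_hom])

text \<open>The binomial coefficients come from composing divided powers over the integers, so the
  binomial theorem for (- c + c)^k applies in every characteristic, without dividing by
  factorials.\<close>

lemma E_inverse_pt:
  assumes v: "v \<in> M" shows "E \<alpha> c (E \<alpha> (- c) (pt v s)) = pt v s"
proof -
  obtain n where n: "\<And>k. k \<ge> n \<Longrightarrow> D \<alpha> k v = 0" "n > 0"
    using ad_divpow_bound[OF X_nilpotent[OF a]] by (metis le_Suc_eq less_Suc_eq_0_disj less_imp_le nat_le_linear not_less_eq_eq)
  let ?f = "\<lambda>j i. pt (D \<alpha> i (D \<alpha> j v)) (c ^ i * ((- c) ^ j * s))"
  have z: "D \<alpha> i (D \<alpha> j v) = 0" if "i \<ge> n \<or> j \<ge> n" for i j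
    using n(1)[of "i + j"] that by (auto simp: ad_divpow_comp)
  have "E \<alpha> c (E \<alpha> (- c) (pt v s)) = finprod T (\<lambda>j. E \<alpha> c (pt (D \<alpha> j v) ((- c) ^ j * s))) {..<n}"
    using v n(1) by (simp add: E_pt[OF v, of n] E_finprod D_M)
  also have "\<dots> = finprod T (\<lambda>j. finprod T (?f j) {..<n}) {..<n}"
  proof (rule Z.T.finprod_cong')
    fix j show "E \<alpha> c (pt (D \<alpha> j v) ((- c) ^ j * s)) = finprod T (?f j) {..<n}"
      by (rule E_pt[OF D_M[OF v]]) (use z in simp)
  qed (auto simp: D_M v)
  also have "\<dots> = finprod T (\<lambda>k. finprod T (\<lambda>j. ?f j (k - j)) {..k}) {..<2*n}"
    using v z by (intro Z.T.finprod_triangle[symmetric]) (auto simp: D_M)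
  also have "\<dots> = finprod T (\<lambda>k. if 0 = k then pt v s else \<one>\<^bsub>T\<^esub>) {..<2*n}"
  proof (rule Z.T.finprod_cong')
    fix k
    have "finprod T (\<lambda>j. ?f j (k - j)) {..k} =
        finprod T (\<lambda>j. pt (D \<alpha> k v) (of_nat (k choose j) * (- c) ^ j * c ^ (k - j) * s)) {..k}"
    proof (rule Z.T.finprod_cong')
      fix j assume "j \<in> {..k}"
      then have "j \<le> k" by simp
      then have "pt (D \<alpha> (k - j) (D \<alpha> j v)) r = pt (D \<alpha> k v) (of_nat (k choose j) * r)" for r
        using v binomial_symmetric[of j k] by (simp add: ad_divpow_comp pt_scale_nat D_M)
      then show "?f j (k - j) = pt (D \<alpha> k v) (of_nat (k choose j) * (- c) ^ j * c ^ (k - j) * s)"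
        by (simp add: mult_ac)
    qed (auto simp: v D_M)
    also have "\<dots> = pt (D \<alpha> k v) ((\<Sum>j\<le>k. of_nat (k choose j) * (- c) ^ j * c ^ (k - j)) * s)"
      by (simp add: Z.pt_sum_right[symmetric] D_M v sum_distrib_right)
    also have "(\<Sum>j\<le>k. of_nat (k choose j) * (- c) ^ j * c ^ (k - j)) = (- c + c) ^ k"
      by (rule binomial_ring[symmetric])
    finally show "finprod T (\<lambda>j. ?f j (k - j)) {..k} = (if 0 = k then pt v s else \<one>\<^bsub>T\<^esub>)"
      by (auto simp: power_0_left D_M v)
  qed (auto simp: v)
  also have "\<dots> = pt v s"
    using n(2) v by (intro Z.T.finprod_singleton[of 0 "{..<2*n}" "\<lambda>_. pt v s"]) auto
  finally show ?thesis .
qed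

lemma E_inverse: "u \<in> carrier T \<Longrightarrow> E \<alpha> c (E \<alpha> (- c) u) = u"
  using Z.hom_ext[OF Z.T.is_group hom_compose[OF E_hom E_hom], of "\<lambda>u. u" c "- c" u]
  by (simp add: E_inverse_pt hom_def)

lemma E_Bij: "E \<alpha> c \<in> Bij (carrier T)"
proof -
  have "bij_betw (E \<alpha> c) (carrier T) (carrier T)"
    by (rule bij_betw_byWitness[where f' = "E \<alpha> (- c)"])
      (use E_inverse[of _ c] E_inverse[of _ "- c"] E_closed in auto)
  then show ?thesis using E_ext by (simp add: Bij_def)
qed

text \<open>The argument of \<open>Exp_lie\<close> with scalars: the Leibniz rule expands the left
  side, and \<open>finprod_triangle\<close> regroups it as a Cauchy product.\<close>

lemma E_lie:
  assumes u: "u \<in> M" and v: "v \<in> M" and br: "Z.bracket lie"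
  shows "E \<alpha> c (pt (lie u v) (s * t')) = tensor_lie lie (core_Z X) (E \<alpha> c (pt u s)) (E \<alpha> c (pt v t'))"
proof -
  obtain n where n: "\<And>k. k \<ge> n \<Longrightarrow> D \<alpha> k u = 0" "\<And>k. k \<ge> n \<Longrightarrow> D \<alpha> k v = 0"
    using ad_divpow_bound2[OF X_nilpotent[OF a]] by metis
  let ?f = "\<lambda>i j. pt (lie (D \<alpha> i u) (D \<alpha> j v)) (c ^ i * s * (c ^ j * t'))"
  have lM: "lie (D \<alpha> i u) (D \<alpha> j v) \<in> M" for i j using u v by (intro M_lie D_M)
  have Eu: "E \<alpha> c (pt u r) = finprod T (\<lambda>k. pt (D \<alpha> k u) (c ^ k * r)) {..<n}" for r
    by (rule E_pt[OF u]) (rule n)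
  have Ev: "E \<alpha> c (pt v r) = finprod T (\<lambda>k. pt (D \<alpha> k v) (c ^ k * r)) {..<n}" for r
    by (rule E_pt[OF v]) (rule n)
  have big: "D \<alpha> k (lie u v) = 0" if "k \<ge> 2 * n" for k
    using ad_divpow_lie_zero[of n "X \<alpha>" u v k] n that by blast
  have "E \<alpha> c (pt (lie u v) (s * t')) = finprod T (\<lambda>k. finprod T (\<lambda>i. ?f i (k - i)) {..k}) {..<2*n}"
  proof (subst E_pt[OF M_lie[OF u v] big]; (rule Z.T.finprod_cong')?)
    fix k
    have "pt (D \<alpha> k (lie u v)) (c ^ k * (s * t')) =
      finprod T (\<lambda>i. pt (lie (D \<alpha> i u) (D \<alpha> (k - i) v)) (c ^ k * (s * t'))) {..k}"
      unfolding ad_divpow_lie by (rule Z.pt_sum_left[OF lM])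
    also have "\<dots> = finprod T (\<lambda>i. ?f i (k - i)) {..k}"
    proof (rule Z.T.finprod_cong')
      fix i assume "i \<in> {..k}"
      then have "c ^ k = c ^ i * c ^ (k - i)" by (simp add: power_add[symmetric])
      then have "c ^ k * (s * t') = c ^ i * s * (c ^ (k - i) * t')" by (simp add: mult_ac)
      then show "pt (lie (D \<alpha> i u) (D \<alpha> (k - i) v)) (c ^ k * (s * t')) = ?f i (k - i)" by (simp only:)
    qed (auto simp: lM)
    finally show "pt (D \<alpha> k (lie u v)) (c ^ k * (s * t')) = finprod T (\<lambda>i. ?f i (k - i)) {..k}" .
  qed (auto simp: lM)
  also have "\<dots> = finprod T (\<lambda>i. finprod T (?f i) {..<n}) {..<n}"
    using n lM by (intro Z.T.finprod_triangle) auto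
  also have "\<dots> = finprod T (\<lambda>i. tensor_lie lie (core_Z X) (pt (D \<alpha> i u) (c ^ i * s)) (E \<alpha> c (pt v t'))) {..<n}"
  proof (rule Z.T.finprod_cong')
    fix i
    have "tensor_lie lie (core_Z X) (pt (D \<alpha> i u) (c ^ i * s)) (E \<alpha> c (pt v t')) =
      finprod T (\<lambda>j. tensor_lie lie (core_Z X) (pt (D \<alpha> i u) (c ^ i * s)) (pt (D \<alpha> j v) (c ^ j * t'))) {..<n}"
      unfolding Ev using u v
      by (intro hom_finprod[OF Z.T.comm_group_axioms Z.T.comm_group_axioms Z.tensor_lie_hom_right[OF br]])
        (auto simp: D_M)
    then show "finprod T (?f i) {..<n} = tensor_lie lie (core_Z X) (pt (D \<alpha> i u) (c ^ i * s)) (E \<alpha> c (pt v t'))"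
      using u v by (simp add: Z.tensor_lie_pt[OF br] D_M)
  qed (auto simp: u v D_M intro!: Z.tensor_lie_closed[OF br] E_closed)
  also have "\<dots> = tensor_lie lie (core_Z X) (E \<alpha> c (pt u s)) (E \<alpha> c (pt v t'))"
    unfolding Eu using u v
    by (intro hom_finprod[OF Z.T.comm_group_axioms Z.T.comm_group_axioms Z.tensor_lie_hom_left[OF br, OF E_closed[OF Z.pt_closed[OF v]]], symmetric])
      (auto simp: D_M)
  finally show ?thesis .
qed

lemma E_scale:
  assumes v: "v \<in> M" shows "E \<alpha> c (pt v (s * t')) = tensor_scale (core_Z X) s (E \<alpha> c (pt v t'))"
proof -
  obtain n where n: "\<And>k. k \<ge> n \<Longrightarrow> D \<alpha> k v = 0" using ad_divpow_bound[OF X_nilpotent[OF a]] by metis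
  have E: "E \<alpha> c (pt v r) = finprod T (\<lambda>k. pt (D \<alpha> k v) (c ^ k * r)) {..<n}" for r
    by (rule E_pt[OF v]) (rule n)
  have "tensor_scale (core_Z X) s (E \<alpha> c (pt v t')) = finprod T (\<lambda>k. tensor_scale (core_Z X) s (pt (D \<alpha> k v) (c ^ k * t'))) {..<n}"
    unfolding E using v
    by (intro hom_finprod[OF Z.T.comm_group_axioms Z.T.comm_group_axioms Z.tensor_scale_hom]) (auto simp: D_M)
  also have "\<dots> = E \<alpha> c (pt v (s * t'))"
    unfolding E using v by (intro Z.T.finprod_cong') (auto simp: Z.tensor_scale_pt D_M mult_ac)
  finally show ?thesis by simp
qed

end

lemma bracket_lie: "Z.bracket lie"
  by (auto simp: Z.bracket_def M_lie lie_add_left lie_add_right)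

abbreviation Aut :: "(('g \<times> 'k \<Rightarrow>\<^sub>0 int) set \<Rightarrow> ('g \<times> 'k \<Rightarrow>\<^sub>0 int) set) monoid" where
  "Aut \<equiv> tensor_Aut lie (core_Z X)"

sublocale Aut: group Aut
  by (rule Z.tensor_Aut_group[OF bracket_lie])

lemma E_Aut: "\<alpha> \<in> Rx \<Longrightarrow> E \<alpha> c \<in> carrier Aut"
  by (rule Z.tensor_AutI[OF bracket_lie E_hom E_Bij E_scale E_lie]) (auto simp: bracket_lie)

lemma Aut_mult: "f \<in> carrier Aut \<Longrightarrow> g \<in> carrier Aut \<Longrightarrow> f \<otimes>\<^bsub>Aut\<^esub> g = compose (carrier T) f g"
  by (simp add: tensor_Aut_def BijGroup_def)

lemma Aut_hom: "f \<in> carrier Aut \<Longrightarrow> f \<in> hom T T"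
  by (simp add: tensor_Aut_def)

lemma Aut_eqI:
  assumes "f \<in> carrier Aut" "g \<in> carrier Aut" "\<And>v s. v \<in> M \<Longrightarrow> f (pt v s) = g (pt v s)" shows "f = g"
proof (rule extensionalityI[of _ "carrier T"])
  show "f \<in> extensional (carrier T)" "g \<in> extensional (carrier T)"
    using assms(1,2) by (auto simp: tensor_Aut_def Bij_def)
  show "f u = g u" if "u \<in> carrier T" for u
    by (rule Z.hom_ext[OF Z.T.is_group Aut_hom[OF assms(1)] Aut_hom[OF assms(2)] assms(3) that])
qed


subsection \<open>Root subgroups\<close>

context
  fixes \<gamma> assumes g: "\<gamma> \<in> Rx"
begin

lemma D_minus_term: "ad_divpow (- X (- \<gamma>)) k v = scale (of_int ((- 1) ^ k)) (D (- \<gamma>) k v)"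
  using ad_divpow_scale_left[of "- 1" "X (- \<gamma>)" k v] by simp

lemma Exp_M: assumes v: "v \<in> M" shows "Exp (X \<gamma>) v \<in> M" "Exp (- X (- \<gamma>)) v \<in> M"
proof -
  show "Exp (X \<gamma>) v \<in> M" unfolding Exp_def by (rule Z.module_sum) (rule ad_divpow_M[OF g v])
  show "Exp (- X (- \<gamma>)) v \<in> M" unfolding Exp_def
    by (rule Z.module_sum) (simp only: D_minus_term M_scale ad_divpow_M[OF Rx_minus[OF g] v])
qed

lemma weyl_M: "v \<in> M \<Longrightarrow> weyl \<gamma> v \<in> M"
  unfolding weyl_def by (intro Exp_M)

text \<open>At parameter 1 the exponential over \<open>K\<close> is the complex \<open>Exp\<close>
  acting on the first tensor factor. In this way identities for \<open>weyl\<close> pass from the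
  complex algebra to \<open>K\<close>.\<close>

lemma E_one:
  assumes v: "v \<in> M" shows "E \<gamma> 1 (pt v s) = pt (Exp (X \<gamma>) v) s"
proof -
  obtain n where n: "\<And>k. k \<ge> n \<Longrightarrow> D \<gamma> k v = 0" using ad_divpow_bound[OF X_nilpotent[OF g]] by metis
  have e: "Exp (X \<gamma>) v = (\<Sum>k<n. D \<gamma> k v)" by (rule Exp_eq_sum) (rule n)
  have "pt (Exp (X \<gamma>) v) s = finprod T (\<lambda>k. pt (D \<gamma> k v) s) {..<n}"
    unfolding e by (rule Z.pt_sum_left) (rule D_M[OF g v])
  moreover have "E \<gamma> 1 (pt v s) = finprod T (\<lambda>k. pt (D \<gamma> k v) (1 ^ k * s)) {..<n}"
    by (rule E_pt[OF g v]) (rule n)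
  ultimately show ?thesis by simp
qed

lemma E_minus_one:
  assumes v: "v \<in> M" shows "E (- \<gamma>) (- 1) (pt v s) = pt (Exp (- X (- \<gamma>)) v) s"
proof -
  have g': "- \<gamma> \<in> Rx" by (rule Rx_minus[OF g])
  obtain n where n: "\<And>k. k \<ge> n \<Longrightarrow> D (- \<gamma>) k v = 0" using ad_divpow_bound[OF X_nilpotent[OF g']] by metis
  have e: "Exp (- X (- \<gamma>)) v = (\<Sum>k<n. scale (of_int ((- 1) ^ k)) (D (- \<gamma>) k v))"
    unfolding D_minus_term[symmetric] by (rule Exp_eq_sum) (simp add: D_minus_term n)
  have "pt (Exp (- X (- \<gamma>)) v) s = finprod T (\<lambda>k. pt (scale (of_int ((- 1) ^ k)) (D (- \<gamma>) k v)) s) {..<n}"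
    unfolding e by (rule Z.pt_sum_left) (intro M_scale D_M[OF g' v])
  also have "\<dots> = finprod T (\<lambda>k. pt (D (- \<gamma>) k v) ((- 1) ^ k * s)) {..<n}"
    by (simp only: pt_scale[OF D_M[OF g' v]]) simp
  also have "\<dots> = E (- \<gamma>) (- 1) (pt v s)"
    by (rule E_pt[OF g' v, symmetric]) (rule n)
  finally show ?thesis by simp
qed

definition W :: "('g \<times> 'k \<Rightarrow>\<^sub>0 int) set \<Rightarrow> ('g \<times> 'k \<Rightarrow>\<^sub>0 int) set" where
  "W = E \<gamma> 1 \<otimes>\<^bsub>Aut\<^esub> (E (- \<gamma>) (- 1) \<otimes>\<^bsub>Aut\<^esub> E \<gamma> 1)"

lemma W_Aut: "W \<in> carrier Aut"
  unfolding W_def by (intro Aut.m_closed E_Aut g Rx_minus)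

lemma W_pt: "v \<in> M \<Longrightarrow> W (pt v s) = pt (weyl \<gamma> v) s"
proof -
  assume v: "v \<in> M"
  note A = E_Aut[OF g] E_Aut[OF Rx_minus[OF g]]
  have "W (pt v s) = E \<gamma> 1 (E (- \<gamma>) (- 1) (E \<gamma> 1 (pt v s)))"
    unfolding W_def unfolding Aut_mult[OF A(1) Aut.m_closed[OF A(2,1)]] unfolding Aut_mult[OF A(2,1)]
    using v by (simp add: compose_eq)
  then show ?thesis using v by (simp add: E_one E_minus_one Exp_M weyl_def)
qed

text \<open>As \<open>weyl \<gamma>\<close> maps \<open>X \<beta>\<close> to \<open>s\<close> times
  a root vector, it multiplies the k-th divided power by \<open>s ^ k\<close>, which the parameter
  absorbs as \<open>(of_int s * c) ^ k\<close>.\<close>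

lemma W_conj:
  assumes b: "\<beta> \<in> Rx"
  obtains s :: int where "s = 1 \<or> s = - 1" "\<And>c. W \<otimes>\<^bsub>Aut\<^esub> E \<beta> c = E (refl \<gamma> \<beta>) (of_int s * c) \<otimes>\<^bsub>Aut\<^esub> W"
proof -
  let ?b = "refl \<gamma> \<beta>"
  obtain s :: int where s: "s = 1 \<or> s = - 1" "weyl \<gamma> (X \<beta>) = scale (of_int s) (X ?b)"
    by (rule weyl_X[OF g b])
  have b': "?b \<in> Rx" by (rule refl_Rx[OF g b])
  have D: "weyl \<gamma> (D \<beta> k v) = scale (of_int (s ^ k)) (D ?b k (weyl \<gamma> v))" for k v
    using ad_divpow_hom[of "weyl \<gamma>" "X \<beta>" k v, OF weyl_add[OF g] weyl_scale[OF g] weyl_lie[OF g]]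
    by (simp add: s(2) ad_divpow_scale_left)
  have "W \<otimes>\<^bsub>Aut\<^esub> E \<beta> c = E ?b (of_int s * c) \<otimes>\<^bsub>Aut\<^esub> W" for c
  proof (rule Aut_eqI)
    show "W \<otimes>\<^bsub>Aut\<^esub> E \<beta> c \<in> carrier Aut" "E ?b (of_int s * c) \<otimes>\<^bsub>Aut\<^esub> W \<in> carrier Aut"
      by (intro Aut.m_closed W_Aut E_Aut b b')+
    fix v and r :: 'k assume v: "v \<in> M"
    obtain n1 where n1: "\<And>k. k \<ge> n1 \<Longrightarrow> D \<beta> k v = 0" using ad_divpow_bound[OF X_nilpotent[OF b]] by metis
    obtain n2 where n2: "\<And>k. k \<ge> n2 \<Longrightarrow> D ?b k (weyl \<gamma> v) = 0" using ad_divpow_bound[OF X_nilpotent[OF b']] by metis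
    define n where "n = max n1 n2"
    have "(W \<otimes>\<^bsub>Aut\<^esub> E \<beta> c) (pt v r) = W (E \<beta> c (pt v r))"
      using v by (simp add: Aut_mult[OF W_Aut E_Aut[OF b]] compose_eq)
    also have "E \<beta> c (pt v r) = finprod T (\<lambda>k. pt (D \<beta> k v) (c ^ k * r)) {..<n}"
      by (rule E_pt[OF b v]) (use n1 in \<open>simp add: n_def\<close>)
    also have "W \<dots> = finprod T (\<lambda>k. W (pt (D \<beta> k v) (c ^ k * r))) {..<n}"
      by (rule hom_finprod[OF Z.T.comm_group_axioms Z.T.comm_group_axioms Aut_hom[OF W_Aut]])
        (simp add: D_M[OF b v])
    also have "\<dots> = finprod T (\<lambda>k. pt (D ?b k (weyl \<gamma> v)) ((of_int s * c) ^ k * r)) {..<n}"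
    proof (rule Z.T.finprod_cong')
      fix k
      show "W (pt (D \<beta> k v) (c ^ k * r)) = pt (D ?b k (weyl \<gamma> v)) ((of_int s * c) ^ k * r)"
        by (simp only: W_pt[OF D_M[OF b v]] D pt_scale[OF D_M[OF b' weyl_M[OF v]]])
          (simp add: power_mult_distrib mult_ac)
    qed (simp_all add: D_M[OF b' weyl_M[OF v]])
    also have "\<dots> = E ?b (of_int s * c) (pt (weyl \<gamma> v) r)"
      by (rule E_pt[OF b' weyl_M[OF v], symmetric]) (use n2 in \<open>simp add: n_def\<close>)
    also have "\<dots> = (E ?b (of_int s * c) \<otimes>\<^bsub>Aut\<^esub> W) (pt v r)"
      using v by (simp add: Aut_mult[OF E_Aut[OF b'] W_Aut] compose_eq W_pt)
    finally show "(W \<otimes>\<^bsub>Aut\<^esub> E \<beta> c) (pt v r) = (E ?b (of_int s * c) \<otimes>\<^bsub>Aut\<^esub> W) (pt v r)" .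
  qed
  then show thesis using that s(1) by blast
qed

end

text \<open>The subgroup contains \<open>W \<gamma>\<close>, a product of elements of the root
  subgroups of \<gamma> and - \<gamma>, and conjugation by it carries the root subgroup of \<beta>
  to that of the reflected root.\<close>

lemma subgroup_refl:
  assumes S: "subgroup S Aut" and g: "\<gamma> \<in> Rx" and b: "\<beta> \<in> Rx"
    and Sg: "\<And>c. E \<gamma> c \<in> S" "\<And>c. E (- \<gamma>) c \<in> S" and Sb: "\<And>c. E \<beta> c \<in> S"
  shows "E (refl \<gamma> \<beta>) c \<in> S"
proof -
  interpret S: subgroup S Aut by (rule S)
  obtain s :: int where s: "s = 1 \<or> s = - 1" "\<And>c. W \<gamma> \<otimes>\<^bsub>Aut\<^esub> E \<beta> c = E (refl \<gamma> \<beta>) (of_int s * c) \<otimes>\<^bsub>Aut\<^esub> W \<gamma>"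
    by (rule W_conj[OF g b]) blast
  have WS: "W \<gamma> \<in> S" unfolding W_def[OF g] by (intro S.m_closed Sg)
  have "E (refl \<gamma> \<beta>) (of_int s * c) = W \<gamma> \<otimes>\<^bsub>Aut\<^esub> E \<beta> c \<otimes>\<^bsub>Aut\<^esub> inv\<^bsub>Aut\<^esub> W \<gamma>" for c
    using W_Aut[OF g] E_Aut[OF refl_Rx[OF g b]] E_Aut[OF b] by (simp add: s(2) Aut.m_assoc)
  \<comment> \<open>Taking \<open>of_int s * c\<close> as the parameter undoes the sign.\<close>
  then have "E (refl \<gamma> \<beta>) (of_int s * (of_int s * c)) \<in> S" using WS Sb by simp
  moreover have "of_int s * (of_int s * c) = c" using s(1) by auto
  ultimately show ?thesis by simp
qed

text \<open>The coefficient of \<open>X \<alpha>\<close> in \<open>exp (X \<alpha>) (X (- \<alpha>))\<close> is \<open>- 1\<close>; in \<open>exp (X \<beta>) (X (- \<alpha>))\<close> it is 0.\<close>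
lemma E_inj: "inj_on (\<lambda>\<alpha>. E \<alpha> 1) Rx"
proof (rule inj_onI, rule ccontr)
  fix \<alpha> \<beta> assume a: "\<alpha> \<in> Rx" and b: "\<beta> \<in> Rx" and eq: "E \<alpha> 1 = E \<beta> 1" and ne: "\<alpha> \<noteq> \<beta>"
  let ?A = "\<lparr>carrier = UNIV, monoid.mult = (+), one = 0\<rparr> :: 'k monoid"
  have A: "comm_group ?A"
    by (rule comm_groupI) (auto simp: add_ac intro: exI[of _ "- _"] left_minus)
  \<comment> \<open>The functional \<open>coef \<alpha>\<close>, extended by scalars to an additive
    map from the tensor product to \<open>K\<close>.\<close>
  have "biadditive M ?A (\<lambda>v c. of_int (coef \<alpha> v) * c)"
    by (rule biadditiveI) (auto simp: coef_add[OF a] distrib_left distrib_right)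
  then obtain h where h: "h \<in> hom T ?A" "\<And>v c. v \<in> M \<Longrightarrow> h (pt v c) = of_int (coef \<alpha> v) * c"
    using Z.lift_hom[OF A] by metis
  have sum: "finprod ?A f I = sum f I" if "finite I" for f and I :: "nat set"
  proof -
    interpret A: comm_group ?A by (rule A)
    show ?thesis using that by (induction I) (auto simp: Pi_def)
  qed
  have v: "X (- \<alpha>) \<in> M" by (rule X_M[OF Rx_minus[OF a]])
  have val: "\<exists>n. \<forall>m\<ge>n. h (E \<gamma> 1 (pt (X (- \<alpha>)) 1)) = (\<Sum>k<m. of_int (coef \<alpha> (D \<gamma> k (X (- \<alpha>)))))"
    if g: "\<gamma> \<in> Rx" for \<gamma>
  proof -
    obtain n where n: "\<And>k. k \<ge> n \<Longrightarrow> D \<gamma> k (X (- \<alpha>)) = 0" using ad_divpow_bound[OF X_nilpotent[OF g]] by metis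
    have "h (E \<gamma> 1 (pt (X (- \<alpha>)) 1)) = (\<Sum>k<m. of_int (coef \<alpha> (D \<gamma> k (X (- \<alpha>)))))" if "m \<ge> n" for m
    proof -
      have "E \<gamma> 1 (pt (X (- \<alpha>)) 1) = finprod T (\<lambda>k. pt (D \<gamma> k (X (- \<alpha>))) (1 ^ k * 1)) {..<m}"
        by (rule E_pt[OF g v]) (use n that in simp)
      moreover have "h (finprod T (\<lambda>k. pt (D \<gamma> k (X (- \<alpha>))) (1 ^ k * 1)) {..<m}) =
          finprod ?A (\<lambda>k. h (pt (D \<gamma> k (X (- \<alpha>))) (1 ^ k * 1))) {..<m}"
        by (rule hom_finprod[OF Z.T.comm_group_axioms A h(1)]) (simp add: D_M[OF g v])
      ultimately have "h (E \<gamma> 1 (pt (X (- \<alpha>)) 1)) = finprod ?A (\<lambda>k. h (pt (D \<gamma> k (X (- \<alpha>))) (1 ^ k * 1))) {..<m}"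
        by (simp only:)
      then show ?thesis by (simp only: sum finite_lessThan h(2) D_M[OF g v]) simp
    qed
    then show ?thesis by blast
  qed
  have root: "D \<gamma> k (X (- \<alpha>)) \<in> root_space (shift (- \<alpha>) \<gamma> (int k))" if "\<gamma> \<in> Rx" for \<gamma> k
    unfolding ad_divpow_def using ad_X_root_space[OF that X_root_minus[OF a]] root_space_scale by blast
  have other: "coef \<alpha> (D \<gamma> k (X (- \<alpha>))) = 0" if "\<gamma> \<in> Rx" "shift (- \<alpha>) \<gamma> (int k) \<noteq> \<alpha>" for \<gamma> k
    by (rule coef_other[OF a _ root[OF that(1)] that(2)]) (intro shift_V V_minus Rx_V a that(1))
  have a2: "shift (- \<alpha>) \<alpha> (int k) \<noteq> \<alpha>" if "k \<noteq> 2" for k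
  proof
    assume *: "shift (- \<alpha>) \<alpha> (int k) = \<alpha>"
    have "(shift (- \<alpha>) \<alpha> (int k)) (coroot \<alpha>) = 2" unfolding * by (rule coroot_self[OF a])
    then have "of_nat k * (2 :: complex) = 4" by (simp add: shift_def coroot_self[OF a])
    then have "of_nat k = (2 :: complex)" by simp
    then have "of_nat k = (of_nat 2 :: complex)" by simp
    then show False using that by (simp only: of_nat_eq_iff)
  qed
  \<comment> \<open>The equation - \<alpha> + k\<beta> = \<alpha> would make \<beta> equal to 2/k
    times \<alpha>; reducedness then forces 2/k = 1, that is \<beta> = \<alpha>.\<close>
  have b2: "shift (- \<alpha>) \<beta> (int k) \<noteq> \<alpha>" for k
  proof
    assume *: "shift (- \<alpha>) \<beta> (int k) = \<alpha>"
    show False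
    proof (cases "k = 0")
      case True
      then have "\<alpha> (coroot \<alpha>) = - \<alpha> (coroot \<alpha>)" using * by (metis of_nat_0 shift_simps(1) uminus_apply)
      then show False by (simp add: coroot_self[OF a])
    next
      case False
      have "of_nat k * \<beta> y = 2 * \<alpha> y" for y using fun_cong[OF *, of y] by (simp add: shift_def)
      then have "\<beta> y = complex_of_real (2 / real k) * \<alpha> y" for y using False by (simp add: field_simps)
      then have eqb: "\<beta> = (\<lambda>y. complex_of_real (2 / real k) * \<alpha> y)" by blast
      then have "\<beta> - (\<lambda>y. complex_of_real (2 / real k) * \<alpha> y) \<in> V0" using V0_zero by simp
      then have "2 / real k = 1 \<or> 2 / real k = - 1" by (rule reduced_multiple[OF a b])
      moreover have "2 / real k > 0" using False by simp
      ultimately have "2 / real k = 1" by linarith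
      then show False using eqb ne by simp
    qed
  qed
  obtain n1 where n1: "\<forall>m\<ge>n1. h (E \<alpha> 1 (pt (X (- \<alpha>)) 1)) = (\<Sum>k<m. of_int (coef \<alpha> (D \<alpha> k (X (- \<alpha>)))))"
    using val[OF a] by blast
  obtain n2 where n2: "\<forall>m\<ge>n2. h (E \<beta> 1 (pt (X (- \<alpha>)) 1)) = (\<Sum>k<m. of_int (coef \<alpha> (D \<beta> k (X (- \<alpha>)))))"
    using val[OF b] by blast
  \<comment> \<open>The 3 keeps the index 2, the only contributing one, inside the range.\<close>
  define m where "m = max 3 (max n1 n2)"
  have "D \<alpha> 2 (X (- \<alpha>)) = - X \<alpha>"
    using opposite_string(2)[OF a Rx_minus[OF a]] weyl_X_self_minus[OF a] V0_zero by simp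
  moreover have "coef \<alpha> (- X \<alpha>) + coef \<alpha> (X \<alpha>) = coef \<alpha> 0"
    using coef_add[OF a M_minus[OF X_M[OF a]] X_M[OF a]] by simp
  ultimately have c2: "coef \<alpha> (D \<alpha> 2 (X (- \<alpha>))) = - 1" using coef_X[OF a] by (simp add: coef_def)
  have "h (E \<alpha> 1 (pt (X (- \<alpha>)) 1)) = (\<Sum>k<m. of_int (coef \<alpha> (D \<alpha> k (X (- \<alpha>)))))"
    using n1 by (simp add: m_def)
  also have "\<dots> = (\<Sum>k<m. if k = 2 then - 1 else 0)"
    by (rule sum.cong) (auto simp: c2 other[OF a a2])
  also have "\<dots> = - 1" by (simp add: m_def)
  finally have "h (E \<alpha> 1 (pt (X (- \<alpha>)) 1)) = - 1" .
  moreover have "h (E \<beta> 1 (pt (X (- \<alpha>)) 1)) = (\<Sum>k<m. of_int (coef \<alpha> (D \<beta> k (X (- \<alpha>)))))"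
    using n2 by (simp add: m_def)
  then have "h (E \<beta> 1 (pt (X (- \<alpha>)) 1)) = 0" by (simp add: other[OF b b2])
  ultimately show False using eq by simp
qed

end

section \<open>Generation by reflections\<close>

subsection \<open>Finitely generated abelian groups of functions are Noetherian\<close>

lemma int_span_finite_support:
  assumes "x \<in> int_fun.span T" shows "\<exists>D. finite D \<and> D \<subseteq> T \<and> x \<in> int_fun.span D"
proof -
  obtain D r where D: "finite D" "D \<subseteq> T" "x = (\<Sum>a\<in>D. (\<lambda>y. of_int (r a) * a y))"
    using assms unfolding int_fun.span_explicit by auto
  have "x \<in> int_fun.span D"
    unfolding D(3) by (rule int_fun.span_sum, rule int_fun.span_scale, rule int_fun.span_base)
  then show ?thesis using D by blast
qed

lemma int_span_finite_support_set:
  assumes "finite S" "S \<subseteq> int_fun.span T" shows "\<exists>D. finite D \<and> D \<subseteq> T \<and> S \<subseteq> int_fun.span D"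
  using assms
proof (induction S)
  case (insert x S)
  then obtain D D' where D: "finite D" "D \<subseteq> T" "S \<subseteq> int_fun.span D" "finite D'" "D' \<subseteq> T" "x \<in> int_fun.span D'"
    using int_span_finite_support[of x T] by auto
  then have "insert x S \<subseteq> int_fun.span (D \<union> D')"
    using int_fun.span_mono[of D "D \<union> D'"] int_fun.span_mono[of D' "D \<union> D'"] by auto
  then show ?case using D by (intro exI[of _ "D \<union> D'"]) auto
qed auto

text \<open>The generators are found inside \<open>T\<close> itself, which matters because
  \<open>T\<close> will consist of shifts that lead to roots. By induction on \<open>B\<close>: the
  coefficients at \<open>b\<close> of elements of the span of \<open>T\<close> form an ideal of the
  integers, and those with coefficient 0 are covered by the induction hypothesis.\<close>

lemma int_span_noetherian:
  fixes B T :: "('a \<Rightarrow> complex) set"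
  assumes "finite B" "T \<subseteq> int_fun.span B" shows "\<exists>D. finite D \<and> D \<subseteq> T \<and> T \<subseteq> int_fun.span D"
  using assms
proof (induction B arbitrary: T)
  case empty
  then have "T \<subseteq> {0}" by (simp add: int_fun.span_empty)
  then show ?case using int_fun.span_superset by (intro exI[of _ T]) (auto intro: finite_subset)
next
  case (insert b B)
  let ?s = "\<lambda>(n::int) (f::'a \<Rightarrow> complex). (\<lambda>y. of_int n * f y)"
  define L where "L = int_fun.span T"
  have L: "int_fun.subspace L" unfolding L_def by (rule int_fun.subspace_span)
  have LB: "L \<subseteq> int_fun.span (insert b B)"
    unfolding L_def by (rule int_fun.span_minimal[OF insert.prems int_fun.subspace_span])
  \<comment> \<open>\<open>c\<close> is a possible coefficient of \<open>x\<close> at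
    \<open>b\<close>; it need not be unique, as independence is not assumed.\<close>
  define P where "P c x \<longleftrightarrow> x \<in> L \<and> x - ?s c b \<in> int_fun.span B" for c x
  have P_lin: "P (c - n * d) (x - ?s n y)" if "P c x" "P d y" for c d n x y
  proof -
    have 1: "(x - ?s c b) - ?s n (y - ?s d b) \<in> int_fun.span B"
      using that unfolding P_def by (blast intro: int_fun.span_diff[OF _ int_fun.span_scale])
    have 2: "(x - ?s c b) - ?s n (y - ?s d b) = (x - ?s n y) - ?s (c - n * d) b"
      by (auto simp: fun_eq_iff algebra_simps)
    have 3: "x - ?s n y \<in> L"
      using that unfolding P_def by (blast intro: int_fun.subspace_diff[OF L _ int_fun.subspace_scale[OF L]])
    show ?thesis unfolding P_def using 3 1[unfolded 2] by blast
  qed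
  have P_ex: "\<exists>c. P c x" if "x \<in> L" for x
    using LB that int_fun.span_breakdown_eq[of x b B] by (auto simp: P_def)
  have IH: "\<exists>D. finite D \<and> D \<subseteq> L \<inter> int_fun.span B \<and> L \<inter> int_fun.span B \<subseteq> int_fun.span D"
    using insert.IH[of "L \<inter> int_fun.span B"] by auto
  then obtain D where D: "finite D" "D \<subseteq> L \<inter> int_fun.span B" "L \<inter> int_fun.span B \<subseteq> int_fun.span D" by blast
  have "\<exists>D'. finite D' \<and> D' \<subseteq> L \<and> L \<subseteq> int_fun.span D'"
  proof (cases "\<exists>c x. c \<noteq> 0 \<and> P c x")
    case True
    then obtain c x where c: "c \<noteq> 0" "P c x" by blast
    have "P 0 0" using L by (simp add: P_def int_fun.subspace_0 int_fun.span_zero zero_fun_def[symmetric])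
    then have "P (- c) (0 - ?s 1 x)" using P_lin[of 0 0 c x 1] c by simp
    then have "\<exists>n::nat. n > 0 \<and> (\<exists>x. P (int n) x)"
      using c by (cases "c > 0") (force intro: exI[of _ "nat c"], force intro: exI[of _ "nat (- c)"])
    \<comment> \<open>The least positive coefficient generates the ideal: division by
      \<open>d\<close> leaves a remainder that minimality forces to be 0.\<close>
    then obtain d where d: "d > 0" "\<exists>x. P (int d) x" "\<And>n. 0 < n \<and> (\<exists>x. P (int n) x) \<Longrightarrow> d \<le> n"
      using LeastI_ex[of "\<lambda>n. n > 0 \<and> (\<exists>x. P (int n) x)"] Least_le[of "\<lambda>n. n > 0 \<and> (\<exists>x. P (int n) x)"] by blast
    obtain y where y: "P (int d) y" using d(2) by blast
    have "L \<subseteq> int_fun.span (insert y D)"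
    proof
      fix x assume x: "x \<in> L"
      then obtain c where c: "P c x" using P_ex by blast
      define r where "r = c mod int d"
      have r: "P r (x - ?s (c div int d) y)"
        using P_lin[OF c y, of "c div int d"] by (simp add: r_def minus_div_mult_eq_mod)
      have "r = 0"
      proof (rule ccontr)
        assume "r \<noteq> 0"
        moreover have "0 \<le> r" "r < int d" using d(1) by (auto simp: r_def)
        ultimately have "0 < nat r" "P (int (nat r)) (x - ?s (c div int d) y)" "nat r < d" using r by auto
        then show False using d(3)[of "nat r"] by (meson not_le)
      qed
      then have "x - ?s (c div int d) y \<in> L \<inter> int_fun.span B"
        using r by (simp add: P_def zero_fun_def[symmetric])
      then have "x - ?s (c div int d) y \<in> int_fun.span (insert y D)"
        using D(3) int_fun.span_mono[of D "insert y D"] by blast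
      moreover have "?s (c div int d) y \<in> int_fun.span (insert y D)"
        by (intro int_fun.span_scale int_fun.span_base) simp
      ultimately show "x \<in> int_fun.span (insert y D)" using int_fun.span_add by fastforce
    qed
    then show ?thesis using D y by (intro exI[of _ "insert y D"]) (auto simp: P_def)
  next
    case False
    have "L \<subseteq> int_fun.span B"
    proof
      fix x assume "x \<in> L"
      then have "P 0 x" using P_ex False by metis
      then show "x \<in> int_fun.span B" by (simp add: P_def zero_fun_def[symmetric])
    qed
    then show ?thesis using D by (intro exI[of _ D]) auto
  qed
  then obtain D' where D': "finite D'" "D' \<subseteq> L" "L \<subseteq> int_fun.span D'" by blast
  \<comment> \<open>The generators of the span are traded for the finitely many elements of
    \<open>T\<close> needed to express them.\<close>
  obtain D'' where D'': "finite D''" "D'' \<subseteq> T" "D' \<subseteq> int_fun.span D''"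
    using int_span_finite_support_set[of D' T] D' by (auto simp: L_def)
  have "T \<subseteq> L" unfolding L_def by (rule int_fun.span_superset)
  also have "L \<subseteq> int_fun.span D''"
    using D'(3) int_fun.span_minimal[OF D''(3) int_fun.subspace_span] by blast
  finally show ?case using D'' by blast
qed

context eala_chevalley
begin

subsection \<open>The root system is infinite\<close>

lemma refl_refl: "\<gamma> \<in> Rx \<Longrightarrow> \<beta> \<in> R \<Longrightarrow> refl \<gamma> (refl \<gamma> \<beta>) = \<beta>"
  by (simp add: refl_shift cartan_shift Rx_R cartan_self)

lemma refl_dform2:
  assumes g: "\<gamma> \<in> Rx" and a: "\<alpha> \<in> R" and b: "\<beta> \<in> R"
  shows "dform (refl \<gamma> \<beta>) (refl \<gamma> \<alpha>) = dform \<beta> \<alpha>"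
proof -
  let ?n = "of_int (cartan \<beta> \<gamma>) :: complex" and ?m = "of_int (cartan \<alpha> \<gamma>) :: complex"
  have e: "dform (refl \<gamma> \<beta>) (refl \<gamma> \<alpha>) =
      dform \<beta> \<alpha> - ?m * dform \<beta> \<gamma> - ?n * dform \<alpha> \<gamma> + ?n * ?m * dform \<gamma> \<gamma>"
    using dform_sym[of \<gamma> \<alpha>] by (simp add: refl_shift dform_shift shift_V R_V Rx_V assms algebra_simps)
  have "2 * dform (refl \<gamma> \<beta>) (refl \<gamma> \<alpha>) =
      2 * dform \<beta> \<alpha> - ?m * (2 * dform \<beta> \<gamma>) - ?n * (2 * dform \<alpha> \<gamma>) + 2 * (?n * ?m * dform \<gamma> \<gamma>)"
    unfolding e by (simp add: algebra_simps)
  also have "\<dots> = 2 * dform \<beta> \<alpha>"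
    unfolding cartan_dform[OF b g, symmetric] cartan_dform[OF a g, symmetric]
    by (simp add: algebra_simps)
  finally show ?thesis by simp
qed

lemma cartan_refl2:
  assumes g: "\<gamma> \<in> Rx" and a: "\<alpha> \<in> Rx" and b: "\<beta> \<in> R"
  shows "cartan (refl \<gamma> \<beta>) (refl \<gamma> \<alpha>) = cartan \<beta> \<alpha>"
proof (rule cartan_eqI)
  note r = refl_Rx[OF g a] refl_R[OF g b]
  show "refl \<gamma> \<beta> (coroot (refl \<gamma> \<alpha>)) = of_int (cartan \<beta> \<alpha>)"
    using coroot_eval[OF R_V[OF r(2)] Rx_V[OF r(1)]] coroot_eval[OF R_V[OF b] Rx_V[OF a]] cartan[OF b a]
      refl_dform2[OF g Rx_R[OF a] b] refl_dform2[OF g Rx_R[OF a] Rx_R[OF a]] by simp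
qed

lemma refl_eval: "\<gamma> \<in> Rx \<Longrightarrow> \<beta> \<in> R \<Longrightarrow> refl \<gamma> \<beta> y = \<beta> y - \<beta> (coroot \<gamma>) * \<gamma> y"
  by (simp add: refl_def cartan)

lemma refl_bij: "\<gamma> \<in> Rx \<Longrightarrow> bij_betw (refl \<gamma>) Rx Rx"
  by (rule bij_betw_byWitness[where f' = "refl \<gamma>"]) (auto simp: refl_refl refl_Rx Rx_R)

lemma refl_self: "\<gamma> \<in> Rx \<Longrightarrow> refl \<gamma> \<gamma> = - \<gamma>"
  by (simp add: refl_def cartan_self fun_eq_iff)

lemma zero_R0: "0 \<in> R0"
  using H_nontrivial A2_zero dual_zero by (auto simp: R0_def R_def)

text \<open>0 is an isotropic root, hence by \<open>A5_isotropic\<close> a difference of two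
  nonisotropic roots.\<close>

lemma Rx_nonempty: "Rx \<noteq> {}"
  using zero_R0 A5_isotropic by auto

text \<open>If \<open>Rx\<close> were finite, then the operator \<open>v \<mapsto> \<Sum>\<alpha>\<in>Rx. v(\<alpha>\<^sup>\<or>) \<alpha>\<close> would be a
  nonzero multiple of the identity of \<open>V\<close> by indecomposability; but it kills \<open>V0\<close>.\<close>
lemma infinite_Rx: "infinite Rx"
proof
  assume fin: "finite Rx"
  define P where "P v y = (\<Sum>\<alpha>\<in>Rx. v (coroot \<alpha>) * \<alpha> y)" for v :: "'g \<Rightarrow> complex" and y
  define m where "m \<beta> = (\<Sum>\<alpha>\<in>Rx. cartan \<beta> \<alpha> * cartan \<alpha> \<beta>)" for \<beta>
  have PR: "P \<beta> y = (\<Sum>\<alpha>\<in>Rx. of_int (cartan \<beta> \<alpha>) * \<alpha> y)" if "\<beta> \<in> R" for \<beta> y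
    unfolding P_def by (rule sum.cong) (auto simp: cartan that)
  \<comment> \<open>\<open>P\<close> commutes with reflections: the sum is reindexed by
    \<open>refl \<gamma>\<close>, which preserves Cartan integers.\<close>
  have reflP: "P (refl \<gamma> \<beta>) y = P \<beta> y - P \<beta> (coroot \<gamma>) * \<gamma> y" if "\<gamma> \<in> Rx" "\<beta> \<in> R" for \<gamma> \<beta> y
  proof -
    have "P (refl \<gamma> \<beta>) y = (\<Sum>\<alpha>\<in>Rx. of_int (cartan (refl \<gamma> \<beta>) (refl \<gamma> \<alpha>)) * refl \<gamma> \<alpha> y)"
      unfolding PR[OF refl_R[OF that]] by (rule sum.reindex_bij_betw[OF refl_bij[OF that(1)], symmetric])
    also have "\<dots> = (\<Sum>\<alpha>\<in>Rx. of_int (cartan \<beta> \<alpha>) * \<alpha> y - of_int (cartan \<beta> \<alpha>) * \<alpha> (coroot \<gamma>) * \<gamma> y)"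
    proof (rule sum.cong[OF HOL.refl])
      fix \<alpha> assume "\<alpha> \<in> Rx"
      then show "of_int (cartan (refl \<gamma> \<beta>) (refl \<gamma> \<alpha>)) * refl \<gamma> \<alpha> y =
          of_int (cartan \<beta> \<alpha>) * \<alpha> y - of_int (cartan \<beta> \<alpha>) * \<alpha> (coroot \<gamma>) * \<gamma> y"
        by (simp only: cartan_refl2[OF that(1) _ that(2)] refl_eval[OF that(1) Rx_R]) (simp add: algebra_simps)
    qed
    also have "\<dots> = P \<beta> y - P \<beta> (coroot \<gamma>) * \<gamma> y"
      by (simp add: sum_subtractf PR[OF that(2)] sum_distrib_right)
    finally show ?thesis .
  qed
  have Pm: "P \<beta> (coroot \<beta>) = of_int (m \<beta>)" if "\<beta> \<in> Rx" for \<beta>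
    unfolding m_def PR[OF Rx_R[OF that]] of_int_sum by (rule sum.cong) (auto simp: cartan that Rx_R)
  \<comment> \<open>Commuting with the reflection in \<beta> itself makes \<beta> an eigenvector:
    \<beta> goes to - \<beta>, so 2 \<open>P \<beta>\<close> equals
    \<open>P \<beta> (coroot \<beta>)\<close> times \<beta>.\<close>
  have eig: "2 * P \<beta> y = of_int (m \<beta>) * \<beta> y" if "\<beta> \<in> Rx" for \<beta> y
  proof -
    have "P (- \<beta>) y = - P \<beta> y" by (simp add: P_def sum_negf)
    then show ?thesis using reflP[OF that Rx_R[OF that], of y] by (simp add: refl_self that Pm)
  qed
  have m_pos: "m \<beta> > 0" if "\<beta> \<in> Rx" for \<beta>
  proof -
    have "0 < cartan \<beta> \<beta> * cartan \<beta> \<beta>" by (simp add: cartan_self that)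
    also have "\<dots> \<le> m \<beta>"
      unfolding m_def using cartan_product(1) that fin
      by (intro member_le_sum[of \<beta> Rx "\<lambda>\<alpha>. cartan \<beta> \<alpha> * cartan \<alpha> \<beta>"]) (auto simp: mult.commute)
    finally show ?thesis .
  qed
  have m_refl: "m (refl \<gamma> \<beta>) = m \<beta>" if "\<gamma> \<in> Rx" "\<beta> \<in> Rx" for \<gamma> \<beta>
  proof -
    have "m (refl \<gamma> \<beta>) = (\<Sum>\<alpha>\<in>Rx. cartan (refl \<gamma> \<beta>) (refl \<gamma> \<alpha>) * cartan (refl \<gamma> \<alpha>) (refl \<gamma> \<beta>))"
      unfolding m_def by (rule sum.reindex_bij_betw[OF refl_bij[OF that(1)], symmetric])
    then show ?thesis unfolding m_def by (simp add: cartan_refl2 that Rx_R)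
  qed
  \<comment> \<open>\<open>refl \<gamma> \<beta>\<close> has the eigenvalue of \<beta>, yet it
    involves \<gamma> with a nonzero coefficient; so the eigenvalues of \<beta> and \<gamma>
    agree.\<close>
  have m_eq: "m \<gamma> = m \<beta>" if "\<gamma> \<in> Rx" "\<beta> \<in> Rx" "dform \<gamma> \<beta> \<noteq> 0" for \<gamma> \<beta>
  proof -
    have c: "cartan \<beta> \<gamma> \<noteq> 0" using cartan_eq_zero[OF that(1,2)] that(3) by simp
    have "\<exists>y. \<gamma> y \<noteq> 0" using coroot_self[OF that(1)] by (intro exI[of _ "coroot \<gamma>"]) simp
    then obtain y where y: "\<gamma> y \<noteq> 0" by blast
    have "of_int (m \<beta>) * refl \<gamma> \<beta> y = 2 * P \<beta> y - of_int (cartan \<beta> \<gamma>) * (2 * P \<gamma> y)"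
    proof -
      have e: "P (refl \<gamma> \<beta>) y = P \<beta> y - of_int (cartan \<beta> \<gamma>) * P \<gamma> y"
        by (simp add: P_def refl_def sum_subtractf sum_distrib_left algebra_simps)
      have "of_int (m \<beta>) * refl \<gamma> \<beta> y = 2 * P (refl \<gamma> \<beta>) y"
        using eig[OF refl_Rx[OF that(1,2)], of y] m_refl[OF that(1,2)] by simp
      then show ?thesis unfolding e by (simp add: right_diff_distrib)
    qed
    then have "of_int (m \<beta>) * (of_int (cartan \<beta> \<gamma>) * \<gamma> y) = of_int (cartan \<beta> \<gamma>) * (of_int (m \<gamma>) * \<gamma> y)"
      unfolding eig[OF that(1)] eig[OF that(2)] by (simp add: refl_def right_diff_distrib)
    then have "(of_int (m \<beta>) :: complex) = of_int (m \<gamma>)" using c y by simp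
    then show ?thesis by simp
  qed
  obtain \<gamma> where g: "\<gamma> \<in> Rx" using Rx_nonempty by blast
  define A where "A = {\<beta> \<in> Rx. m \<beta> = m \<gamma>}"
  have "\<not> Rx - A \<noteq> {}"
  proof
    assume "Rx - A \<noteq> {}"
    moreover have "\<forall>\<alpha>\<in>A. \<forall>\<beta>\<in>Rx - A. dform \<alpha> \<beta> = 0" using m_eq unfolding A_def by fastforce
    moreover have "A \<noteq> {}" "A \<inter> (Rx - A) = {}" "A \<union> (Rx - A) = Rx" using g by (auto simp: A_def)
    ultimately have "\<exists>A B. A \<noteq> {} \<and> B \<noteq> {} \<and> A \<inter> B = {} \<and> A \<union> B = Rx \<and> (\<forall>\<alpha>\<in>A. \<forall>\<beta>\<in>B. dform \<alpha> \<beta> = 0)"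
      by (intro exI[of _ A] exI[of _ "Rx - A"] conjI)
    then show False by (rule notE[OF A5_indecomposable])
  qed
  then have all: "m \<beta> = m \<gamma>" if "\<beta> \<in> Rx" for \<beta> using that by (auto simp: A_def)
  let ?Q = "{v. \<forall>y. 2 * P v y = of_int (m \<gamma>) * v y}"
  have sub: "real_fun.subspace ?Q"
  proof -
    have "P 0 y = 0" "P (u + v) y = P u y + P v y" "P (\<lambda>x. k * v x) y = k * P v y" for u v k y
      by (simp_all add: P_def sum.distrib distrib_right sum_distrib_left mult.assoc)
    then show ?thesis
      unfolding real_fun.subspace_def by (auto simp: distrib_left mult.left_commute)
  qed
  have RxQ: "Rx \<subseteq> ?Q" using eig all by auto
  have "R \<subseteq> ?Q"
  proof
    fix \<alpha> assume a: "\<alpha> \<in> R"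
    show "\<alpha> \<in> ?Q"
    proof (cases "\<alpha> \<in> Rx")
      case False
      then have "\<alpha> \<in> R0" using a by (auto simp: Rx_def)
      then obtain \<beta> \<beta>' where "\<alpha> = \<beta> - \<beta>'" "\<beta> \<in> Rx" "\<beta>' \<in> Rx" using A5_isotropic by auto
      then show ?thesis using real_fun.subspace_diff[OF sub, of \<beta> \<beta>'] RxQ by blast
    qed (use RxQ in blast)
  qed
  then have VQ: "V \<subseteq> ?Q" unfolding V_def by (rule real_fun.span_minimal[OF _ sub])
  have "V0 \<subseteq> {0}"
  proof
    fix \<delta> assume d: "\<delta> \<in> V0"
    have "P \<delta> y = 0" for y
      unfolding P_def by (rule sum.neutral) (use d in \<open>auto simp: coroot_eval V0_V Rx_V V0_dform\<close>)
    then have "\<forall>y. \<delta> y = 0" using VQ V0_V[OF d] m_pos[OF g] by auto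
    then show "\<delta> \<in> {0}" by (auto simp: fun_eq_iff)
  qed
  then have "V0 \<subseteq> real_fun.span {}" by (simp add: real_fun.span_empty)
  then have "real_fun.dim V0 \<le> card {}" using real_fun.dim_le_card[of V0 "{}"] by simp
  then show False using nullity by (simp add: nullity_def)
qed

subsection \<open>Finitely many roots generate all the roots under reflections\<close>

lemma cartan_bound: "\<alpha> \<in> Rx \<Longrightarrow> \<beta> \<in> Rx \<Longrightarrow> cartan \<beta> \<alpha> \<in> {- 4..4}"
  using cartan_abs_le[of \<alpha> \<beta> 4] cartan_product(2)[of \<alpha> \<beta>] by (simp add: abs_le_iff)

lemma B_Rx: "finite B" "B \<subseteq> Rx"
proof -
  show fin: "finite B" using lifted_base by (simp add: lifted_base_def)
  have BR: "B \<subseteq> R" using lifted_base by (simp add: lifted_base_def)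
  have "\<pi> \<notin> V0" if p: "\<pi> \<in> B" for \<pi>
  proof
    assume v: "\<pi> \<in> V0"
    let ?c = "\<lambda>\<rho>. if \<rho> = \<pi> then 1 else 0 :: real"
    have "(\<Sum>\<rho>\<in>B. (\<lambda>y. complex_of_real (?c \<rho>) * \<rho> y)) = (\<Sum>\<rho>\<in>B. if \<rho> = \<pi> then \<pi> else 0)"
      by (rule sum.cong) (auto simp: fun_eq_iff)
    also have "\<dots> = \<pi>" using fin p by simp
    finally have "(\<Sum>\<rho>\<in>B. (\<lambda>y. complex_of_real (?c \<rho>) * \<rho> y)) \<in> V0" using v by simp
    moreover have "\<forall>c::_ \<Rightarrow> real. (\<Sum>\<pi>\<in>B. (\<lambda>x. complex_of_real (c \<pi>) * \<pi> x)) \<in> V0 \<longrightarrow> (\<forall>\<pi>\<in>B. c \<pi> = 0)"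
      using lifted_base by (simp add: lifted_base_def)
    ultimately have "\<forall>\<rho>\<in>B. ?c \<rho> = 0" by (elim allE[of _ ?c] impE)
    then show False using p by auto
  qed
  then show "B \<subseteq> Rx" using BR Rx_iff_V0 by blast
qed

text \<open>Modulo \<open>V0\<close> every root is an integral combination of \<open>B\<close>, so
  orthogonality to \<open>B\<close> is orthogonality to all of \<open>V\<close>.\<close>

lemma orthogonal_B:
  assumes w: "w \<in> V" and orth: "\<And>\<pi>. \<pi> \<in> B \<Longrightarrow> dform w \<pi> = 0" shows "w \<in> V0"
proof -
  let ?Q = "{v \<in> V. dform w v = 0}"
  have sub: "real_fun.subspace ?Q"
    unfolding real_fun.subspace_def by (auto simp: V_zero V_add V_rscale dform_add_right dform_rscale_right)
  have BQ: "B \<subseteq> ?Q" using orth B_Rx Rx_V by auto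
  have "R \<subseteq> ?Q"
  proof
    fix \<alpha> assume a: "\<alpha> \<in> R"
    then obtain n :: "_ \<Rightarrow> nat" where n: "cls \<alpha> = cls (\<Sum>\<pi>\<in>B. (\<lambda>x. of_nat (n \<pi>) * \<pi> x)) \<or>
        cls \<alpha> = cls (- (\<Sum>\<pi>\<in>B. (\<lambda>x. of_nat (n \<pi>) * \<pi> x)))"
      using lifted_base unfolding lifted_base_def by blast
    define b where "b = (\<Sum>\<pi>\<in>B. (\<lambda>x. of_nat (n \<pi>) * \<pi> x))"
    have "(\<lambda>x. complex_of_real (real (n \<pi>)) * \<pi> x) \<in> ?Q" if "\<pi> \<in> B" for \<pi>
      using BQ that by (intro real_fun.subspace_scale[OF sub]) auto
    then have bQ: "b \<in> ?Q" unfolding b_def by (intro real_fun.subspace_sum[OF sub]) simp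
    have "\<alpha> - b \<in> V0 \<or> \<alpha> - (- b) \<in> V0" using n by (simp only: cls_eq_iff b_def[symmetric])
    moreover have V0Q: "V0 \<subseteq> ?Q" using V0_V V0_dform(2) w by auto
    ultimately have "\<alpha> - b \<in> ?Q \<or> \<alpha> - (- b) \<in> ?Q" by blast
    then have "\<alpha> - b + b \<in> ?Q \<or> \<alpha> - (- b) + (- b) \<in> ?Q"
      using real_fun.subspace_add[OF sub _ bQ] real_fun.subspace_add[OF sub _ real_fun.subspace_neg[OF sub bQ]] by blast
    then show "\<alpha> \<in> ?Q" by simp
  qed
  then have "V \<subseteq> ?Q" unfolding V_def[symmetric] using real_fun.span_minimal[OF _ sub] unfolding V_def by blast
  then show ?thesis using w by (auto simp: V0_def)
qed

text \<open>By \<open>orthogonal_B\<close> the class of a root modulo \<open>V0\<close> is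
  determined by its Cartan integers at the finitely many elements of \<open>B\<close>, and these
  integers are bounded.\<close>

lemma finite_classes: "\<exists>C. finite C \<and> C \<subseteq> Rx \<and> (\<forall>\<beta>\<in>Rx. \<exists>\<rho>\<in>C. \<beta> - \<rho> \<in> V0)"
proof -
  define \<phi> where "\<phi> \<beta> = restrict (cartan \<beta>) B" for \<beta>
  have "\<phi> ` Rx \<subseteq> B \<rightarrow>\<^sub>E {- 4..4}" using cartan_bound B_Rx by (auto simp: \<phi>_def)
  then have fin: "finite (\<phi> ` Rx)" by (rule finite_subset) (auto intro: finite_PiE B_Rx)
  then obtain C where C: "C \<subseteq> Rx" "finite C" "\<phi> ` Rx = \<phi> ` C"
    using finite_subset_image[of "\<phi> ` Rx" \<phi> Rx] by blast
  have "\<exists>\<rho>\<in>C. \<beta> - \<rho> \<in> V0" if b: "\<beta> \<in> Rx" for \<beta>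
  proof -
    obtain \<rho> where r: "\<rho> \<in> C" "\<phi> \<beta> = \<phi> \<rho>" using C(3) b by blast
    have "dform (\<beta> - \<rho>) \<pi> = 0" if p: "\<pi> \<in> B" for \<pi>
    proof -
      have "cartan \<beta> \<pi> = cartan \<rho> \<pi>" using fun_cong[OF r(2), of \<pi>] p by (simp add: \<phi>_def)
      then have "dform \<beta> \<pi> = dform \<rho> \<pi>"
        using cartan_dform[of \<beta> \<pi>] cartan_dform[of \<rho> \<pi>] b r(1) C(1) p B_Rx by (auto simp: Rx_R subset_iff)
      then show ?thesis using b r(1) C(1) by (auto simp: dform_diff Rx_V)
    qed
    then have "\<beta> - \<rho> \<in> V0" using b r(1) C(1) by (intro orthogonal_B V_diff) (auto simp: Rx_V)
    then show ?thesis using r(1) by blast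
  qed
  then show ?thesis using C by blast
qed

lemma refl_translate:
  assumes b: "\<beta> \<in> Rx" and bd: "\<beta> + \<delta> \<in> Rx" and g: "\<gamma> \<in> Rx" and d: "\<delta> \<in> V0" "\<gamma> - \<beta> \<in> V0"
  shows "refl (\<beta> + \<delta>) (refl \<beta> \<gamma>) = \<gamma> + (\<delta> + \<delta>)" "refl \<beta> (refl (\<beta> + \<delta>) \<gamma>) = \<gamma> - (\<delta> + \<delta>)"
proof -
  have 1: "cartan \<gamma> \<beta> = 2"
    using cartan_cong[OF Rx_R[OF b] Rx_R[OF g] b b d(2)] V0_zero by (simp add: cartan_self b)
  have 2: "cartan \<gamma> (\<beta> + \<delta>) = 2"
    using cartan_cong[OF Rx_R[OF b] Rx_R[OF g] b bd d(2)] d(1) by (simp add: cartan_self b)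
  have 3: "cartan \<beta> (\<beta> + \<delta>) = 2" "cartan (\<beta> + \<delta>) \<beta> = 2"
    using cartan_cong[OF Rx_R[OF b] Rx_R[OF b] b bd] cartan_cong[OF Rx_R[OF b] Rx_R[OF bd] b b] d(1) V0_zero
    by (simp_all add: cartan_self b)
  show "refl (\<beta> + \<delta>) (refl \<beta> \<gamma>) = \<gamma> + (\<delta> + \<delta>)"
    by (simp add: refl_shift cartan_shift b g bd Rx_R 1 2 3) (simp add: shift_def fun_eq_iff)
  show "refl \<beta> (refl (\<beta> + \<delta>) \<gamma>) = \<gamma> - (\<delta> + \<delta>)"
    by (simp add: refl_shift cartan_shift b g bd Rx_R 1 2 3) (simp add: shift_def fun_eq_iff)
qed

text \<open>Only the parities of the coefficients matter modulo twice the span, so the subset sums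
  of \<open>D\<close> represent all residue classes.\<close>

lemma half_span:
  assumes "finite D" "\<delta> \<in> int_fun.span D"
  shows "\<exists>S\<subseteq>D. \<exists>\<epsilon>\<in>int_fun.span D. \<delta> = (\<Sum>d\<in>S. d) + (\<epsilon> + \<epsilon>)"
proof -
  obtain r :: "_ \<Rightarrow> int" where r: "\<delta> = (\<Sum>d\<in>D. (\<lambda>y. of_int (r d) * d y))"
    using assms(2) unfolding int_fun.span_finite[OF assms(1)] by auto
  define S where "S = {d \<in> D. odd (r d)}"
  define \<epsilon> where "\<epsilon> = (\<Sum>d\<in>D. (\<lambda>y. of_int (r d div 2) * d y))"
  have "\<delta> = (\<Sum>d\<in>D. (if odd (r d) then d else 0) + ((\<lambda>y. of_int (r d div 2) * d y) + (\<lambda>y. of_int (r d div 2) * d y)))"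
    unfolding r
  proof (rule sum.cong[OF refl])
    fix d
    have "k = (if odd k then 1 else 0) + (k div 2 + k div 2)" for k :: int by presburger
    from arg_cong[OF this[of "r d"], of "of_int :: int \<Rightarrow> complex"]
    have "(of_int (r d) :: complex) = (if odd (r d) then 1 else 0) + (of_int (r d div 2) + of_int (r d div 2))"
      by (simp only: of_int_add if_distrib[of of_int] of_int_0 of_int_1)
    then show "(\<lambda>y. of_int (r d) * d y) = (if odd (r d) then d else 0) +
        ((\<lambda>y. of_int (r d div 2) * d y) + (\<lambda>y. of_int (r d div 2) * d y))"
      by (auto simp: fun_eq_iff distrib_right)
  qed
  also have "\<dots> = (\<Sum>d\<in>S. d) + (\<epsilon> + \<epsilon>)"
    unfolding sum.distrib \<epsilon>_def S_def using assms(1) by (simp add: sum.inter_filter)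
  finally have "\<delta> = (\<Sum>d\<in>S. d) + (\<epsilon> + \<epsilon>)" .
  moreover have "\<epsilon> \<in> int_fun.span D"
    unfolding \<epsilon>_def by (intro int_fun.span_sum int_fun.span_scale int_fun.span_base)
  ultimately show ?thesis by (intro exI[of _ S]) (auto simp: S_def)
qed

text \<open>Reflections in \<beta> and \<beta> + d, for \<open>d\<close> in \<open>D\<close>,
  translate the class of \<beta> by twice any element of the span of \<open>D\<close>. There are
  finitely many residue classes modulo these translations, and one root is added for each class that
  contains a root.\<close>

lemma class_generators:
  assumes b: "\<beta> \<in> Rx"
  shows "\<exists>F. finite F \<and> F \<subseteq> Rx \<and> (\<forall>\<Psi>. F \<subseteq> \<Psi> \<and> \<Psi> \<subseteq> Rx \<and> (\<forall>\<gamma>\<in>\<Psi>. \<forall>\<mu>\<in>\<Psi>. refl \<gamma> \<mu> \<in> \<Psi>) \<longrightarrow>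
    (\<forall>\<mu>\<in>Rx. \<mu> - \<beta> \<in> V0 \<longrightarrow> \<mu> \<in> \<Psi>))"
proof -
  define T where "T = {\<delta> \<in> V0. \<beta> + \<delta> \<in> Rx}"
  obtain Q where Q: "finite Q" "int_fun.span Q = int_fun.span R" using A4 by blast
  have TQ: "T \<subseteq> int_fun.span Q"
  proof
    fix \<delta> assume "\<delta> \<in> T"
    then have "\<beta> + \<delta> \<in> int_fun.span R" "\<beta> \<in> int_fun.span R"
      using b by (auto simp: T_def Rx_R intro: int_fun.span_base)
    then show "\<delta> \<in> int_fun.span Q" unfolding Q(2) using int_fun.span_diff[of "\<beta> + \<delta>" R \<beta>] by simp
  qed
  then obtain D where D: "finite D" "D \<subseteq> T" "T \<subseteq> int_fun.span D"
    using int_span_noetherian[OF Q(1) TQ] by blast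
  \<comment> \<open>\<open>E S \<rho>\<close> says that the shift \<rho> leads to a root and has the
    residue of the sum of \<open>S\<close>. That sum itself need not lead to a root, hence the
    choice of \<open>rep S\<close>.\<close>
  define E where "E S \<rho> \<longleftrightarrow> \<rho> \<in> T \<and> (\<exists>\<epsilon>\<in>int_fun.span D. \<rho> = (\<Sum>d\<in>S. d) + (\<epsilon> + \<epsilon>))" for S \<rho>
  define rep where "rep S = (SOME \<rho>. E S \<rho>)" for S
  define F where "F = insert \<beta> ((\<lambda>d. \<beta> + d) ` D \<union> (\<lambda>S. \<beta> + rep S) ` {S. S \<subseteq> D \<and> (\<exists>\<rho>. E S \<rho>)})"
  have rep: "E S (rep S)" if "E S \<rho>" for S \<rho> unfolding rep_def by (rule someI[of "E S", OF that])
  have finF: "finite F" unfolding F_def using D(1) by simp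
  have FRx: "F \<subseteq> Rx" unfolding F_def using D(2) b rep by (auto simp: T_def E_def)
  have main: "\<mu> \<in> \<Psi>" if Psi: "F \<subseteq> \<Psi>" "\<Psi> \<subseteq> Rx" "\<forall>\<gamma>\<in>\<Psi>. \<forall>\<mu>\<in>\<Psi>. refl \<gamma> \<mu> \<in> \<Psi>"
    and mu: "\<mu> \<in> Rx" "\<mu> - \<beta> \<in> V0" for \<Psi> \<mu>
  proof -
    \<comment> \<open>Both directions of translation are required so that \<open>L\<close> is closed
      under negation and becomes a subgroup; it then contains the span of \<open>D\<close> as soon
      as it contains \<open>D\<close>.\<close>
    define L where "L = {\<epsilon> \<in> V0. \<forall>\<gamma>\<in>\<Psi>. \<gamma> - \<beta> \<in> V0 \<longrightarrow> \<gamma> + (\<epsilon> + \<epsilon>) \<in> \<Psi> \<and> \<gamma> - (\<epsilon> + \<epsilon>) \<in> \<Psi>}"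
    have "D \<subseteq> L"
    proof
      fix d assume d: "d \<in> D"
      then have "d \<in> V0" "\<beta> + d \<in> \<Psi>" "\<beta> \<in> \<Psi>" using D(2) Psi(1) by (auto simp: T_def F_def)
      then show "d \<in> L"
        using refl_translate[of \<beta> d] Psi(2,3) unfolding L_def by (auto simp: subset_iff) (metis+)
    qed
    moreover have "int_fun.subspace L"
    proof -
      have add: "x + y \<in> L" if "x \<in> L" "y \<in> L" for x y
      proof -
        have "\<gamma> + (x + y + (x + y)) \<in> \<Psi> \<and> \<gamma> - (x + y + (x + y)) \<in> \<Psi>" if g: "\<gamma> \<in> \<Psi>" "\<gamma> - \<beta> \<in> V0" for \<gamma>
        proof -
          have "\<gamma> + (x + x) \<in> \<Psi>" "\<gamma> - (x + x) \<in> \<Psi>" using \<open>x \<in> L\<close> g by (auto simp: L_def)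
          moreover have "\<gamma> + (x + x) - \<beta> \<in> V0" "\<gamma> - (x + x) - \<beta> \<in> V0"
            using V0_add[OF g(2) V0_add[of x x]] V0_diff[OF g(2) V0_add[of x x]] \<open>x \<in> L\<close>
            by (auto simp: L_def algebra_simps)
          ultimately have "\<gamma> + (x + x) + (y + y) \<in> \<Psi>" "\<gamma> - (x + x) - (y + y) \<in> \<Psi>"
            using \<open>y \<in> L\<close> unfolding L_def by blast+
          then show ?thesis by (simp add: algebra_simps)
        qed
        then show ?thesis using that V0_add by (auto simp: L_def)
      qed
      have neg: "- x \<in> L" if "x \<in> L" for x
        using that V0_minus by (auto simp: L_def)
      have zero: "0 \<in> L" using V0_zero by (simp add: L_def)
      have nat: "(\<lambda>y. of_nat n * x y) \<in> L" if "x \<in> L" for n x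
      proof (induction n)
        case 0
        then show ?case using zero by (simp add: zero_fun_def)
      next
        case (Suc n)
        have "(\<lambda>y. of_nat (Suc n) * x y) = x + (\<lambda>y. of_nat n * x y)" by (auto simp: fun_eq_iff distrib_right)
        then show ?case using add[OF that Suc] by simp
      qed
      have int: "(\<lambda>y. of_int c * x y) \<in> L" if "x \<in> L" for c x
      proof (cases c rule: int_cases2)
        case (nonpos n)
        have "(\<lambda>y. of_int c * x y) = - (\<lambda>y. of_nat n * x y)" by (auto simp: fun_eq_iff nonpos)
        then show ?thesis using neg[OF nat[OF that]] by simp
      qed (use nat[OF that] in simp)
      show ?thesis unfolding int_fun.subspace_def using zero add int by blast
    qed
    ultimately have L: "int_fun.span D \<subseteq> L" by (rule int_fun.span_minimal)
    define \<delta> where "\<delta> = \<mu> - \<beta>"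
    have d: "\<delta> \<in> T" using mu by (simp add: T_def \<delta>_def)
    then obtain S \<epsilon> where S: "S \<subseteq> D" "\<epsilon> \<in> int_fun.span D" "\<delta> = (\<Sum>d\<in>S. d) + (\<epsilon> + \<epsilon>)"
      using half_span[OF D(1), of \<delta>] D(3) by blast
    then have "E S \<delta>" using d by (auto simp: E_def)
    then obtain \<epsilon>' where r: "\<beta> + rep S \<in> \<Psi>" "rep S \<in> T" "\<epsilon>' \<in> int_fun.span D" "rep S = (\<Sum>d\<in>S. d) + (\<epsilon>' + \<epsilon>')"
      using rep[of S \<delta>] Psi(1) S(1) unfolding E_def[of S "rep S"] F_def by blast
    have "\<epsilon> - \<epsilon>' \<in> L" using L int_fun.span_diff[OF S(2) r(3)] by blast
    moreover have "\<beta> + rep S - \<beta> \<in> V0" using r(2) by (simp add: T_def)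
    ultimately have "\<beta> + rep S + (\<epsilon> - \<epsilon>' + (\<epsilon> - \<epsilon>')) \<in> \<Psi>" using r(1) unfolding L_def by blast
    moreover have "\<beta> + rep S + (\<epsilon> - \<epsilon>' + (\<epsilon> - \<epsilon>')) = \<mu>"
      using S(3) unfolding r(4) \<delta>_def by (simp add: algebra_simps)
    ultimately show ?thesis by simp
  qed
  show ?thesis
    by (rule exI[of _ F], intro conjI finF FRx allI impI ballI, elim conjE, rule main; assumption)
qed

lemma reflection_generators:
  obtains F where "finite F" "F \<subseteq> Rx"
    "\<forall>\<Psi>. F \<subseteq> \<Psi> \<and> \<Psi> \<subseteq> Rx \<and> (\<forall>\<gamma>\<in>\<Psi>. \<forall>\<mu>\<in>\<Psi>. refl \<gamma> \<mu> \<in> \<Psi>) \<longrightarrow> \<Psi> = Rx"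
proof -
  obtain C where C: "finite C" "C \<subseteq> Rx" "\<forall>\<beta>\<in>Rx. \<exists>\<rho>\<in>C. \<beta> - \<rho> \<in> V0" using finite_classes by blast
  obtain G where G: "\<forall>\<beta>\<in>Rx. finite (G \<beta>) \<and> G \<beta> \<subseteq> Rx \<and> (\<forall>\<Psi>. G \<beta> \<subseteq> \<Psi> \<and> \<Psi> \<subseteq> Rx \<and>
      (\<forall>\<gamma>\<in>\<Psi>. \<forall>\<mu>\<in>\<Psi>. refl \<gamma> \<mu> \<in> \<Psi>) \<longrightarrow> (\<forall>\<mu>\<in>Rx. \<mu> - \<beta> \<in> V0 \<longrightarrow> \<mu> \<in> \<Psi>))"
    using class_generators by metis
  have G1: "finite (G \<beta>)" "G \<beta> \<subseteq> Rx" if "\<beta> \<in> C" for \<beta> using G C(2) that by blast+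
  have "\<Psi> = Rx" if Psi: "\<Union>(G ` C) \<subseteq> \<Psi>" "\<Psi> \<subseteq> Rx" "\<forall>\<gamma>\<in>\<Psi>. \<forall>\<mu>\<in>\<Psi>. refl \<gamma> \<mu> \<in> \<Psi>" for \<Psi>
  proof -
    have "\<mu> \<in> \<Psi>" if mu: "\<mu> \<in> Rx" for \<mu>
    proof -
      obtain \<rho> where r: "\<rho> \<in> C" "\<mu> - \<rho> \<in> V0" using C(3) mu by blast
      then have "G \<rho> \<subseteq> \<Psi> \<and> \<Psi> \<subseteq> Rx \<and> (\<forall>\<gamma>\<in>\<Psi>. \<forall>\<mu>\<in>\<Psi>. refl \<gamma> \<mu> \<in> \<Psi>)" using Psi by blast
      moreover have "\<rho> \<in> Rx" using r(1) C(2) by blast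
      ultimately show ?thesis using G mu r(2) by blast
    qed
    then show ?thesis using Psi(2) by blast
  qed
  moreover have "finite (\<Union>(G ` C))" "\<Union>(G ` C) \<subseteq> Rx" using C(1) G1 by auto
  ultimately show thesis by (intro that[of "\<Union>(G ` C)"]) auto
qed

end

section \<open>Infinitude and finite generation of the adjoint group\<close>

context eala_K
begin

lemma Ad_group_carrier: "carrier (Ad_group K X) = generate Aut {E \<alpha> c | \<alpha> c. \<alpha> \<in> Rx}"
  by (simp add: Ad_group_def)

lemma infinite_Ad_group: "infinite (carrier (Ad_group K X))"
proof
  assume "finite (carrier (Ad_group K X))"
  moreover have "(\<lambda>\<alpha>. E \<alpha> 1) ` Rx \<subseteq> carrier (Ad_group K X)"
    unfolding Ad_group_carrier by (auto intro!: generate.incl)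
  ultimately have "finite ((\<lambda>\<alpha>. E \<alpha> 1) ` Rx)" by (rule finite_subset[rotated])
  then show False using finite_imageD[OF _ E_inj] infinite_Rx by blast
qed

lemma finitely_generated_Ad_group:
  assumes fin: "finite (UNIV :: 'k set)" shows "finitely_generated (Ad_group K X)"
proof -
  obtain F where F: "finite F" "F \<subseteq> Rx"
    "\<forall>\<Psi>. F \<subseteq> \<Psi> \<and> \<Psi> \<subseteq> Rx \<and> (\<forall>\<gamma>\<in>\<Psi>. \<forall>\<mu>\<in>\<Psi>. refl \<gamma> \<mu> \<in> \<Psi>) \<longrightarrow> \<Psi> = Rx"
    by (rule reflection_generators)
  let ?gens = "{E \<alpha> c | \<alpha> c. \<alpha> \<in> Rx}"
  \<comment> \<open>Both signs are included because \<open>W \<gamma>\<close> involves the root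
    subgroups of \<gamma> and of - \<gamma>; for the same reason the set \<Psi> below asks for
    both.\<close>
  define S where "S = (\<lambda>(\<alpha>, c). E \<alpha> c) ` ((F \<union> uminus ` F) \<times> UNIV)"
  have S: "finite S" "S \<subseteq> ?gens"
    unfolding S_def using F(1,2) fin Rx_minus by (auto intro!: finite_imageI)
  have gens: "?gens \<subseteq> carrier Aut" using E_Aut by auto
  have subS: "subgroup (generate Aut S) Aut" by (rule Aut.generate_is_subgroup) (use S gens in blast)
  define \<Psi> where "\<Psi> = {\<alpha> \<in> Rx. \<forall>c. E \<alpha> c \<in> generate Aut S \<and> E (- \<alpha>) c \<in> generate Aut S}"
  have "\<Psi> = Rx"
  proof (rule F(3)[rule_format], intro conjI ballI)
    show "F \<subseteq> \<Psi>" using F(2) by (auto simp: \<Psi>_def S_def intro!: generate.incl)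
    show "\<Psi> \<subseteq> Rx" by (auto simp: \<Psi>_def)
    fix \<gamma> \<mu> assume "\<gamma> \<in> \<Psi>" "\<mu> \<in> \<Psi>"
    then have *: "\<gamma> \<in> Rx" "\<mu> \<in> Rx" "E \<gamma> c \<in> generate Aut S" "E (- \<gamma>) c \<in> generate Aut S"
      "E \<mu> c \<in> generate Aut S" "E (- \<mu>) c \<in> generate Aut S" for c by (auto simp: \<Psi>_def)
    have "E (refl \<gamma> \<mu>) c \<in> generate Aut S" for c
      by (rule subgroup_refl[OF subS *(1,2,3,4,5)])
    moreover have "E (refl \<gamma> (- \<mu>)) c \<in> generate Aut S" for c
      by (rule subgroup_refl[OF subS *(1) Rx_minus[OF *(2)] *(3,4,6)])
    ultimately show "refl \<gamma> \<mu> \<in> \<Psi>" by (simp add: \<Psi>_def refl_Rx * refl_minus Rx_R)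
  qed
  then have "?gens \<subseteq> generate Aut S" by (auto simp: \<Psi>_def)
  then have "generate Aut ?gens \<subseteq> generate Aut S" by (rule Aut.generate_subgroup_incl[OF _ subS])
  moreover have "generate Aut S \<subseteq> generate Aut ?gens" by (rule Aut.mono_generate[OF S(2)])
  ultimately have eq: "generate Aut S = generate Aut ?gens" by blast
  have G: "Ad_group K X = Aut\<lparr>carrier := generate Aut ?gens\<rparr>" by (simp add: Ad_group_def)
  \<comment> \<open>\<open>finitely_generated\<close> refers to generation inside
    \<open>Ad_group K X\<close>, which agrees with generation inside \<open>Aut\<close>.\<close>
  have "generate (Aut\<lparr>carrier := generate Aut ?gens\<rparr>) S = generate Aut S"
    by (rule Aut.generate_consistent[OF _ Aut.generate_is_subgroup[OF gens]])
      (use S(2) in \<open>auto intro: generate.incl\<close>)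
  then show ?thesis
    unfolding finitely_generated_def G using S eq by (intro exI[of _ S]) (auto intro: generate.incl)
qed

end

theorem theorem8p13:
  fixes scale :: "complex \<Rightarrow> 'g::ab_group_add \<Rightarrow> 'g"
    and lie :: "'g \<Rightarrow> 'g \<Rightarrow> 'g"
    and form :: "'g \<Rightarrow> 'g \<Rightarrow> complex"
    and H :: "'g set"
    and B :: "('g \<Rightarrow> complex) set"
    and \<sigma> :: "('g \<Rightarrow> complex) \<Rightarrow> ('g \<Rightarrow> complex) \<Rightarrow> complex"
    and scaleL :: "complex \<Rightarrow> 'l::ab_group_add \<Rightarrow> 'l"
    and lieL :: "'l \<Rightarrow> 'l \<Rightarrow> 'l"
    and \<tau> :: "'g \<Rightarrow> 'g"
    and x :: "('g \<Rightarrow> complex) \<Rightarrow> 'g"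
    and p :: nat
  assumes "eala scale lie form H"
    and "eala_data.tame scale lie form H"
    and "eala_data.reduced scale lie form H"
    and "eala_data.rank scale lie form H > 1"
    and "eala_data.nullity scale lie form H \<ge> 1"
    and "eala_data.lifted_base scale lie form H B"
    and "eala_data.coordinatized scale lie form H B \<sigma> scaleL lieL"
    and "eala_data.elementary scale lie form H \<sigma>"
    and "eala_data.chevalley_automorphism scale lie H \<tau>"
    and "eala_data.chevalley_system scale lie form H \<tau> x"
    and "prime p" and "CHAR('k::field) = p"
  shows "infinite (carrier (eala_data.Ad_group scale lie form H TYPE('k) x)) \<and>
         (finite (UNIV :: 'k set) \<and> p \<ge> 5 \<longrightarrow>
           finitely_generated (eala_data.Ad_group scale lie form H TYPE('k) x))"
proof -
  interpret eala scale lie form H by (rule assms(1))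
  interpret eala_K scale lie form H \<tau> x B "TYPE('k)"
    by unfold_locales (use assms in auto)
  show ?thesis using infinite_Ad_group finitely_generated_Ad_group by blast
qed

end
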